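(* For every ordinal $\alpha<\kappa(\omega)$ (every ordinal $\alpha$, if $\kappa(\omega)$ does not exist), $\mathrm{TFAG}$ fails the $\alpha$-ary Schröder–Bernstein property.
   Context: $\kappa(\omega)$ is the least cardinal $\kappa$ with $\kappa\to(\omega)^{<\omega}_2$. $\mathrm{TFAG}$ is the theory of torsion-free abelian groups, with embeddings being injective group homomorphisms. For structures $M,N$ and tuples $\bar a,\bar b$: $(M,\bar a)\leq(N,\bar b)$ means there is an embedding $f:M\to N$ with $f(\bar a)=\bar b$; $(M,\bar a)\sim(N,\bar b)$ means $\leq$ both ways. Inductively: $\sim_0$ is $\sim$; for limit $\delta$, $\sim_\delta$ iff $\sim_\beta$ for all $\beta<\delta$; $(M,\bar a)\sim_{\beta+1}(N,\bar b)$ iff every $a\in M$ has some $b\in N$ with $(M,\bar a a)\sim_\beta(N,\bar b b)$, and vice versa. $M\sim_\alpha N$ means $(M,\emptyset)\sim_\alpha(N,\emptyset)$. A pinned name for a model of $\Phi$ is $(P,\dot M)$ with $P$ a forcing notion, $P\Vdash\dot M\in\mathrm{Mod}(\check\Phi)$ (models with universe $\mathbb{N}$), and $P\times P\Vdash\dot M_0\cong\dot M_1$. $(P,\dot M)\sim_\alpha(Q,\dot N)$ means $P\times Q\times R\Vdash\dot M\sim_\alpha\dot N$ for some/any forcing $R$ collapsing $\alpha,P,Q,\dot M,\dot N$ to be countable; $(P,\dot M)\cong(Q,\dot N)$ means $P\times Q\Vdash\dot M\cong\dot N$. $\Phi$ has the $\alpha$-ary Schröder–Bernstein property if $(P,\dot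 M)\sim_\alpha(Q,\dot N)$ implies $(P,\dot M)\cong(Q,\dot N)$ for all pinned names for models of $\Phi$ (for countable $\alpha$ this is equivalent to: for countable $M,N\models\Phi$, $M\sim_\alpha N$ implies $M\cong N$). *)

theory Defs
  imports "HOL-Library.Ramsey"
begin

unbundle cardinal_syntax

section \<open>The cardinal \<open>\<kappa>(\<omega>)\<close>\<close>

text \<open>
  Ordinals and cardinals are well-orders and cardinal orders (\<^const>\<open>card_order_on\<close>),
  compared up to isomorphism by \<open>\<le>o\<close>, \<open><o\<close>, \<open>=o\<close>. The partition relation
  \<open>\<kappa> \<rightarrow> (\<omega>)\<^sup><\<^sup>\<omega>\<^sub>2\<close>: the values of the colouring \<open>f\<close> at infinite sets are irrelevant.
\<close>

definition arrow_omega :: "'a rel \<Rightarrow> bool" where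
  "arrow_omega \<kappa> \<longleftrightarrow>
     (\<forall>f :: 'a set \<Rightarrow> bool. \<exists>H \<subseteq> Field \<kappa>. Restr \<kappa> H =o natLeq \<and>
        (\<forall>n. \<exists>c. \<forall>A \<in> nsets H n. f A = c))"

text \<open>
  Every cardinal below a cardinal carried by \<open>'a\<close> is itself carried by \<open>'a\<close>, so leastness
  among the cardinals of type \<open>'a rel\<close> is leastness among all cardinals.
\<close>

definition is_kappa_omega :: "'a rel \<Rightarrow> bool" where
  "is_kappa_omega \<kappa> \<longleftrightarrow> Card_order \<kappa> \<and> arrow_omega \<kappa> \<and>
     (\<forall>\<kappa>' :: 'a rel. Card_order \<kappa>' \<and> arrow_omega \<kappa>' \<longrightarrow> \<kappa> \<le>o \<kappa>')"


section \<open>Forcing\<close>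

text \<open>
  A forcing notion is a nonempty preorder with carrier \<^term>\<open>Field P\<close>; \<open>(q, p) \<in> P\<close> means
  that \<open>q\<close> is stronger than \<open>p\<close>. Statements of the forcing language are represented by their
  forcing relation, a predicate on conditions; conjunction and universal quantification
  (over elements of ground model sets) are pointwise, and the remaining connectives are the
  usual clauses of the definition of forcing.
\<close>

definition forcing_notion :: "'p rel \<Rightarrow> bool" where
  "forcing_notion P \<longleftrightarrow> Field P \<noteq> {} \<and> preorder_on (Field P) P"

definition fnot :: "'p rel \<Rightarrow> ('p \<Rightarrow> bool) \<Rightarrow> 'p \<Rightarrow> bool" where
  "fnot P \<phi> p \<longleftrightarrow> (\<forall>q. (q, p) \<in> P \<longrightarrow> \<not> \<phi> q)"

definition fimp :: "'p rel \<Rightarrow> ('p \<Rightarrow> bool) \<Rightarrow> ('p \<Rightarrow> bool) \<Rightarrow> 'p \<Rightarrow> bool" where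
  "fimp P \<phi> \<psi> p \<longleftrightarrow> (\<forall>q. (q, p) \<in> P \<longrightarrow> \<phi> q \<longrightarrow> \<psi> q)"

definition fex :: "'p rel \<Rightarrow> ('x \<Rightarrow> 'p \<Rightarrow> bool) \<Rightarrow> 'p \<Rightarrow> bool" where
  "fex P \<phi> p \<longleftrightarrow> (\<forall>q. (q, p) \<in> P \<longrightarrow> (\<exists>r. (r, q) \<in> P \<and> (\<exists>x. \<phi> x r)))"

lemma fex_mono [mono]:
  "(\<And>x p. \<phi> x p \<longrightarrow> \<psi> x p) \<Longrightarrow> fex P \<phi> p \<longrightarrow> fex P \<psi> p"
  unfolding fex_def by meson

definition forced :: "'p rel \<Rightarrow> ('p \<Rightarrow> bool) \<Rightarrow> bool" where
  "forced P \<phi> \<longleftrightarrow> (\<forall>p \<in> Field P. \<phi> p)"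

text \<open>
  A name for a subset of a ground model set \<open>X\<close> is a set of pairs \<open>(x, s)\<close> with \<open>x \<in> X\<close> and
  \<open>s\<close> a condition; its value at a generic \<open>G\<close> is \<open>{x. \<exists>s \<in> G. (x, s) \<in> \<tau>}\<close>. Every subset of \<open>X\<close>
  in the extension has such a name, so quantification over subsets of \<open>X\<close> in the
  forcing language is quantification over these names.
\<close>

type_synonym ('x, 'p) name = "('x \<times> 'p) set"

definition is_name :: "'p rel \<Rightarrow> ('x, 'p) name \<Rightarrow> bool" where
  "is_name P \<tau> \<longleftrightarrow> snd ` \<tau> \<subseteq> Field P"

definition forces_in :: "'p rel \<Rightarrow> 'x \<Rightarrow> ('x, 'p) name \<Rightarrow> 'p \<Rightarrow> bool" where
  "forces_in P x \<tau> p \<longleftrightarrow>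
     (\<forall>q. (q, p) \<in> P \<longrightarrow> (\<exists>r. (r, q) \<in> P \<and> (\<exists>s. (x, s) \<in> \<tau> \<and> (r, s) \<in> P)))"

definition prod_forcing :: "'p rel \<Rightarrow> 'q rel \<Rightarrow> ('p \<times> 'q) rel"  (infixr "\<otimes>" 80) where
  "P \<otimes> Q = {((p', q'), (p, q)) | p' q' p q. (p', p) \<in> P \<and> (q', q) \<in> Q}"

text \<open>
  A name for one factor of a product, regarded as a name for the product \<open>P\<close>; here \<open>\<pi>\<close> is
  the projection to that factor.
\<close>

definition lift_name :: "'p rel \<Rightarrow> ('p \<Rightarrow> 'q) \<Rightarrow> ('x, 'q) name \<Rightarrow> ('x, 'p) name" where
  "lift_name P \<pi> \<tau> = {(x, u). u \<in> Field P \<and> (x, \<pi> u) \<in> \<tau>}"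

text \<open>The name \<open>f\<close> is forced to restrict to an injective function from \<open>A\<close> to \<open>\<nat>\<close>.\<close>

definition forces_injection ::
    "'p rel \<Rightarrow> 'x set \<Rightarrow> ('x \<times> nat, 'p) name \<Rightarrow> 'p \<Rightarrow> bool" where
  "forces_injection P A f p \<longleftrightarrow>
     (\<forall>a \<in> A. fex P (\<lambda>b. forces_in P (a, b) f) p) \<and>
     (\<forall>a \<in> A. \<forall>b b'. b \<noteq> b' \<longrightarrow>
        fnot P (\<lambda>q. forces_in P (a, b) f q \<and> forces_in P (a, b') f q) p) \<and>
     (\<forall>a \<in> A. \<forall>a' \<in> A. \<forall>b. a \<noteq> a' \<longrightarrow>
        fnot P (\<lambda>q. forces_in P (a, b) f q \<and> forces_in P (a', b) f q) p)"

definition collapses :: "'p rel \<Rightarrow> 'x set \<Rightarrow> bool" where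
  "collapses P A \<longleftrightarrow>
     forced P (fex P (\<lambda>f q. is_name P f \<and> forces_injection P A f q))"


section \<open>Names for groups with universe \<open>\<nat>\<close>\<close>

text \<open>
  A structure with universe \<open>\<nat>\<close> is given by the graph of its addition,
  \<open>{(a, b, c). a + b = c}\<close>; zero and negation are definable from it and are
  preserved by every map preserving addition between groups.
\<close>

type_synonym 'p gname = "(nat \<times> nat \<times> nat, 'p) name"

definition forces_zero :: "'p rel \<Rightarrow> 'p gname \<Rightarrow> nat \<Rightarrow> 'p \<Rightarrow> bool" where
  "forces_zero P M z p \<longleftrightarrow> (\<forall>a. forces_in P (z, a, a) M p)"

text \<open>\<open>forces_multiple P M n a c p\<close>: \<open>p\<close> forces \<open>n \<cdot> a = c\<close>.\<close>

primrec forces_multiple :: "'p rel \<Rightarrow> 'p gname \<Rightarrow> nat \<Rightarrow> nat \<Rightarrow> nat \<Rightarrow> 'p \<Rightarrow> bool" where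
  "forces_multiple P M 0 a c = forces_zero P M c"
| "forces_multiple P M (Suc n) a c =
     fex P (\<lambda>d q. forces_multiple P M n a d q \<and> forces_in P (d, a, c) M q)"

text \<open>The conjuncts: totality and single-valuedness of addition; associativity;
  commutativity; neutral element and inverses; torsion-freeness.\<close>

definition TFAG :: "'p rel \<Rightarrow> 'p gname \<Rightarrow> 'p \<Rightarrow> bool" where
  "TFAG P M p \<longleftrightarrow>
     (\<forall>a b. fex P (\<lambda>c. forces_in P (a, b, c) M) p) \<and>
     (\<forall>a b c c'. c \<noteq> c' \<longrightarrow>
        fnot P (\<lambda>q. forces_in P (a, b, c) M q \<and> forces_in P (a, b, c') M q) p) \<and>
     (\<forall>a b c u v w.
        fimp P (\<lambda>q. forces_in P (a, b, u) M q \<and> forces_in P (b, c, v) M q \<and>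
                    forces_in P (u, c, w) M q)
               (forces_in P (a, v, w) M) p) \<and>
     (\<forall>a b c. fimp P (forces_in P (a, b, c) M) (forces_in P (b, a, c) M) p) \<and>
     fex P (\<lambda>z q. forces_zero P M z q \<and>
                  (\<forall>a. fex P (\<lambda>b. forces_in P (a, b, z) M) q)) p \<and>
     (\<forall>n a z. n > 0 \<longrightarrow>
        fimp P (\<lambda>q. forces_zero P M z q \<and> forces_multiple P M n a z q)
               (forces_zero P M a) p)"

text \<open>\<open>f\<close> is forced to be an embedding, respectively an isomorphism, of \<open>M\<close> into \<open>N\<close>.\<close>

definition forces_embedding ::
    "'p rel \<Rightarrow> 'p gname \<Rightarrow> 'p gname \<Rightarrow> (nat \<times> nat, 'p) name \<Rightarrow> 'p \<Rightarrow> bool" where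
  "forces_embedding P M N f p \<longleftrightarrow> forces_injection P UNIV f p \<and>
     (\<forall>a b c a' b' c'.
        fimp P (\<lambda>q. forces_in P (a, b, c) M q \<and> forces_in P (a, a') f q \<and>
                    forces_in P (b, b') f q \<and> forces_in P (c, c') f q)
               (forces_in P (a', b', c') N) p)"

definition forces_isomorphism ::
    "'p rel \<Rightarrow> 'p gname \<Rightarrow> 'p gname \<Rightarrow> (nat \<times> nat, 'p) name \<Rightarrow> 'p \<Rightarrow> bool" where
  "forces_isomorphism P M N f p \<longleftrightarrow> forces_embedding P M N f p \<and>
     (\<forall>b. fex P (\<lambda>a. forces_in P (a, b) f) p)"

definition forces_iso :: "'p rel \<Rightarrow> 'p gname \<Rightarrow> 'p gname \<Rightarrow> 'p \<Rightarrow> bool" where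
  "forces_iso P M N =
     fex P (\<lambda>f q. is_name P f \<and> forces_isomorphism P M N f q)"

definition forces_embeds ::
    "'p rel \<Rightarrow> 'p gname \<Rightarrow> nat list \<Rightarrow> 'p gname \<Rightarrow> nat list \<Rightarrow> 'p \<Rightarrow> bool" where
  "forces_embeds P M as N bs p \<longleftrightarrow> length as = length bs \<and>
     fex P (\<lambda>f q. is_name P f \<and> forces_embedding P M N f q \<and>
                  (\<forall>i < length as. forces_in P (as ! i, bs ! i) f q)) p"

text \<open>
  The relation \<open>p \<tturnstile>\<^sub>P (M, as) \<sim>\<^sub>\<beta> (N, bs)\<close>, by recursion on the well-order \<open>\<beta>\<close>:
  \<open>\<beta>\<close> is zero, has a greatest element \<open>x\<close> (and is the successor of its restriction to the
  elements below \<open>x\<close>), or is a limit. Ordinals smaller than \<open>\<beta>\<close> are represented by the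
  proper initial segments of \<open>\<beta>\<close>.
\<close>

inductive forces_sim ::
    "'p rel \<Rightarrow> 'p gname \<Rightarrow> 'p gname \<Rightarrow> 'a rel \<Rightarrow> nat list \<Rightarrow> nat list \<Rightarrow> 'p \<Rightarrow> bool"
  for P :: "'p rel" and M N :: "'p gname" where
  zero: "forces_sim P M N {} as bs p"
    if "forces_embeds P M as N bs p" and "forces_embeds P N bs M as p"
| succ: "forces_sim P M N \<beta> as bs p"
    if "Well_order \<beta>" and "x \<in> Field \<beta>" and "\<forall>y \<in> Field \<beta>. (y, x) \<in> \<beta>"
      and "\<forall>a. fex P (\<lambda>b. forces_sim P M N (Restr \<beta> (underS \<beta> x)) (as @ [a]) (bs @ [b])) p"
      and "\<forall>b. fex P (\<lambda>a. forces_sim P M N (Restr \<beta> (underS \<beta> x)) (as @ [a]) (bs @ [b])) p"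
| lim: "forces_sim P M N \<beta> as bs p"
    if "Well_order \<beta>" and "\<beta> \<noteq> {}" and "\<not> (\<exists>x \<in> Field \<beta>. \<forall>y \<in> Field \<beta>. (y, x) \<in> \<beta>)"
      and "\<forall>x \<in> Field \<beta>. forces_sim P M N (Restr \<beta> (underS \<beta> x)) as bs p"


section \<open>Pinned names and the Schroeder-Bernstein property\<close>

text \<open>
  A sentence \<open>\<Phi>\<close> in the language of groups enters only through the relation
  ``\<open>p\<close> forces that \<open>M\<close> is a model of \<open>\<Phi>\<close>''; \<^const>\<open>TFAG\<close> is the instance of interest.
\<close>

definition pinned_name ::
    "('p rel \<Rightarrow> 'p gname \<Rightarrow> 'p \<Rightarrow> bool) \<Rightarrow> 'p rel \<Rightarrow> 'p gname \<Rightarrow> bool" where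
  "pinned_name \<Phi> P M \<longleftrightarrow> forcing_notion P \<and> is_name P M \<and> forced P (\<Phi> P M) \<and>
     (let PP = P \<otimes> P in
        forced PP (forces_iso PP (lift_name PP fst M) (lift_name PP snd M)))"

definition pinned_iso :: "'p rel \<Rightarrow> 'p gname \<Rightarrow> 'q rel \<Rightarrow> 'q gname \<Rightarrow> bool" where
  "pinned_iso P M Q N \<longleftrightarrow>
     (let PQ = P \<otimes> Q in
        forced PQ (forces_iso PQ (lift_name PQ fst M) (lift_name PQ snd N)))"

text \<open>
  The truth of the forced statement does not depend on the choice of the collapsing forcing
  \<open>R\<close>; existence of \<open>R\<close> is asserted so that the relation is never vacuously true. If \<open>'v\<close>
  is infinite, it carries a suitable \<open>R\<close>, e.g. finite partial functions.
\<close>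

definition pinned_sim ::
    "'v rel \<Rightarrow> 'v rel \<Rightarrow> 'v gname \<Rightarrow> 'v rel \<Rightarrow> 'v gname \<Rightarrow> bool" where
  "pinned_sim \<alpha> P M Q N \<longleftrightarrow>
     (\<exists>R :: 'v rel. forcing_notion R \<and>
        collapses R (Field \<alpha>) \<and> collapses R (Field P) \<and> collapses R (Field Q) \<and>
        collapses R M \<and> collapses R N \<and>
        (let PQR = P \<otimes> Q \<otimes> R in
           forced PQR (forces_sim PQR (lift_name PQR fst M)
                                      (lift_name PQR (fst \<circ> snd) N) \<alpha> [] [])))"

text \<open>
  The type \<open>'v\<close> is the universe of discourse, carrying the ordinal \<open>\<alpha>\<close> and the conditions of
  all forcing notions considered.
\<close>

definition schroeder_bernstein ::
    "('v rel \<Rightarrow> 'v gname \<Rightarrow> 'v \<Rightarrow> bool) \<Rightarrow> 'v rel \<Rightarrow> bool" where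
  "schroeder_bernstein \<Phi> \<alpha> \<longleftrightarrow>
     (\<forall>P M Q N. pinned_name \<Phi> P M \<and> pinned_name \<Phi> Q N \<and> pinned_sim \<alpha> P M Q N
        \<longrightarrow> pinned_iso P M Q N)"

end

theory Submission
  imports
    Defs
    "HOL-Number_Theory.Number_Theory"
    "HOL-Library.Poly_Mapping"
    "HOL-Library.Sublist"
    "HOL-Library.Countable_Set"
begin

text \<open>The obstacle is that there are only countably many primes, while the tree may be
  uncountable, so a label cannot have a prime of its own. Instead words of labels are coded:
  countably many predicates on words, and the relation between a word and its one-label extensions.
  A label is then recognised through the infinite sequences of labels that start with it. The second
  component of a basis vector makes room for the embeddings. The vectors with a direction span a
  part that every homomorphism preserves (index \<open>Wp\<close>), and modulo that part an
  isomorphism acts on a one-label word by a scalar. The modulus is \<open>9\<close> because passing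
  the discrepancy from a node to a child costs a multiple of \<open>3\<close>: the tie at
  \<open>3\<close> has to notice such a multiple, yet a factor \<open>1 \<plusminus> 3\<close> must
  be able to repair it. Primes \<open>q\<close> with \<open>q mod 9 = 1\<close> may be inverted
  freely, since the units so created are \<open>\<plusminus>1\<close> modulo \<open>9\<close>; at
  all other primes except \<open>3\<close> the coefficients are simply integral.\<close>

text \<open>
  Let \<open>T\<close> be the tree of finite sequences descending in \<open>\<alpha>\<close>. Two subgroups \<open>G\<^sub>0, G\<^sub>1\<close> of a rational vector
  space are cut out by integrality conditions on functionals. Conditions at primes \<open>q \<equiv> 1\<close> mod \<open>9\<close> encode
  relations on the basis, since the elements infinitely divisible by \<open>q\<close> are preserved by every homomorphism.
  As \<open>\<alpha> < \<kappa>(\<omega>)\<close>, countably many relations suffice to make the coded structure rigid, so that an isomorphism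
  \<open>G\<^sub>0 \<cong> G\<^sub>1\<close> multiplies the basis vectors attached to nodes by units, which are \<open>\<plusminus>1\<close> mod \<open>9\<close>, up to terms
  pointing in the direction of other nodes. The conditions at \<open>3\<close> differ for \<open>G\<^sub>0\<close> and \<open>G\<^sub>1\<close> at the root only, and
  they force such an isomorphism to pass this discrepancy from each node to one of its children. This
  produces an infinite branch of \<open>T\<close>, which does not exist.

  Embeddings, however, may stop at any node \<open>t\<close> by means of the factor \<open>1 \<plusminus> 3\<close>. The resulting map \<open>G\<^sub>0 \<rightarrow> G\<^sub>1\<close> has
  an embedding \<open>G\<^sub>1 \<rightarrow> G\<^sub>0\<close> as inverse on all elements whose support avoids \<open>t\<close>, and on those it does not change
  when \<open>t\<close> is prolonged. Prolonging \<open>t\<close> at each move wins the back-and-forth game of length \<open>\<alpha>\<close>.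

  Enumerating \<open>G\<^sub>j\<close> generically by finite injective sequences yields the pinned names. A forced isomorphism
  between them restricts to countable subgroups in the ground model, to which the branch argument applies.
\<close>

section \<open>Integrality at a prime\<close>

text \<open>Membership in the localisation of the integers at \<open>p\<close>; the fraction need
  not be reduced.\<close>

definition int_at :: "nat \<Rightarrow> rat \<Rightarrow> bool" where
  "int_at p x \<longleftrightarrow> (\<exists>a b :: int. \<not> int p dvd b \<and> x * of_int b = of_int a)"

lemma int_at_of_int [simp]: "prime p \<Longrightarrow> int_at p (of_int a)"
  unfolding int_at_def by (rule exI[of _ a], rule exI[of _ 1]) (auto dest: prime_gt_1_nat)

lemma int_at_0 [simp]: "prime p \<Longrightarrow> int_at p 0"
  using int_at_of_int[of p 0] by simp

lemma int_at_add:
  assumes p: "prime p" and x: "int_at p x" and y: "int_at p y"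
  shows "int_at p (x + y)"
proof -
  from x obtain a b where ab: "\<not> int p dvd b" "x * of_int b = of_int a" unfolding int_at_def by blast
  from y obtain c d where cd: "\<not> int p dvd d" "y * of_int d = of_int c" unfolding int_at_def by blast
  have "\<not> int p dvd b * d" using p ab cd by (simp add: prime_dvd_mult_iff)
  moreover have "(x + y) * of_int (b * d) = of_int (a * d + c * b)"
    using ab(2)[symmetric] cd(2)[symmetric] by (simp add: algebra_simps)
  ultimately show ?thesis unfolding int_at_def by blast
qed

lemma int_at_mult:
  assumes p: "prime p" and x: "int_at p x" and y: "int_at p y"
  shows "int_at p (x * y)"
proof -
  from x obtain a b where ab: "\<not> int p dvd b" "x * of_int b = of_int a" unfolding int_at_def by blast
  from y obtain c d where cd: "\<not> int p dvd d" "y * of_int d = of_int c" unfolding int_at_def by blast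
  have "\<not> int p dvd b * d" using p ab cd by (simp add: prime_dvd_mult_iff)
  moreover have "(x * y) * of_int (b * d) = of_int (a * c)"
    using ab(2)[symmetric] cd(2)[symmetric] by (simp add: algebra_simps)
  ultimately show ?thesis unfolding int_at_def by blast
qed

lemma int_at_minus: "prime p \<Longrightarrow> int_at p x \<Longrightarrow> int_at p (- x)"
  using int_at_mult[of p "of_int (-1)" x] int_at_of_int[of p "-1"] by simp

lemma int_at_diff: "prime p \<Longrightarrow> int_at p x \<Longrightarrow> int_at p y \<Longrightarrow> int_at p (x - y)"
  using int_at_add[of p x "- y"] int_at_minus by simp

lemma int_at_sum: "prime p \<Longrightarrow> (\<And>a. a \<in> A \<Longrightarrow> int_at p (f a)) \<Longrightarrow> int_at p (sum f A)"
  by (induction A rule: infinite_finite_induct) (auto intro: int_at_add)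

lemma int_at_divide:
  assumes p: "prime p" and x: "int_at p x" and d: "\<not> int p dvd d"
  shows "int_at p (x / of_int d)"
proof -
  have d0: "d \<noteq> 0" using d by auto
  have "int_at p (1 / of_int d)" unfolding int_at_def using d d0
    by (intro exI[of _ 1] exI[of _ d]) auto
  from int_at_mult[OF p x this] show ?thesis by simp
qed

lemma int_at_numeral_divide_iff:
  assumes "prime p"
  shows "int_at p (of_int k / of_nat p) \<longleftrightarrow> int p dvd k"
proof
  assume "int_at p (of_int k / of_nat p)"
  then obtain a b where ab: "\<not> int p dvd b" "of_int k / of_nat p * of_int b = (of_int a :: rat)"
    unfolding int_at_def by blast
  have "(of_nat p :: rat) \<noteq> 0" using assms prime_gt_0_nat[OF assms] by simp
  with ab(2) have "(of_int (k * b) :: rat) = of_int (int p * a)"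
    by (simp add: field_simps)
  hence "k * b = int p * a" using of_int_eq_iff by blast
  hence "int p dvd k * b" by simp
  thus "int p dvd k" using ab(1) assms by (simp add: prime_dvd_mult_iff)
next
  assume "int p dvd k"
  then obtain c where "k = int p * c" by blast
  moreover have "(of_nat p :: rat) \<noteq> 0" using assms prime_gt_0_nat[OF assms] by simp
  ultimately show "int_at p (of_int k / of_nat p)" using int_at_of_int[OF assms, of c] by simp
qed

text \<open>The numerator would be divisible by every power of \<open>p\<close>. This turns
  divisibility, which homomorphisms preserve, into the vanishing of functionals.\<close>

lemma infinitely_divisible_imp_0:
  assumes p: "prime p" and x: "\<And>n. int_at p (x / of_nat p ^ n)"
  shows "x = 0"
proof (rule ccontr)
  assume x0: "x \<noteq> 0"
  from x[of 0] obtain a b where ab: "\<not> int p dvd b" "x * of_int b = of_int a"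
    unfolding int_at_def by auto
  have b0: "b \<noteq> 0" using ab by auto
  have a0: "a \<noteq> 0" using ab(2) x0 b0 by auto
  have "int p ^ n dvd a" for n
  proof -
    obtain c d where cd: "\<not> int p dvd d" "x / of_nat p ^ n * of_int d = of_int c"
      using x[of n] unfolding int_at_def by blast
    have pn: "(of_nat p ^ n :: rat) \<noteq> 0" using prime_gt_0_nat[OF p] by simp
    have xd: "x * of_int d = of_nat p ^ n * of_int c"
      using cd(2) pn by (simp add: field_simps)
    have "(of_int (a * d) :: rat) = x * of_int b * of_int d" using ab(2) by simp
    also have "\<dots> = (x * of_int d) * of_int b" by simp
    also have "\<dots> = of_int (int p ^ n * (c * b))" unfolding xd by (simp add: algebra_simps)
    finally have "a * d = int p ^ n * (c * b)" using of_int_eq_iff by blast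
    hence "int p ^ n dvd a * d" by simp
    moreover have "coprime (int p ^ n) d"
      using cd(1) p by (simp add: coprime_power_left_iff prime_imp_coprime)
    ultimately show ?thesis using coprime_dvd_mult_left_iff by blast
  qed
  hence "infinite {n. int p ^ n dvd a}" by simp
  moreover have "finite {n. int p ^ n dvd a}"
    using finite_divisor_powers[OF a0, of "int p"] p prime_gt_1_nat[OF p] by simp
  ultimately show False by simp
qed

text \<open>Euclid's argument with the cyclotomic polynomial of order 9, evaluated at
  \<open>x = 3 * fact N\<close>. A prime factor \<open>q\<close> of the value does not divide
  \<open>x\<close>, so \<open>q > N\<close> and \<open>q \<noteq> 3\<close>; then
  \<open>x ^ 9\<close> but not \<open>x ^ 3\<close> is \<open>1\<close> modulo \<open>q\<close>, and
  the order 9 of \<open>x\<close> divides \<open>q - 1\<close>.\<close>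

lemma primes_1_mod_9_infinite: "infinite {q :: nat. prime q \<and> q mod 9 = 1}"
  unfolding infinite_nat_iff_unbounded_le
proof
  fix N :: nat
  define x :: nat where "x = 3 * fact N"
  define y where "y = x ^ 6 + x ^ 3 + 1"
  have "y \<noteq> 1" unfolding y_def x_def by simp
  then obtain q where q: "prime q" "q dvd y" using prime_factor_nat by blast
  have qx: "\<not> q dvd x"
  proof
    assume "q dvd x"
    hence "q dvd x ^ 6 + x ^ 3" by (simp add: dvd_add dvd_power dvd_trans)
    hence "q dvd 1" using q(2) unfolding y_def by (metis dvd_add_right_iff)
    thus False using q by auto
  qed
  have q3: "q \<noteq> 3" using qx unfolding x_def by auto
  have qN: "q > N"
  proof (rule ccontr)
    assume "\<not> q > N"
    hence "q dvd fact N" using q by (simp add: prime_dvd_fact_iff)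
    thus False using qx unfolding x_def by simp
  qed
  have id: "int (x ^ 9) - 1 = (int (x ^ 3) - 1) * int y"
    unfolding y_def by (simp add: power_numeral_reduce algebra_simps)
  have "int q dvd int (x ^ 9) - 1" unfolding id using q(2) by simp
  hence c9: "[x ^ 9 = 1] (mod q)" unfolding cong_int_iff[symmetric] by (simp add: cong_iff_dvd_diff)
  have n3: "\<not> [x ^ 3 = 1] (mod q)"
  proof
    assume a: "[x ^ 3 = 1] (mod q)"
    have "[(x ^ 3) ^ 2 + x ^ 3 + 1 = 1 ^ 2 + 1 + 1] (mod q)"
      using a by (intro cong_add cong_pow) auto
    moreover have "(x ^ 3) ^ 2 = x ^ 6" by (simp flip: power_mult)
    ultimately have "[y = 3] (mod q)" unfolding y_def by (simp add: numeral_3_eq_3)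
    hence "q dvd 3" using q(2) by (meson cong_dvd_iff)
    hence "q \<le> 3" by (auto dest: dvd_imp_le)
    hence "q \<in> {0, 1, 2, 3}" by auto
    hence "q = 3" using q(1) \<open>q dvd 3\<close> by auto
    thus False using q3 by simp
  qed
  have three_prime: "prime (3 :: nat)" by simp
  have "ord q x dvd 9" using c9 ord_divides[of x 9 q] by blast
  hence "ord q x dvd 3 ^ 2" by simp
  then obtain i where i: "i \<le> 2" "ord q x = 3 ^ i"
    using divides_primepow_nat[of 3 "ord q x" 2] three_prime by blast
  have "\<not> ord q x dvd 3" using n3 ord_divides[of x 3 q] by blast
  hence "i \<noteq> 0" "i \<noteq> 1" unfolding i(2) by (auto intro: gr0I)
  hence "i = 2" using i(1) by linarith
  hence "ord q x = 9" using i(2) by simp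
  moreover have "ord q x dvd totient q"
  proof -
    have "coprime q x" using prime_imp_coprime[OF q(1) qx] .
    thus ?thesis by (rule order_divides_totient)
  qed
  ultimately have "9 dvd q - 1" using q(1) by (simp add: totient_prime)
  then obtain k where "q - 1 = 9 * k" by blast
  hence "q = 9 * k + 1" using prime_gt_1_nat[OF q(1)] by linarith
  hence "q mod 9 = 1" by simp
  thus "\<exists>n\<ge>N. n \<in> {q. prime q \<and> q mod 9 = 1}" using q qN by (intro exI[of _ q]) auto
qed

text \<open>Denominators are only controlled away from the primes congruent to 1 mod 9, so that the
  units of the resulting ring are still \<open>\<plusminus>1\<close> mod 9.\<close>

lemma mod_9_eq_1_if_prime_factors:
  fixes n :: nat
  assumes "n \<noteq> 0" "\<And>q. prime q \<Longrightarrow> q dvd n \<Longrightarrow> q mod 9 = 1"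
  shows "n mod 9 = 1"
  using assms
proof (induction n rule: less_induct)
  case (less n)
  show ?case
  proof (cases "n = 1")
    case False
    then obtain q where q: "prime q" "q dvd n" using prime_factor_nat by blast
    then obtain m where m: "n = q * m" by blast
    have "m < n" "m \<noteq> 0" using m less.prems(1) prime_gt_1_nat[OF q(1)] by auto
    moreover have "m mod 9 = 1"
      by (rule less.IH[OF calculation]) (use less.prems(2) m in \<open>simp add: dvd_mult\<close>)
    moreover have "q mod 9 = 1" using less.prems q by blast
    ultimately show ?thesis unfolding m by (metis mod_mult_left_eq mult_1)
  qed simp
qed

text \<open>Write \<open>c = a / b\<close> in lowest terms. A prime that is not \<open>1\<close>
  modulo 9 divides neither \<open>b\<close>, by integrality of \<open>c\<close>, nor
  \<open>a\<close>, by integrality of \<open>d\<close>. Hence \<open>b\<close> and the absolute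
  value of \<open>a\<close> are both \<open>1\<close> modulo 9, and the sign of \<open>a\<close> is
  the \<open>s\<close> sought.\<close>

lemma unit_mod_9:
  assumes c: "\<And>p. prime p \<Longrightarrow> p mod 9 \<noteq> 1 \<Longrightarrow> int_at p c"
    and d: "\<And>p. prime p \<Longrightarrow> p mod 9 \<noteq> 1 \<Longrightarrow> int_at p d"
    and cd: "c * d = 1"
  shows "\<exists>s \<in> {1, -1 :: int}. int_at 3 ((c - of_int s) / 9)"
proof -
  obtain a b where ab: "quotient_of c = (a, b)" by fastforce
  have b: "b > 0" "coprime a b" "c = of_int a / of_int b"
    using quotient_of_denom_pos[OF ab] quotient_of_coprime[OF ab] quotient_of_div[OF ab] by auto
  have a0: "a \<noteq> 0" using b cd by auto
  have fac: False if q: "prime q" "int q dvd v"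
    and x: "int_at q (of_int u / of_int v)" and uv: "coprime u v" "v \<noteq> 0" for q u v
  proof -
    obtain e f where ef: "\<not> int q dvd f" "of_int u / of_int v * of_int f = (of_int e :: rat)"
      using x unfolding int_at_def by blast
    hence "(of_int (u * f) :: rat) = of_int (v * e)" using uv by (simp add: field_simps)
    hence "u * f = v * e" using of_int_eq_iff by blast
    hence "int q dvd u * f" using q(2) by simp
    hence "int q dvd u" using ef(1) q(1) by (simp add: prime_dvd_mult_iff)
    hence "is_unit (int q)" using q(2) uv(1) coprime_common_divisor by blast
    thus False using q(1) by auto
  qed
  have d': "d = of_int b / of_int a" using cd b a0 by (auto simp: field_simps)
  have "nat \<bar>b\<bar> mod 9 = 1"
  proof (rule mod_9_eq_1_if_prime_factors)
    fix q assume q: "prime q" "q dvd nat \<bar>b\<bar>"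
    hence "int q dvd b" by (simp add: int_dvd_int_iff[symmetric] del: int_dvd_int_iff)
    thus "q mod 9 = 1" using fac[OF q(1), of b a] c[OF q(1)] b by blast
  qed (use b in simp)
  hence m2: "b mod 9 = 1" using b(1) zmod_int[of "nat \<bar>b\<bar>" 9] by simp
  have "nat \<bar>a\<bar> mod 9 = 1"
  proof (rule mod_9_eq_1_if_prime_factors)
    fix q assume q: "prime q" "q dvd nat \<bar>a\<bar>"
    hence "int q dvd a" by (simp add: int_dvd_int_iff[symmetric] del: int_dvd_int_iff)
    moreover have "coprime b a" using b(2) by (simp add: coprime_commute)
    ultimately show "q mod 9 = 1" using fac[OF q(1), of a b] d[OF q(1)] d' a0 by blast
  qed (use a0 in simp)
  hence m1: "\<bar>a\<bar> mod 9 = 1" using zmod_int[of "nat \<bar>a\<bar>" 9] by simp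
  note m = m1 m2
  define s :: int where "s = sgn a"
  have s: "s \<in> {1, -1}" unfolding s_def using a0 by (auto simp: sgn_if)
  have "[\<bar>a\<bar> = b] (mod 9)" using m by (simp add: cong_def)
  hence "9 dvd \<bar>a\<bar> - b" by (simp add: cong_iff_dvd_diff)
  moreover have "a - s * b = s * (\<bar>a\<bar> - b)"
    unfolding s_def by (simp add: algebra_simps abs_sgn sgn_mult_self_eq abs_mult_sgn)
  ultimately have "9 dvd a - s * b" by simp
  then obtain k where k: "a - s * b = 9 * k" by blast
  have b3: "\<not> int 3 dvd b" using m(2) by presburger
  have "(c - of_int s) / 9 = of_int k / of_int b"
  proof -
    have "c - of_int s = of_int (a - s * b) / of_int b" using b by (simp add: field_simps)
    thus ?thesis unfolding k by simp
  qed
  moreover have "int_at 3 (of_int k / of_int b)"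
    by (intro int_at_divide int_at_of_int) (use b3 in auto)
  ultimately show ?thesis using s by auto
qed

section \<open>Rational vectors and their bases\<close>

abbreviation keys :: "('b \<Rightarrow>\<^sub>0 rat) \<Rightarrow> 'b set" where "keys \<equiv> Poly_Mapping.keys"
abbreviation lookup :: "('b \<Rightarrow>\<^sub>0 rat) \<Rightarrow> 'b \<Rightarrow> rat" where "lookup \<equiv> Poly_Mapping.lookup"

text \<open>Supports are finite, so every function on the basis gives a functional, even the
  indicator of an infinite set.\<close>

definition ev :: "('b \<Rightarrow> rat) \<Rightarrow> ('b \<Rightarrow>\<^sub>0 rat) \<Rightarrow> rat" where
  "ev \<phi> x = (\<Sum>b\<in>keys x. \<phi> b * lookup x b)"

definition smul :: "rat \<Rightarrow> ('b \<Rightarrow>\<^sub>0 rat) \<Rightarrow> ('b \<Rightarrow>\<^sub>0 rat)" where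
  "smul c x = Poly_Mapping.map ((*) c) x"

definition ind :: "'b set \<Rightarrow> 'b \<Rightarrow> rat" where
  "ind S b = (if b \<in> S then 1 else 0)"

definition lin :: "('b \<Rightarrow> 'c \<Rightarrow>\<^sub>0 rat) \<Rightarrow> ('b \<Rightarrow>\<^sub>0 rat) \<Rightarrow> ('c \<Rightarrow>\<^sub>0 rat)" where
  "lin f x = (\<Sum>b\<in>keys x. smul (lookup x b) (f b))"

lemma lookup_smul [simp]: "lookup (smul c x) b = c * lookup x b"
  unfolding smul_def by (simp add: Poly_Mapping.map.rep_eq when_def)

lemma ev_superset: "finite A \<Longrightarrow> keys x \<subseteq> A \<Longrightarrow> ev \<phi> x = (\<Sum>b\<in>A. \<phi> b * lookup x b)"
  unfolding ev_def by (rule sum.mono_neutral_left) (auto simp: in_keys_iff)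

lemma ev_add: "ev \<phi> (x + y) = ev \<phi> x + ev \<phi> y"
proof -
  let ?A = "keys x \<union> keys y"
  have "keys (x + y) \<subseteq> ?A" by (rule keys_add)
  thus ?thesis by (simp add: ev_superset[of ?A] lookup_add algebra_simps sum.distrib)
qed

lemma ev_smul: "ev \<phi> (smul c x) = c * ev \<phi> x"
proof -
  have "keys (smul c x) \<subseteq> keys x" by (auto simp: in_keys_iff)
  thus ?thesis by (simp add: ev_superset[of "keys x"] sum_distrib_left mult_ac)
qed

lemma ev_0 [simp]: "ev \<phi> 0 = 0"
  by (simp add: ev_def)

lemma uminus_eq_smul: "- x = smul (-1) x"
  by (rule poly_mapping_eqI) simp

lemma ev_uminus: "ev \<phi> (- x) = - ev \<phi> x"
  by (simp add: uminus_eq_smul ev_smul)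

lemma ev_diff: "ev \<phi> (x - y) = ev \<phi> x - ev \<phi> y"
  using ev_add[of \<phi> x "- y"] by (simp add: ev_uminus)

lemma ev_sum: "ev \<phi> (sum f A) = (\<Sum>a\<in>A. ev \<phi> (f a))"
  by (induction A rule: infinite_finite_induct) (auto simp: ev_add)

lemma ev_single [simp]: "ev \<phi> (Poly_Mapping.single b c) = \<phi> b * c"
  by (cases "c = 0") (simp_all add: ev_def)

lemma lookup_conv_ev: "lookup x b = ev (ind {b}) x"
proof -
  have "ev (ind {b}) x = (\<Sum>b'\<in>insert b (keys x). ind {b} b' * lookup x b')"
    by (rule ev_superset) auto
  also have "\<dots> = (\<Sum>b'\<in>insert b (keys x). if b' = b then lookup x b else 0)"
    by (rule sum.cong) (auto simp: ind_def)
  finally show ?thesis by simp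
qed

lemma ev_linear: "ev (\<lambda>b. c * \<phi> b + d * \<psi> b) x = c * ev \<phi> x + d * ev \<psi> x"
  by (simp add: ev_def algebra_simps sum.distrib sum_distrib_left)

lemma ev_lin: "ev \<phi> (lin f x) = ev (\<lambda>b. ev \<phi> (f b)) x"
  by (simp add: lin_def ev_sum ev_smul) (simp add: ev_def mult.commute)

lemma lin_add: "lin f (x + y) = lin f x + lin f y"
  by (rule poly_mapping_eqI) (simp add: lookup_conv_ev ev_lin ev_add)

lemma ev_ind_cong:
  assumes "\<And>b. b \<in> keys x \<Longrightarrow> \<phi> b = \<psi> b"
  shows "ev \<phi> x = ev \<psi> x"
  unfolding ev_def using assms by (auto intro: sum.cong)

lemma ev_ind_eq_sum: "ev (ind S) x = (\<Sum>b\<in>keys x \<inter> S. lookup x b)"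
  unfolding ev_def by (rule sum.mono_neutral_cong_right) (auto simp: ind_def)

text \<open>A basis vector \<open>(\<eta>, i)\<close> consists of a word \<open>\<eta>\<close> of labels and a direction \<open>i\<close>, which is a node or
  \<open>None\<close>. Each node \<open>s\<close> carries three labels, written \<open>U\<^sub>s\<close>, \<open>A\<^sub>s\<close>, \<open>V\<^sub>s\<close> in the comments; \<open>A\<^sub>s\<close> is a copy of
  \<open>U\<^sub>t\<close> for the parent \<open>t\<close> of \<open>s\<close>. Nodes are lists with the newest entry first.\<close>

datatype kind = KU | KA | KV

type_synonym 'a lab = "kind \<times> 'a list"
type_synonym 'a bas = "'a lab list \<times> 'a list option"

text \<open>One prime will belong to each index: \<open>Pred k\<close> codes the predicate
  \<open>P k\<close> on words, \<open>Len n\<close> the length, \<open>Lnk n\<close> the extension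
  of a word by one label, \<open>Wp\<close> the span of the vectors with a direction, and
  \<open>Cp\<close> the fact that \<open>A\<^sub>s\<close> copies \<open>U\<^sub>t\<close> for the
  parent \<open>t\<close> of \<open>s\<close>.\<close>

datatype idx = Pred nat | Len nat | Lnk nat | Wp | Cp

text \<open>The indicator vanishes on the difference of \<open>(\<eta>, i)\<close> and any one-label
  extension of it, so its kernel records which words extend \<open>\<eta>\<close>.\<close>

definition lnk_cls :: "'a lab list \<Rightarrow> 'a list option \<Rightarrow> 'a bas set" where
  "lnk_cls \<eta> i = insert (\<eta>, i) {(\<eta> @ [m], i) | m. True}"

text \<open>The same device for copies: the difference of \<open>U\<^sub>t\<close> and
  \<open>A\<^sub>s\<close> lies in the kernel of the indicator for every child \<open>s\<close> of
  \<open>t\<close>.\<close>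

definition cp_cls :: "'a list \<Rightarrow> 'a list option \<Rightarrow> 'a bas set" where
  "cp_cls t i = insert ([(KU, t)], i) {([(KA, s)], i) | s. s \<noteq> [] \<and> tl s = t}"

definition in_cp :: "'a bas \<Rightarrow> bool" where
  "in_cp b \<longleftrightarrow> (\<exists>t i. b \<in> cp_cls t i)"

definition kids :: "'a list \<Rightarrow> 'a bas set" where
  "kids s = {([(KU, s)], Some r) | r. r \<noteq> [] \<and> tl r = s}"

text \<open>Integrality of \<open>bphi j s\<close> at \<open>3\<close> ties the coefficient of \<open>A\<^sub>s\<close> in direction \<open>s\<close> (at the root, \<open>j\<close> times
  that of \<open>A\<^sub>s\<close> itself) to the coefficients of \<open>U\<^sub>s\<close> in the directions of the children of \<open>s\<close>; only a change
  of \<open>V\<^sub>s\<close> or \<open>A\<^sub>s\<close> by a factor that is not \<open>\<plusminus>1\<close> mod 9 can break this tie.\<close>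

definition bphi :: "nat \<Rightarrow> 'a list \<Rightarrow> 'a bas \<Rightarrow> rat" where
  "bphi j s b = ind {([(KV, s)], None)} b - ind {([(KA, s)], None)} b
     - 3 * (if s = [] then of_nat j * ind {([(KA, s)], None)} b else ind {([(KA, s)], Some s)} b)
     + 3 * ind (kids s) b"

definition bpsi :: "'a list \<Rightarrow> 'a bas \<Rightarrow> rat" where
  "bpsi s b = ind {([(KA, s)], None)} b - ind {([(KU, s)], None)} b"

definition bas_of :: "'a list set \<Rightarrow> 'a bas set" where
  "bas_of N = {(\<eta>, i). snd ` set \<eta> \<subseteq> N \<and> set_option i \<subseteq> N}"

section \<open>The map \<open>flex\<close> and its transpose on functionals\<close>

definition nxtn :: "'a list \<Rightarrow> 'a list \<Rightarrow> 'a list option" where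
  "nxtn t s = (if suffix s t \<and> length s < length t
     then Some (drop (length t - Suc (length s)) t) else None)"

text \<open>\<open>A\<^sub>s\<close> follows the rule for \<open>U\<close> at the parent of
  \<open>s\<close>, even if \<open>s\<close> is off the path to \<open>t\<close>; otherwise it would
  cease to be a copy.\<close>

fun nxt :: "'a list \<Rightarrow> 'a lab \<Rightarrow> 'a list option" where
  "nxt t (KU, s) = nxtn t s"
| "nxt t (KA, s) = (if s = [] then None else nxtn t (tl s))"
| "nxt t (KV, s) = None"

lemma nxtn_eq_Some_iff: "nxtn t s = Some n \<longleftrightarrow> n \<noteq> [] \<and> tl n = s \<and> suffix n t"
proof
  assume "nxtn t s = Some n"
  hence s: "suffix s t" "length s < length t" and n: "n = drop (length t - Suc (length s)) t"
    by (auto simp: nxtn_def split: if_splits)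
  from s(1) obtain u where u: "t = u @ s" by (auto simp: suffix_def)
  with s(2) have "u \<noteq> []" by auto
  then obtain u' a where "u = u' @ [a]" by (metis rev_exhaust)
  with u n have "n = a # s" "t = u' @ n" by auto
  thus "n \<noteq> [] \<and> tl n = s \<and> suffix n t" by (auto simp: suffix_def)
next
  assume *: "n \<noteq> [] \<and> tl n = s \<and> suffix n t"
  then obtain a u where "n = a # s" "t = u @ n" by (cases n) (auto simp: suffix_def)
  thus "nxtn t s = Some n" by (auto simp: nxtn_def suffix_def)
qed

lemma nxtn_eq_None_iff: "nxtn t s = None \<longleftrightarrow> \<not> (suffix s t \<and> length s < length t)"
  by (auto simp: nxtn_def)

text \<open>Only the first label counts, so that a nonempty word and its extensions are treated
  alike and the classes of \<open>Lnk\<close> are respected. The same holds for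
  \<open>hit\<close>.\<close>

definition scal :: "'a list \<Rightarrow> int \<Rightarrow> 'a bas \<Rightarrow> int" where
  "scal t e b = (if snd b = None \<and> fst b \<noteq> [] \<and> hd (fst b) = (KV, t) then 1 + 3 * e else 1)"

text \<open>The basis vectors to which \<open>flex0\<close> adds a multiple of the coefficient of
  the same word without direction.\<close>

definition hit :: "'a list \<Rightarrow> 'a bas \<Rightarrow> bool" where
  "hit t b \<longleftrightarrow> snd b \<noteq> None \<and> fst b \<noteq> [] \<and> nxt t (hd (fst b)) = snd b"

definition flex0 :: "'a list \<Rightarrow> int \<Rightarrow> 'a bas \<Rightarrow> 'a bas \<Rightarrow>\<^sub>0 rat" where
  "flex0 t e b = Poly_Mapping.single b (of_int (scal t e b)) +
     (if snd b = None \<and> fst b \<noteq> [] then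
        (case nxt t (hd (fst b)) of None \<Rightarrow> 0
           | Some n \<Rightarrow> Poly_Mapping.single (fst b, Some n) (of_int e)) else 0)"

text \<open>\<open>flex t e\<close> hands the discrepancy between the two groups at the root down the path to \<open>t\<close>, where
  scaling \<open>V\<^sub>t\<close> by \<open>1 + 3e\<close> absorbs it.\<close>

definition flex :: "'a list \<Rightarrow> int \<Rightarrow> ('a bas \<Rightarrow>\<^sub>0 rat) \<Rightarrow> ('a bas \<Rightarrow>\<^sub>0 rat)" where
  "flex t e = lin (flex0 t e)"

text \<open>The transpose of \<open>flex\<close>, see \<open>ev_flex\<close>: it turns an
  integrality condition on the image into one on the argument.\<close>

definition pull :: "'a list \<Rightarrow> int \<Rightarrow> ('a bas \<Rightarrow> rat) \<Rightarrow> 'a bas \<Rightarrow> rat" where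
  "pull t e \<phi> b = of_int (scal t e b) * \<phi> b +
     (if snd b = None \<and> fst b \<noteq> [] then
        (case nxt t (hd (fst b)) of None \<Rightarrow> 0 | Some n \<Rightarrow> of_int e * \<phi> (fst b, Some n)) else 0)"

lemma ev_flex: "ev \<phi> (flex t e x) = ev (pull t e \<phi>) x"
  unfolding flex_def ev_lin
  by (rule arg_cong[of _ _ "\<lambda>f. ev f x"])
     (auto simp: flex0_def pull_def ev_add split: option.splits)

lemma flex_add: "flex t e (x + y) = flex t e x + flex t e y"
  by (simp add: flex_def lin_add)

lemma pull_ind_single:
  "pull t e (ind {b}) = (\<lambda>b'. of_int (scal t e b) * ind {b} b'
      + (if hit t b then of_int e else 0) * ind {(fst b, None)} b')"
  by (rule ext, cases b) (auto simp: pull_def ind_def hit_def split: option.splits)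

lemma lookup_flex:
  "lookup (flex t e x) b = of_int (scal t e b) * lookup x b
     + (if hit t b then of_int e * lookup x (fst b, None) else 0)"
  by (simp add: lookup_conv_ev ev_flex pull_ind_single ev_linear)

text \<open>A word and its extensions have the same first label, so the functional of the class
  pulls back to a combination of the functionals of the same class in the directions
  \<open>i\<close> and \<open>None\<close>.\<close>

lemma pull_ind_lnk:
  assumes "\<eta> \<noteq> []"
  shows "pull t e (ind (lnk_cls \<eta> i)) = (\<lambda>b'. of_int (scal t e (\<eta>, i)) * ind (lnk_cls \<eta> i) b'
      + (if hit t (\<eta>, i) then of_int e else 0) * ind (lnk_cls \<eta> None) b')"
proof
  fix b' :: "'a bas"
  obtain \<eta>' i' where b': "b' = (\<eta>', i')" by fastforce
  define R where "R \<longleftrightarrow> \<eta>' = \<eta> \<or> (\<exists>m. \<eta>' = \<eta> @ [m])"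
  have ind: "ind (lnk_cls \<eta> k) (\<eta>', k') = (if R \<and> k' = k then 1 else 0)" for k k'
    by (auto simp: ind_def lnk_cls_def R_def)
  have hd: "\<eta>' \<noteq> [] \<and> hd \<eta>' = hd \<eta>" if R using that assms by (auto simp: R_def)
  show "pull t e (ind (lnk_cls \<eta> i)) b' = of_int (scal t e (\<eta>, i)) * ind (lnk_cls \<eta> i) b'
      + (if hit t (\<eta>, i) then of_int e else 0) * ind (lnk_cls \<eta> None) b'"
  proof (cases R)
    case True
    with hd assms show ?thesis
      by (cases i; cases i') (simp_all add: b' pull_def ind hit_def scal_def split: option.splits)
  qed (simp add: b' pull_def ind split: option.splits)
qed

lemma pull_ind_cp:
  "pull t e (ind (cp_cls s i)) = (\<lambda>b'. ind (cp_cls s i) b'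
      + (if i \<noteq> None \<and> nxtn t s = i then of_int e else 0) * ind (cp_cls s None) b')"
proof
  fix b' :: "'a bas"
  obtain \<eta>' i' where b': "b' = (\<eta>', i')" by fastforce
  define R where "R \<longleftrightarrow> \<eta>' = [(KU, s)] \<or> (\<exists>r. \<eta>' = [(KA, r)] \<and> r \<noteq> [] \<and> tl r = s)"
  have ind: "ind (cp_cls s k) (\<eta>', k') = (if R \<and> k' = k then 1 else 0)" for k k'
    by (auto simp: ind_def cp_cls_def R_def)
  have hd: "\<eta>' \<noteq> [] \<and> nxt t (hd \<eta>') = nxtn t s \<and> fst (hd \<eta>') \<noteq> KV" if R
    using that by (auto simp: R_def)
  show "pull t e (ind (cp_cls s i)) b' = ind (cp_cls s i) b'
      + (if i \<noteq> None \<and> nxtn t s = i then of_int e else 0) * ind (cp_cls s None) b'"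
  proof (cases R)
    case True
    have "scal t e (\<eta>', k) = 1" for k using hd[OF True] by (auto simp: scal_def)
    with hd[OF True] True show ?thesis
      by (cases i; cases i') (simp_all add: b' pull_def ind split: option.splits)
  qed (simp add: b' pull_def ind split: option.splits)
qed

section \<open>The coded groups\<close>

locale coded_group =
  fixes P :: "nat \<Rightarrow> 'a lab list \<Rightarrow> bool" and q :: "idx \<Rightarrow> nat"
  assumes q_inj: "inj q" and q_prime: "prime (q k)" and q_mod: "q k mod 9 = 1"
begin

text \<open>Each index codes a subspace as the common kernel of the indicators of its classes. A
  singleton class forbids a basis vector; a larger class only asks that the coefficients over it
  have sum zero.\<close>

fun cls :: "idx \<Rightarrow> 'a bas set set" where
  "cls (Pred k) = {{(\<eta>, i)} | \<eta> i. \<not> P k \<eta>}"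
| "cls (Len n) = {{(\<eta>, i)} | \<eta> i. length \<eta> \<noteq> n}"
| "cls (Lnk n) = {{(\<eta>, i)} | \<eta> i. length \<eta> \<noteq> Suc n \<and> length \<eta> \<noteq> Suc (Suc n)}
     \<union> {lnk_cls \<eta> i | \<eta> i. length \<eta> = Suc n}"
| "cls Wp = {{(\<eta>, None)} | \<eta>. True}"
| "cls Cp = {{b} | b. \<not> in_cp b} \<union> {cp_cls t i | t i. True}"

text \<open>The prime \<open>q k\<close> restricts only sums over classes, so that division by
  \<open>q k\<close> is free on their common kernel. At \<open>3\<close> coefficients may have
  denominator \<open>9\<close>: the gluing elements need this, and it makes \<open>9\<close> times a
  coefficient an error that \<open>flex\<close> may commit.\<close>

definition constraints :: "nat \<Rightarrow> (nat \<times> ('a bas \<Rightarrow> rat)) set" where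
  "constraints j = {(q k, ind S) | k S. S \<in> cls k}
     \<union> {(3, bphi j s) | s. True} \<union> {(3, bpsi s) | s. True} \<union> {(3, \<lambda>b'. 9 * ind {b} b') | b. True}
     \<union> {(l, ind {b}) | l b. prime l \<and> l mod 9 \<noteq> 1 \<and> l \<noteq> 3}"

definition inG :: "nat \<Rightarrow> ('a bas \<Rightarrow>\<^sub>0 rat) \<Rightarrow> bool" where
  "inG j x \<longleftrightarrow> (\<forall>(p, \<phi>) \<in> constraints j. int_at p (ev \<phi> x))"

definition Grp :: "nat \<Rightarrow> 'a list set \<Rightarrow> ('a bas \<Rightarrow>\<^sub>0 rat) set" where
  "Grp j N = {x. inG j x \<and> keys x \<subseteq> bas_of N}"

lemma constraints_cases:
  assumes "(p, \<phi>) \<in> constraints j"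
  obtains (cls) k S where "S \<in> cls k" "p = q k" "\<phi> = ind S"
  | (phi) s where "p = 3" "\<phi> = bphi j s"
  | (psi) s where "p = 3" "\<phi> = bpsi s"
  | (nine) b where "p = 3" "\<phi> = (\<lambda>b'. 9 * ind {b} b')"
  | (other) b where "prime p" "p mod 9 \<noteq> 1" "p \<noteq> 3" "\<phi> = ind {b}"
  using assms unfolding constraints_def by blast

lemma constraints_prime: "(p, \<phi>) \<in> constraints j \<Longrightarrow> prime p"
  by (erule constraints_cases) (auto simp: q_prime)

lemma inG_cls: "inG j x \<Longrightarrow> S \<in> cls k \<Longrightarrow> int_at (q k) (ev (ind S) x)"
  unfolding inG_def constraints_def by blast

lemma inG_phi: "inG j x \<Longrightarrow> int_at 3 (ev (bphi j s) x)"
  unfolding inG_def constraints_def by blast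

lemma inG_psi: "inG j x \<Longrightarrow> int_at 3 (ev (bpsi s) x)"
  unfolding inG_def constraints_def by blast

lemma inG_nine: "inG j x \<Longrightarrow> int_at 3 (9 * lookup x b)"
  unfolding lookup_conv_ev ev_linear[of 9 "ind {b}" 0 "\<lambda>_. 0" x, simplified, symmetric]
    inG_def constraints_def by blast

lemma inG_other: "inG j x \<Longrightarrow> prime l \<Longrightarrow> l mod 9 \<noteq> 1 \<Longrightarrow> l \<noteq> 3 \<Longrightarrow> int_at l (lookup x b)"
  unfolding lookup_conv_ev inG_def constraints_def by blast

lemma three_prime [simp]: "prime (3 :: nat)"
  by simp

lemma inG_nine_ind: "inG j x \<Longrightarrow> int_at 3 (9 * ev (ind S) x)"
  unfolding ev_ind_eq_sum sum_distrib_left by (rule int_at_sum) (auto intro: inG_nine)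

lemma inG_0 [simp]: "inG j 0"
  unfolding inG_def by (auto dest: constraints_prime)

lemma inG_add: "inG j x \<Longrightarrow> inG j y \<Longrightarrow> inG j (x + y)"
  unfolding inG_def by (auto simp: ev_add intro!: int_at_add dest: constraints_prime)

lemma inG_uminus: "inG j x \<Longrightarrow> inG j (- x)"
  unfolding inG_def by (auto simp: ev_uminus intro!: int_at_minus dest: constraints_prime)

lemma inG_single:
  assumes "\<And>p \<phi>. (p, \<phi>) \<in> constraints j \<Longrightarrow> int_at p (\<phi> b)"
  shows "inG j (Poly_Mapping.single b 1)"
  using assms unfolding inG_def by auto

lemma Grp_0 [simp]: "0 \<in> Grp j N"
  by (simp add: Grp_def)

lemma Grp_add: "x \<in> Grp j N \<Longrightarrow> y \<in> Grp j N \<Longrightarrow> x + y \<in> Grp j N"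
  unfolding Grp_def using keys_add[of x y] by (auto intro: inG_add)

lemma Grp_uminus: "x \<in> Grp j N \<Longrightarrow> - x \<in> Grp j N"
  unfolding Grp_def by (auto intro: inG_uminus simp: keys_def)

lemma Grp_diff: "x \<in> Grp j N \<Longrightarrow> y \<in> Grp j N \<Longrightarrow> x - y \<in> Grp j N"
  using Grp_add[of x j N "- y"] Grp_uminus[of y] by simp

lemma int_at_ind: "prime p \<Longrightarrow> int_at p (ind S b)"
  using int_at_of_int[of p 0] int_at_of_int[of p 1] by (simp add: ind_def)

lemma int_at_bphi_bpsi_ind:
  assumes "prime p"
  shows "int_at p (bphi j s b)" "int_at p (bpsi s b)" "int_at p (9 * ind S b)"
proof -
  note i = int_at_of_int[OF assms]
  have n: "int_at p (3 :: rat)" "int_at p (9 :: rat)" "int_at p (of_nat j)"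
    using i[of 3] i[of 9] i[of "int j"] by simp_all
  show "int_at p (bphi j s b)" "int_at p (bpsi s b)" "int_at p (9 * ind S b)"
    unfolding bphi_def bpsi_def using assms
    by (auto intro!: int_at_add int_at_diff int_at_mult int_at_ind n)
qed

lemma Grp_basis: "b \<in> bas_of N \<Longrightarrow> Poly_Mapping.single b 1 \<in> Grp j N"
  unfolding Grp_def
  by (auto intro!: inG_single elim!: constraints_cases intro: int_at_bphi_bpsi_ind int_at_ind simp: q_prime)

section \<open>The integrality conditions under \<open>flex\<close>\<close>

lemma int_at_comb:
  assumes "prime p" "int_at p (ev \<phi> x)" "c = 0 \<or> int_at p (ev \<psi> x)"
  shows "int_at p (ev (\<lambda>b. of_int a * \<phi> b + of_int c * \<psi> b) x)"
  unfolding ev_linear using assms by (cases "c = 0") (auto intro!: int_at_add int_at_mult)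

lemma int_at_flex_single:
  assumes "prime p" "int_at p (ev (ind {b}) x)" "hit t b \<Longrightarrow> int_at p (ev (ind {(fst b, None)}) x)"
  shows "int_at p (ev (ind {b}) (flex t e x))"
proof -
  have "ev (ind {b}) (flex t e x) = ev (\<lambda>b'. of_int (scal t e b) * ind {b} b'
      + of_int (if hit t b then e else 0) * ind {(fst b, None)} b') x"
    unfolding ev_flex pull_ind_single by (rule arg_cong[of _ _ "\<lambda>f. ev f x"]) auto
  thus ?thesis using assms by (simp only:, intro int_at_comb) auto
qed

text \<open>Each index other than \<open>Wp\<close> treats all directions alike, so the functional
  in direction \<open>None\<close> that enters through \<open>flex\<close> belongs to the same
  index. For \<open>Wp\<close> only the direction \<open>None\<close> occurs, which is never
  hit.\<close>

lemma flex_cls: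
  assumes x: "inG j x" and S: "S \<in> cls k"
  shows "int_at (q k) (ev (ind S) (flex t e x))"
proof (cases k)
  case (Pred n)
  with S obtain \<eta> i where s: "S = {(\<eta>, i)}" "\<not> P n \<eta>" by auto
  hence "{(\<eta>, None)} \<in> cls k" using Pred by auto
  thus ?thesis using s inG_cls[OF x S] inG_cls[OF x, of "{(\<eta>, None)}" k]
    by (auto intro!: int_at_flex_single simp: q_prime)
next
  case (Len n)
  with S obtain \<eta> i where s: "S = {(\<eta>, i)}" "length \<eta> \<noteq> n" by auto
  hence "{(\<eta>, None)} \<in> cls k" using Len by auto
  thus ?thesis using s inG_cls[OF x S] inG_cls[OF x, of "{(\<eta>, None)}" k]
    by (auto intro!: int_at_flex_single simp: q_prime)
next
  case (Lnk n)
  with S consider \<eta> i where "S = {(\<eta>, i)}" "length \<eta> \<noteq> Suc n" "length \<eta> \<noteq> Suc (Suc n)"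
    | \<eta> i where "S = lnk_cls \<eta> i" "length \<eta> = Suc n" by auto
  thus ?thesis
  proof cases
    case 1
    hence "{(\<eta>, None)} \<in> cls k" using Lnk by auto
    thus ?thesis using 1 inG_cls[OF x S] inG_cls[OF x, of "{(\<eta>, None)}" k]
      by (auto intro!: int_at_flex_single simp: q_prime)
  next
    case 2
    hence N: "lnk_cls \<eta> None \<in> cls k" using Lnk by auto
    have ne: "\<eta> \<noteq> []" using 2 by auto
    have "ev (ind S) (flex t e x) = ev (\<lambda>b'. of_int (scal t e (\<eta>, i)) * ind S b'
      + of_int (if hit t (\<eta>, i) then e else 0) * ind (lnk_cls \<eta> None) b') x"
      unfolding ev_flex 2 pull_ind_lnk[OF ne] by (rule arg_cong[of _ _ "\<lambda>f. ev f x"]) auto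
    thus ?thesis using inG_cls[OF x S] inG_cls[OF x N] by (simp only:, intro int_at_comb q_prime) auto
  qed
next
  case Wp
  with S obtain \<eta> where s: "S = {(\<eta>, None)}" by auto
  thus ?thesis using inG_cls[OF x S] by (auto intro!: int_at_flex_single simp: q_prime hit_def)
next
  case Cp
  with S consider b where "S = {b}" "\<not> in_cp b" | s i where "S = cp_cls s i" by auto
  thus ?thesis
  proof cases
    case 1
    have "int_at (q k) (ev (ind {(fst b, None)}) x)" if h: "hit t b"
    proof -
      have "\<not> in_cp (fst b, None)"
        using 1(2) unfolding in_cp_def cp_cls_def by (cases b) auto
      hence "{(fst b, None)} \<in> cls k" using Cp by auto
      thus ?thesis using inG_cls[OF x] by blast
    qed
    thus ?thesis using 1 inG_cls[OF x S] by (auto intro!: int_at_flex_single simp: q_prime)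
  next
    case 2
    have N: "cp_cls s None \<in> cls k" using Cp by auto
    have "ev (ind S) (flex t e x) = ev (\<lambda>b'. of_int 1 * ind S b'
      + of_int (if i \<noteq> None \<and> nxtn t s = i then e else 0) * ind (cp_cls s None) b') x"
      unfolding ev_flex 2 pull_ind_cp by (rule arg_cong[of _ _ "\<lambda>f. ev f x"]) auto
    thus ?thesis using inG_cls[OF x S] inG_cls[OF x N] by (simp only:, intro int_at_comb q_prime) auto
  qed
qed

lemma ev_bphi:
  "ev (bphi j s) x = lookup x ([(KV, s)], None) - lookup x ([(KA, s)], None)
     - 3 * (if s = [] then of_nat j * lookup x ([(KA, s)], None) else lookup x ([(KA, s)], Some s))
     + 3 * ev (ind (kids s)) x"
  unfolding lookup_conv_ev
  by (auto simp: bphi_def ev_def sum.distrib sum_subtractf sum_distrib_left algebra_simps)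

lemma ev_bpsi: "ev (bpsi s) x = lookup x ([(KA, s)], None) - lookup x ([(KU, s)], None)"
  unfolding lookup_conv_ev
  by (auto simp: bpsi_def ev_def sum.distrib sum_subtractf sum_distrib_left algebra_simps)

text \<open>If \<open>s\<close> is a proper ancestor of \<open>t\<close>, exactly one child of
  \<open>s\<close> lies on the path to \<open>t\<close>, and only its direction is hit.\<close>

lemma ev_kids_flex:
  fixes x :: "'a bas \<Rightarrow>\<^sub>0 rat"
  shows "ev (ind (kids s)) (flex t e x) = ev (ind (kids s)) x
     + (if suffix s t \<and> length s < length t then of_int e * lookup x ([(KU, s)], None) else 0)"
proof -
  have "pull t e (ind (kids s)) = (\<lambda>b. 1 * ind (kids s) b
      + (if suffix s t \<and> length s < length t then of_int e else 0) * ind {([(KU, s)], None)} b)"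
  proof
    fix b :: "'a bas"
    show "pull t e (ind (kids s)) b = 1 * ind (kids s) b
      + (if suffix s t \<and> length s < length t then of_int e else 0) * ind {([(KU, s)], None)} b"
    proof (cases "fst b = [(KU, s)]")
      case True
      then obtain i where b: "b = ([(KU, s)], i)" by (cases b) auto
      show ?thesis
      proof (cases "nxtn t s")
        case None
        then show ?thesis using nxtn_eq_None_iff[of t s]
          by (cases i) (auto simp: b pull_def ind_def kids_def scal_def)
      next
        case (Some n)
        hence "suffix s t \<and> length s < length t" using nxtn_eq_None_iff[of t s] by auto
        then show ?thesis using Some nxtn_eq_Some_iff[of t s n]
          by (cases i) (auto simp: b pull_def ind_def kids_def scal_def)
      qed
    next
      case False
      then show ?thesis by (cases b) (auto simp: pull_def ind_def kids_def split: option.splits)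
    qed
  qed
  thus ?thesis unfolding ev_flex lookup_conv_ev by (simp only: ev_linear) auto
qed

lemma lookup_flex_V: "lookup (flex t e x) ([(KV, s)], None)
    = (if s = t then 1 + 3 * of_int e else 1) * lookup x ([(KV, s)], None)"
  by (auto simp: lookup_flex scal_def hit_def)

lemma lookup_flex_None: "k \<noteq> KV \<Longrightarrow> lookup (flex t e x) ([(k, s)], None) = lookup x ([(k, s)], None)"
  by (auto simp: lookup_flex scal_def hit_def)

lemma lookup_flex_A:
  assumes "s \<noteq> []"
  shows "lookup (flex t e x) ([(KA, s)], Some s) = lookup x ([(KA, s)], Some s)
     + (if suffix s t then of_int e * lookup x ([(KA, s)], None) else 0)"
  using assms nxtn_eq_Some_iff[of t "tl s" s]
  by (auto simp: lookup_flex scal_def hit_def)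

text \<open>At a proper ancestor \<open>s\<close> of \<open>t\<close> the term added to
  \<open>A\<^sub>s\<close> in direction \<open>s\<close> (at the root, the change from
  \<open>j\<close> to \<open>j'\<close>) cancels the term added to \<open>U\<^sub>s\<close> in the
  direction of the next child, up to a multiple of \<open>a - u\<close>, which \<open>bpsi\<close>
  makes integral. At \<open>t\<close> there is no next child; there scaling \<open>V\<^sub>t\<close>
  amounts to multiplying the whole old condition by \<open>1 + 3 * E\<close>, up to multiples of
  \<open>9 * a\<close>, \<open>9 * d\<close> and \<open>9 * k\<close>. At all other nodes nothing
  changes.\<close>

lemma flex_phi:
  assumes x: "inG j x" and j: "(j, e, j') = (0, 1, 1) \<or> (j, e, j') = (1, -1, 0)"
  shows "int_at 3 (ev (bphi j' s) (flex t e x))"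
proof -
  define v a u d k where "v = lookup x ([(KV, s)], None)" and "a = lookup x ([(KA, s)], None)"
    and "u = lookup x ([(KU, s)], None)" and "d = lookup x ([(KA, s)], Some s)"
    and "k = ev (ind (kids s)) x"
  define E :: rat where "E = of_int e"
  have E: "E = 1 \<or> E = -1" "int_at 3 E" using j unfolding E_def by auto
  have i3: "int_at 3 (3 :: rat)" "int_at 3 (1::rat)" using int_at_of_int[of 3 3] int_at_of_int[of 3 1] by auto
  have e1: "int_at 3 (1 + 3 * E)"
    using int_at_of_int[OF three_prime, of "1 + 3 * e"] by (simp add: E_def)
  have nine: "int_at 3 (9 * d)" "int_at 3 (9 * k)" "int_at 3 (9 * a)"
    using inG_nine[OF x] inG_nine_ind[OF x] unfolding d_def k_def a_def by auto
  have psi: "int_at 3 (a - u)" using inG_psi[OF x, of s] unfolding ev_bpsi a_def u_def .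
  have phi: "int_at 3 (v - a - 3 * (if s = [] then of_nat j * a else d) + 3 * k)"
    using inG_phi[OF x, of s] unfolding ev_bphi v_def a_def d_def k_def by simp
  have "ev (bphi j' s) (flex t e x) = (if s = t then 1 + 3 * E else 1) * v - a
     - 3 * (if s = [] then of_nat j' * a else d + (if suffix s t then E * a else 0))
     + 3 * (k + (if suffix s t \<and> length s < length t then E * u else 0))"
    unfolding ev_bphi lookup_flex_V lookup_flex_None[of KA, simplified] ev_kids_flex E_def
      v_def a_def d_def k_def u_def by (simp add: lookup_flex_A)
  also have "int_at 3 \<dots>"
  proof (cases "s = t")
    case True
    show ?thesis
    proof (cases "s = []")
      case s: True
      have "(1 + 3 * E) * v - a - 3 * (of_nat j' * a) + 3 * k
        = (1 + 3 * E) * (v - a - 3 * (of_nat j * a) + 3 * k) + (- E * (9 * k) + of_int (if j = 0 then 0 else -1) * (9 * a))"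
        using j unfolding E_def by (auto simp: algebra_simps)
      moreover have "int_at 3 \<dots>"
        by (rule int_at_add[OF three_prime int_at_mult[OF three_prime e1]
              int_at_add[OF three_prime int_at_mult[OF three_prime int_at_minus[OF three_prime E(2)] nine(2)]
                int_at_mult[OF three_prime int_at_of_int[OF three_prime] nine(3)]]])
           (use phi s in simp)
      ultimately show ?thesis using s True by simp
    next
      case s: False
      have "(1 + 3 * E) * v - a - 3 * (d + E * a) + 3 * k
        = (1 + 3 * E) * (v - a - 3 * d + 3 * k) + E * (9 * d - 9 * k)"
        by (simp add: algebra_simps)
      moreover have "int_at 3 \<dots>"
        by (rule int_at_add[OF three_prime int_at_mult[OF three_prime e1]
              int_at_mult[OF three_prime E(2) int_at_diff[OF three_prime nine(1,2)]]])
           (use phi s in simp)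
      ultimately show ?thesis using s True by simp
    qed
  next
    case st: False
    hence suf: "suffix s t \<Longrightarrow> length s < length t"
      by (metis suffix_length_le suffix_order.le_neq_trans le_neq_implies_less suffix_def append_self_conv2 length_append add_eq_self_zero length_0_conv add.commute)
    show ?thesis
    proof (cases "s = []")
      case s: True
      hence sl: "suffix s t" "length s < length t" using st by auto
      have eq: "v - a - 3 * (of_nat j' * a) + 3 * (k + E * u)
         = (v - a - 3 * (of_nat j * a) + 3 * k) - 3 * E * (a - u)"
        using j unfolding E_def by (auto simp: algebra_simps)
      have "int_at 3 (v - a - 3 * (of_nat j' * a) + 3 * (k + E * u))"
        unfolding eq using phi s by (intro int_at_diff int_at_mult psi E i3) auto
      thus ?thesis using s st sl by simp
    next
      case s: False
      have eq: "v - a - 3 * (d + (if suffix s t then E * a else 0)) + 3 * (k + (if suffix s t then E * u else 0))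
         = (v - a - 3 * d + 3 * k) - (if suffix s t then 3 * E else 0) * (a - u)"
        by (auto simp: algebra_simps)
      have "int_at 3 (v - a - 3 * (d + (if suffix s t then E * a else 0))
          + 3 * (k + (if suffix s t then E * u else 0)))"
        unfolding eq using phi s i3 E by (intro int_at_diff int_at_mult psi) (auto intro: int_at_mult)
      moreover have "(suffix s t \<and> length s < length t) \<longleftrightarrow> suffix s t" using suf by blast
      ultimately show ?thesis using s st by (simp only: if_False mult_1_left)
    qed
  qed
  finally show ?thesis .
qed

lemma inG_flex:
  assumes x: "inG j x" and j: "(j, e, j') = (0, 1, 1) \<or> (j, e, j') = (1, -1, 0)"
  shows "inG j' (flex t e x)"
  unfolding inG_def
proof safe
  fix p \<phi> assume "(p, \<phi>) \<in> constraints j'"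
  thus "int_at p (ev \<phi> (flex t e x))"
  proof (cases rule: constraints_cases)
    case (cls k S)
    thus ?thesis using flex_cls[OF x] by simp
  next
    case (phi s)
    thus ?thesis using flex_phi[OF x j] by simp
  next
    case (psi s)
    thus ?thesis using inG_psi[OF x, of s] by (simp add: ev_bpsi lookup_flex_None)
  next
    case (nine b)
    have "ev (\<lambda>b'. 9 * ind {b} b') (flex t e x) = of_int (scal t e b) * (9 * lookup x b)
       + of_int (if hit t b then e else 0) * (9 * lookup x (fst b, None))"
      using ev_linear[of 9 "ind {b}" 0 "\<lambda>_. 0" "flex t e x"]
      by (auto simp: lookup_conv_ev[symmetric] lookup_flex algebra_simps)
    moreover have "int_at 3 \<dots>"
      by (intro int_at_add int_at_mult[OF _ int_at_of_int inG_nine[OF x]]) auto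
    ultimately show ?thesis using nine by simp
  next
    case (other b)
    have "int_at p (ev (ind {b'}) x)" for b'
      using inG_other[OF x other(1-3)] by (simp only: lookup_conv_ev)
    thus ?thesis using other int_at_flex_single by blast
  qed
qed

section \<open>The embeddings \<open>flex\<close> between the two groups, their injectivity and
  their inverses\<close>

lemma keys_flex:
  assumes "keys x \<subseteq> bas_of N" "\<And>n. suffix n t \<Longrightarrow> n \<in> N"
  shows "keys (flex t e x) \<subseteq> bas_of N"
proof
  fix b assume "b \<in> keys (flex t e x)"
  hence "lookup (flex t e x) b \<noteq> 0" by (simp add: in_keys_iff)
  hence "lookup x b \<noteq> 0 \<or> (hit t b \<and> lookup x (fst b, None) \<noteq> 0)"
    by (auto simp: lookup_flex split: if_splits)
  thus "b \<in> bas_of N"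
  proof
    assume "lookup x b \<noteq> 0"
    thus ?thesis using assms(1) by (auto simp: in_keys_iff)
  next
    assume h: "hit t b \<and> lookup x (fst b, None) \<noteq> 0"
    hence f: "(fst b, None) \<in> bas_of N" using assms(1) by (auto simp: in_keys_iff)
    obtain \<eta> n where b: "b = (\<eta>, Some n)" "nxt t (hd \<eta>) = Some n"
      using h by (cases b) (auto simp: hit_def)
    have "suffix n t" using b(2) nxtn_eq_Some_iff[of t _ n]
      by (cases "(t, hd \<eta>)" rule: nxt.cases) (auto split: if_splits)
    thus ?thesis using f b assms(2) by (auto simp: bas_of_def)
  qed
qed

lemma flex_Grp:
  assumes "x \<in> Grp j N" "\<And>n. suffix n t \<Longrightarrow> n \<in> N" "(j, e, j') = (0, 1, 1) \<or> (j, e, j') = (1, -1, 0)"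
  shows "flex t e x \<in> Grp j' N"
  using assms inG_flex keys_flex unfolding Grp_def by blast

text \<open>The map is triangular: coefficients without direction are multiplied by
  \<open>1\<close>, \<open>4\<close> or \<open>-2\<close>, and to a coefficient with direction only
  a multiple of one without direction is added.\<close>

lemma inj_flex:
  fixes t :: "'a list"
  assumes "e = 1 \<or> e = -1"
  shows "inj (flex t e)"
proof (rule injI)
  fix x y :: "'a bas \<Rightarrow>\<^sub>0 rat" assume eq: "flex t e x = flex t e y"
  have sc: "scal t e b \<noteq> 0" for b :: "'a bas" using assms by (auto simp: scal_def)
  have N: "lookup x (\<eta>, None) = lookup y (\<eta>, None)" for \<eta>
    using arg_cong[OF eq, of "\<lambda>z. lookup z (\<eta>, None)"] sc[of "(\<eta>, None)"]
    by (simp add: lookup_flex hit_def)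
  show "x = y"
  proof (rule poly_mapping_eqI)
    fix b
    show "lookup x b = lookup y b"
      using arg_cong[OF eq, of "\<lambda>z. lookup z b"] sc[of b] N[of "fst b"]
      by (auto simp: lookup_flex split: if_splits)
  qed
qed

text \<open>No word of the support starts with a label at \<open>t\<close> or at a descendant of
  \<open>t\<close>. These are the places where the factor \<open>1 + 3 * e\<close> acts and where
  prolonging \<open>t\<close> would alter \<open>flex\<close>.\<close>

definition fresh :: "'a list \<Rightarrow> ('a bas \<Rightarrow>\<^sub>0 rat) \<Rightarrow> bool" where
  "fresh t x \<longleftrightarrow> (\<forall>b\<in>keys x. fst b \<noteq> [] \<longrightarrow> \<not> suffix t (snd (hd (fst b))))"

lemma fresh_flex: "fresh t x \<Longrightarrow> fresh t (flex t' e x)"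
  unfolding fresh_def
proof
  fix b assume f: "\<forall>b\<in>keys x. fst b \<noteq> [] \<longrightarrow> \<not> suffix t (snd (hd (fst b)))"
    and b: "b \<in> keys (flex t' e x)"
  hence "lookup x b \<noteq> 0 \<or> lookup x (fst b, None) \<noteq> 0"
    by (auto simp: in_keys_iff lookup_flex split: if_splits)
  hence "b \<in> keys x \<or> (fst b, None) \<in> keys x" by (simp add: in_keys_iff)
  thus "fst b \<noteq> [] \<longrightarrow> \<not> suffix t (snd (hd (fst b)))" using f by force
qed

text \<open>On a fresh element the scaling factor never acts. What remains is the identity plus
  \<open>e\<close> times a map of square zero, since vectors with a direction receive contributions
  but send none.\<close>

lemma flex_inverse:
  assumes "fresh t x"
  shows "flex t (- e) (flex t e x) = x"
proof (rule poly_mapping_eqI)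
  fix b :: "'a bas"
  have n: "lookup x b' = 0" if "scal t k b' \<noteq> 1" for b' k
    using that assms by (auto simp: fresh_def scal_def in_keys_iff split: if_splits)
  have sc: "of_int (scal t k b') * lookup x b' = lookup x b'" for k b'
    using n[of k b'] by (cases "scal t k b' = 1") auto
  have h: "\<not> hit t (fst b, None)" by (simp add: hit_def)
  have "lookup (flex t e x) (fst b, None) = lookup x (fst b, None)"
    using sc h by (simp add: lookup_flex)
  moreover have "scal t (-e) b = 1" if "hit t b" using that by (auto simp: scal_def hit_def)
  ultimately show "lookup (flex t (- e) (flex t e x)) b = lookup x b"
    using sc[of "- e" b] sc[of e b] by (auto simp: lookup_flex)
qed

text \<open>The paths to \<open>t\<close> and to \<open>a # t\<close> continue differently only from
  \<open>t\<close> on. If \<open>s\<close> does not extend \<open>t\<close>, neither does its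
  parent, so the rule for \<open>A\<^sub>s\<close> is unchanged as well.\<close>

lemma flex_extend:
  assumes f: "fresh t x" and t: "t' = a # t"
  shows "flex t' e x = flex t e x"
proof (rule poly_mapping_eqI)
  fix b :: "'a bas"
  have sfx: "suffix t t'" using t by (simp add: suffix_ConsI)
  have sc: "of_int (scal r e b) * lookup x b = lookup x b" if "suffix t r" for r
  proof (cases "scal r e b = 1")
    case False
    hence "lookup x b = 0" using that f by (auto simp: fresh_def scal_def in_keys_iff split: if_splits)
    thus ?thesis by simp
  qed simp
  have "hit t' b \<longleftrightarrow> hit t b" if "lookup x (fst b, None) \<noteq> 0"
  proof (cases "fst b = []")
    case False
    obtain k s where ks: "hd (fst b) = (k, s)" by fastforce
    have "(fst b, None) \<in> keys x" using that by (simp add: in_keys_iff)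
    hence ns: "\<not> suffix t s" using f False ks unfolding fresh_def by fastforce
    have eq: "nxtn t' r = nxtn t r" if r: "\<not> suffix t r" for r
    proof -
      have "nxtn t' r = Some n \<longleftrightarrow> nxtn t r = Some n" for n
        unfolding nxtn_eq_Some_iff using r by (auto simp: t suffix_Cons)
      thus ?thesis by (metis not_Some_eq)
    qed
    have "\<not> suffix t (tl s)" using ns by (metis suffix_tl suffix_order.trans)
    with ns have "nxt t' (k, s) = nxt t (k, s)" by (cases k) (auto simp: eq)
    thus ?thesis using ks by (simp add: hit_def)
  qed (simp add: hit_def)
  thus "lookup (flex t' e x) b = lookup (flex t e x) b"
    using sc[of t'] sc[of t] sfx by (auto simp: lookup_flex)
qed

end

section \<open>Homomorphisms between coded groups\<close>

context coded_group
begin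

text \<open>The hypothesis on \<open>x\<close> is exactly what a homomorphism would produce if it
  carried part of the word \<open>[x 0]\<close> to the word \<open>[x 1]\<close>; see
  \<open>hom_rigid\<close>.\<close>

definition rigid_on :: "'a lab set \<Rightarrow> bool" where
  "rigid_on L \<longleftrightarrow> (\<forall>x :: nat \<Rightarrow> 'a lab. range x \<subseteq> L \<longrightarrow>
     (\<forall>k n. P k (map x [0..<Suc n]) \<longrightarrow> P k (map x [1..<Suc (Suc n)])) \<longrightarrow> x 0 = x 1)"

definition hom :: "('a bas \<Rightarrow>\<^sub>0 rat) set \<Rightarrow> ('a bas \<Rightarrow>\<^sub>0 rat) set
    \<Rightarrow> (('a bas \<Rightarrow>\<^sub>0 rat) \<Rightarrow> ('a bas \<Rightarrow>\<^sub>0 rat)) \<Rightarrow> bool" where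
  "hom G H f \<longleftrightarrow> f ` G \<subseteq> H \<and> (\<forall>x\<in>G. \<forall>y\<in>G. f (x + y) = f x + f y)"

abbreviation "bv b \<equiv> Poly_Mapping.single b (1 :: rat)"

lemma smul_Suc: "smul (of_nat (Suc n)) x = smul (of_nat n) x + x"
  by (rule poly_mapping_eqI) (simp add: lookup_add algebra_simps)

lemma Grp_smul_int:
  assumes "x \<in> Grp j N"
  shows "smul (of_int k) x \<in> Grp j N"
proof -
  have nat: "smul (of_nat n) x \<in> Grp j N" for n
  proof (induction n)
    case 0
    have "smul 0 x = 0" by (rule poly_mapping_eqI) simp
    thus ?case by simp
  next
    case (Suc n)
    thus ?case using assms Grp_add smul_Suc[of n x] by metis
  qed
  show ?thesis
  proof (cases "k \<ge> 0")
    case True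
    thus ?thesis using nat[of "nat k"] by simp
  next
    case False
    hence "smul (of_int k) x = - smul (of_nat (nat (- k))) x"
      by (intro poly_mapping_eqI) simp
    thus ?thesis using nat[of "nat (- k)"] Grp_uminus by metis
  qed
qed

context
  fixes j j' N f
  assumes f: "hom (Grp j N) (Grp j' N) f"
begin

lemma hom_Grp: "x \<in> Grp j N \<Longrightarrow> f x \<in> Grp j' N"
  using f by (auto simp: hom_def)

lemma hom_add: "x \<in> Grp j N \<Longrightarrow> y \<in> Grp j N \<Longrightarrow> f (x + y) = f x + f y"
  using f by (auto simp: hom_def)

lemma hom_0: "f 0 = 0"
  using hom_add[of 0 0] by simp

lemma hom_uminus: "x \<in> Grp j N \<Longrightarrow> f (- x) = - f x"
  using hom_add[of x "- x"] Grp_uminus[of x] hom_0 by (simp add: eq_neg_iff_add_eq_0 add.commute)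

lemma hom_diff: "x \<in> Grp j N \<Longrightarrow> y \<in> Grp j N \<Longrightarrow> f (x - y) = f x - f y"
  using hom_add[of x "- y"] Grp_uminus[of y] hom_uminus[of y] by simp

lemma hom_smul_int:
  assumes "x \<in> Grp j N"
  shows "f (smul (of_int k) x) = smul (of_int k) (f x)"
proof -
  have nat: "f (smul (of_nat n) x) = smul (of_nat n) (f x)" for n
  proof (induction n)
    case 0
    have "smul 0 x = 0" "smul 0 (f x) = 0" by (rule poly_mapping_eqI, simp)+
    thus ?case by (simp add: hom_0)
  next
    case (Suc n)
    have "smul (of_nat n) x \<in> Grp j N" using Grp_smul_int[OF assms, of "int n"] by simp
    from hom_add[OF this assms] show ?case unfolding smul_Suc Suc .
  qed
  show ?thesis
  proof (cases "k \<ge> 0")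
    case True
    thus ?thesis using nat[of "nat k"] by simp
  next
    case False
    hence "smul (of_int k) y = - smul (of_nat (nat (- k))) y" for y :: "'a bas \<Rightarrow>\<^sub>0 rat"
      by (intro poly_mapping_eqI) simp
    thus ?thesis using nat[of "nat (- k)"] hom_uminus[of "smul (of_nat (nat (- k))) x"]
        Grp_smul_int[OF assms, of "- k"] False by simp
  qed
qed

text \<open>The common kernel of the functionals of an index \<open>k\<close> consists of the elements divisible
  by all powers of \<open>q k\<close>.\<close>

lemma hom_preserves_kernel:
  assumes x: "x \<in> Grp j N" and k: "\<And>S. S \<in> cls k \<Longrightarrow> ev (ind S) x = 0" and S: "S \<in> cls k"
  shows "ev (ind S) (f x) = 0"
proof (rule infinitely_divisible_imp_0[OF q_prime])
  fix n
  define c :: rat where "c = 1 / of_nat (q k) ^ n"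
  have q0: "q k \<noteq> 0" using q_prime[of k] by (intro notI) simp
  have "inG j (smul c x)"
    unfolding inG_def
  proof safe
    fix p \<phi> assume p: "(p, \<phi>) \<in> constraints j"
    show "int_at p (ev \<phi> (smul c x))"
    proof (cases "p = q k")
      case True
      from p have "ev \<phi> x = 0"
      proof (cases rule: constraints_cases)
        case (cls k' S')
        hence "k' = k" using True q_inj by (auto dest: injD)
        thus ?thesis using cls k by simp
      qed (use True q_mod[of k] in auto)
      thus ?thesis using constraints_prime[OF p] by (simp add: ev_smul)
    next
      case False
      have "\<not> p dvd q k" using False constraints_prime[OF p] q_prime primes_dvd_imp_eq by blast
      hence "\<not> int p dvd int (q k) ^ n" using constraints_prime[OF p]
        by (metis int_dvd_int_iff of_nat_power prime_dvd_power)
      moreover have "int_at p (ev \<phi> x)" using x p by (auto simp: Grp_def inG_def)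
      ultimately have "int_at p (ev \<phi> x / of_int (int (q k) ^ n))"
        using constraints_prime[OF p] int_at_divide by blast
      thus ?thesis by (simp add: ev_smul c_def)
    qed
  qed
  moreover have "keys (smul c x) \<subseteq> keys x" by (auto simp: in_keys_iff)
  ultimately have y: "smul c x \<in> Grp j N" using x by (auto simp: Grp_def)
  have "smul (of_int (int (q k) ^ n)) (smul c x) = x"
    using q0 by (intro poly_mapping_eqI) (simp add: c_def)
  hence "f x = smul (of_int (int (q k) ^ n)) (f (smul c x))"
    using hom_smul_int[OF y, of "int (q k) ^ n"] by simp
  hence "ev (ind S) (f x) / of_nat (q k) ^ n = ev (ind S) (f (smul c x))"
    using q0 by (simp add: ev_smul)
  thus "int_at (q k) (ev (ind S) (f x) / of_nat (q k) ^ n)"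
    using inG_cls[OF _ S] hom_Grp[OF y] by (auto simp: Grp_def)
qed

lemma hom_preserves_kernel_single:
  assumes x: "x \<in> Grp j N" and k: "\<And>S. S \<in> cls k \<Longrightarrow> ev (ind S) x = 0" and S: "{b} \<in> cls k"
  shows "lookup (f x) b = 0"
  unfolding lookup_conv_ev using hom_preserves_kernel[OF assms] .

lemma hom_keys: "x \<in> Grp j N \<Longrightarrow> lookup (f x) b \<noteq> 0 \<Longrightarrow> b \<in> bas_of N"
  using hom_Grp[of x] by (auto simp: Grp_def in_keys_iff)

section \<open>Recovering the coded relations from a homomorphism\<close>

lemma hom_length:
  assumes b: "(\<eta>, i) \<in> bas_of N" and l: "lookup (f (bv (\<eta>, i))) (\<eta>', i') \<noteq> 0"
  shows "length \<eta>' = length \<eta>"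
proof (rule ccontr)
  assume ne: "length \<eta>' \<noteq> length \<eta>"
  have "lookup (f (bv (\<eta>, i))) (\<eta>', i') = 0"
    by (rule hom_preserves_kernel_single[where k = "Len (length \<eta>)"])
       (use b ne in \<open>auto intro: Grp_basis simp: ind_def\<close>)
  thus False using l by simp
qed

lemma hom_pred:
  assumes b: "(\<eta>, i) \<in> bas_of N" and l: "lookup (f (bv (\<eta>, i))) (\<eta>', i') \<noteq> 0" and p: "P k \<eta>"
  shows "P k \<eta>'"
proof (rule ccontr)
  assume ne: "\<not> P k \<eta>'"
  have "lookup (f (bv (\<eta>, i))) (\<eta>', i') = 0"
    by (rule hom_preserves_kernel_single[where k = "Pred k"])
       (use b ne p in \<open>auto intro: Grp_basis simp: ind_def\<close>)
  thus False using l by simp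
qed

lemma ev_lnk:
  assumes "\<And>\<zeta> k. lookup x (\<zeta>, k) \<noteq> 0 \<Longrightarrow> length \<zeta> = length \<eta>"
  shows "ev (ind (lnk_cls \<eta> i)) x = lookup x (\<eta>, i)"
  unfolding lookup_conv_ev
proof (rule ev_ind_cong)
  fix b assume b: "b \<in> keys x"
  obtain \<zeta> k where "b = (\<zeta>, k)" by fastforce
  moreover from this b assms have "length \<zeta> = length \<eta>" by (auto simp: in_keys_iff)
  ultimately show "ind (lnk_cls \<eta> i) b = ind {(\<eta>, i)} b" by (auto simp: ind_def lnk_cls_def)
qed

text \<open>The difference of the two basis vectors lies in the kernel of \<open>Lnk n\<close>. So
  the coefficient of the image at \<open>\<eta>'\<close> has to be balanced by coefficients, in the
  image of the longer word, at extensions of \<open>\<eta>'\<close>.\<close>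

lemma hom_child:
  assumes b: "(\<eta> @ [m], i) \<in> bas_of N" and \<eta>: "\<eta> \<noteq> []"
    and l: "lookup (f (bv (\<eta>, i))) (\<eta>', i') \<noteq> 0"
  shows "\<exists>m'. lookup (f (bv (\<eta> @ [m], i))) (\<eta>' @ [m'], i') \<noteq> 0"
proof (rule ccontr)
  assume no: "\<not> ?thesis"
  have b': "(\<eta>, i) \<in> bas_of N" using b by (auto simp: bas_of_def)
  have len: "length \<eta>' = length \<eta>" by (rule hom_length[OF b' l])
  obtain n where n: "length \<eta> = Suc n" using \<eta> by (cases \<eta>) auto
  define y where "y = bv (\<eta> @ [m], i) - bv (\<eta>, i)"
  have yG: "y \<in> Grp j N" unfolding y_def using b b' by (intro Grp_diff Grp_basis)
  have fy: "f y = f (bv (\<eta> @ [m], i)) - f (bv (\<eta>, i))"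
    unfolding y_def using b b' by (intro hom_diff Grp_basis)
  have "ev (ind (lnk_cls \<eta>' i')) (f y) = 0"
  proof (rule hom_preserves_kernel[OF yG])
    show "lnk_cls \<eta>' i' \<in> cls (Lnk n)" using len n by auto
    fix S assume "S \<in> cls (Lnk n)"
    thus "ev (ind S) y = 0" using n by (auto simp: y_def ev_diff ind_def lnk_cls_def)
  qed
  moreover have "ev (ind (lnk_cls \<eta>' i')) (f (bv (\<eta>, i))) = lookup (f (bv (\<eta>, i))) (\<eta>', i')"
    by (rule ev_lnk) (use hom_length[OF b'] len in auto)
  moreover have "ev (ind (lnk_cls \<eta>' i')) (f (bv (\<eta> @ [m], i))) = 0"
    unfolding ev_ind_eq_sum
  proof (rule sum.neutral, safe)
    fix \<zeta> k assume a: "(\<zeta>, k) \<in> keys (f (bv (\<eta> @ [m], i)))" "(\<zeta>, k) \<in> lnk_cls \<eta>' i'"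
    hence "length \<zeta> = Suc (length \<eta>)" using hom_length[OF b, of \<zeta> k] by (simp add: in_keys_iff)
    hence "\<exists>m'. \<zeta> = \<eta>' @ [m'] \<and> k = i'" using a(2) len by (auto simp: lnk_cls_def)
    thus "lookup (f (bv (\<eta> @ [m], i))) (\<zeta>, k) = 0" using no by auto
  qed
  ultimately show False using l fy by (simp add: ev_diff)
qed

lemma bas_of_labels: "(\<eta>, i) \<in> bas_of N \<Longrightarrow> x \<in> set \<eta> \<Longrightarrow> snd x \<in> N"
  by (auto simp: bas_of_def)

text \<open>Suppose that \<open>[k']\<close> occurs in the image of \<open>[k]\<close>. Repeatedly
  extend the word by the last label of the current image word; \<open>hom_child\<close> answers with
  a new label. Words and image words then are the windows from place \<open>0\<close> and from place
  \<open>1\<close> of a single sequence \<open>x\<close>. Predicates pass from a word to its image,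
  hence to its shift, and rigidity gives \<open>x 0 = x 1\<close>.\<close>

lemma hom_rigid:
  assumes R: "rigid_on (UNIV \<times> N)" and b: "([k], i) \<in> bas_of N"
    and l: "lookup (f (bv ([k], i))) (\<eta>', i') \<noteq> 0"
  shows "\<eta>' = [k]"
proof -
  obtain k' where \<eta>': "\<eta>' = [k']" using hom_length[OF b l] by (cases \<eta>') auto
  define Q where "Q \<eta> \<zeta> \<longleftrightarrow> \<eta> \<noteq> [] \<and> (\<eta>, i) \<in> bas_of N \<and> (\<zeta>, i') \<in> bas_of N
     \<and> lookup (f (bv (\<eta>, i))) (\<zeta>, i') \<noteq> 0" for \<eta> \<zeta>
  have Q0: "Q [k] [k']" using b l \<eta>' hom_keys[of "bv ([k], i)"] Grp_basis unfolding Q_def by auto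
  have Qlen: "length \<zeta> = length \<eta>" if "Q \<eta> \<zeta>" for \<eta> \<zeta>
    using that hom_length unfolding Q_def by blast
  have step: "\<exists>m'. Q (\<eta> @ [last \<zeta>]) (\<zeta> @ [m'])" if Q: "Q \<eta> \<zeta>" for \<eta> \<zeta>
  proof -
    have "\<zeta> \<noteq> []" using Qlen[OF Q] Q by (auto simp: Q_def)
    hence bb: "(\<eta> @ [last \<zeta>], i) \<in> bas_of N"
      using Q last_in_set[of \<zeta>] unfolding Q_def bas_of_def by auto
    then obtain m' where m': "lookup (f (bv (\<eta> @ [last \<zeta>], i))) (\<zeta> @ [m'], i') \<noteq> 0"
      using hom_child Q unfolding Q_def by blast
    hence "(\<zeta> @ [m'], i') \<in> bas_of N" using hom_keys Grp_basis[OF bb] by blast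
    hence "Q (\<eta> @ [last \<zeta>]) (\<zeta> @ [m'])" using bb m' by (auto simp: Q_def)
    thus ?thesis ..
  qed
  obtain x where x0: "x 0 = k" and x1: "x 1 = k'"
    and x: "\<And>n. Q (map x [0..<Suc n]) (map x [1..<Suc (Suc n)])"
  proof -
    have "\<exists>g. g 0 = ([k], [k']) \<and> (\<forall>n. Q (fst (g n)) (snd (g n)) \<and>
      (\<exists>m'. g (Suc n) = (fst (g n) @ [last (snd (g n))], snd (g n) @ [m'])))"
    proof -
      define nx where "nx = (\<lambda>(\<eta>, \<zeta>). (\<eta> @ [last \<zeta>], \<zeta> @ [SOME m'. Q (\<eta> @ [last \<zeta>]) (\<zeta> @ [m'])]))"
      define g where "g n = (nx ^^ n) ([k], [k'])" for n
      have "Q (fst (g n)) (snd (g n))" for n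
      proof (induction n)
        case (Suc n)
        from someI_ex[OF step[OF Suc]] show ?case
          by (simp add: g_def nx_def case_prod_beta)
      qed (simp add: g_def Q0)
      thus ?thesis by (intro exI[of _ g]) (auto simp: g_def nx_def case_prod_beta)
    qed
    then obtain g where g: "g 0 = ([k], [k'])" "\<And>n. Q (fst (g n)) (snd (g n))"
      "\<And>n. \<exists>m'. g (Suc n) = (fst (g n) @ [last (snd (g n))], snd (g n) @ [m'])" by blast
    define x where "x n = last (fst (g n))" for n
    have l1: "length (fst (g n)) = Suc n" for n
      by (induction n) (use g(1,3) in \<open>auto, metis fst_conv length_append_singleton\<close>)
    have last: "last (snd (g n)) = x (Suc n)" for n
      using g(3)[of n] by (auto simp: x_def)
    have fg: "fst (g n) = map x [0..<Suc n]" for n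
    proof (induction n)
      case 0
      thus ?case using g(1) by (simp add: x_def)
    next
      case (Suc n)
      thus ?case using g(3)[of n] last[of n] by auto
    qed
    have sg: "snd (g n) = map x [1..<Suc (Suc n)]" for n
    proof (induction n)
      case 0
      thus ?case using g(1) last[of 0] by simp
    next
      case (Suc n)
      obtain m' where m': "g (Suc n) = (fst (g n) @ [last (snd (g n))], snd (g n) @ [m'])"
        using g(3) by blast
      hence "m' = x (Suc (Suc n))" using last[of "Suc n"] by simp
      thus ?case using m' Suc by simp
    qed
    have "x 0 = k" using fg[of 0] g(1) by simp
    moreover have "x 1 = k'" using sg[of 0] g(1) by simp
    moreover have "Q (map x [0..<Suc n]) (map x [1..<Suc (Suc n)])" for n
      using g(2)[of n] fg[of n] sg[of n] by simp
    ultimately show ?thesis using that by blast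
  qed
  have "snd (x n) \<in> N" for n
    using bas_of_labels[of "map x [0..<Suc n]" i "x n"] x[of n] by (auto simp: Q_def)
  hence "range x \<subseteq> UNIV \<times> N" by (simp add: image_subset_iff mem_Times_iff)
  moreover have "P k (map x [1..<Suc (Suc n)])" if "P k (map x [0..<Suc n])" for k n
    using x[of n] hom_pred that unfolding Q_def by blast
  ultimately have "x 0 = x 1" using R unfolding rigid_on_def by blast
  thus ?thesis using x0 x1 \<eta>' by simp
qed

lemma hom_Wp:
  assumes "x \<in> Grp j N" "\<And>\<eta>. lookup x (\<eta>, None) = 0"
  shows "lookup (f x) (\<eta>, None) = 0"
  by (rule hom_preserves_kernel_single[where k = Wp])
     (use assms in \<open>auto simp: lookup_conv_ev[symmetric]\<close>)

lemma lookup_ev_cp: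
  assumes "\<And>\<zeta> k. lookup x (\<zeta>, k) \<noteq> 0 \<Longrightarrow> \<zeta> = \<eta>" "\<eta> = [(KU, t)] \<or> (\<exists>s. \<eta> = [(KA, s)] \<and> s \<noteq> [] \<and> tl s = t)"
  shows "ev (ind (cp_cls t i)) x = lookup x (\<eta>, i)"
  unfolding lookup_conv_ev
  by (rule ev_ind_cong) (use assms in \<open>auto simp: ind_def cp_cls_def in_keys_iff\<close>)

text \<open>The difference of the two basis vectors lies in the kernel of \<open>Cp\<close>. By
  rigidity each image involves a single word, so that the sum over a class reduces to one
  coefficient.\<close>

lemma hom_copy:
  assumes R: "rigid_on (UNIV \<times> N)" and s: "s \<in> N" "tl s \<in> N" "s \<noteq> []"
  shows "lookup (f (bv ([(KA, s)], None))) ([(KA, s)], i)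
       = lookup (f (bv ([(KU, tl s)], None))) ([(KU, tl s)], i)"
proof -
  let ?a = "bv ([(KA, s)], None)" and ?u = "bv ([(KU, tl s)], None)"
  have b: "([(KA, s)], None) \<in> bas_of N" "([(KU, tl s)], None) \<in> bas_of N"
    using s by (auto simp: bas_of_def)
  have G: "?u \<in> Grp j N" "?a \<in> Grp j N" "?u - ?a \<in> Grp j N" using b by (auto intro: Grp_basis Grp_diff)
  have "ev (ind (cp_cls (tl s) i)) (f (?u - ?a)) = 0"
  proof (rule hom_preserves_kernel[OF G(3)])
    show "cp_cls (tl s) i \<in> cls Cp" by auto
    fix S assume "S \<in> cls Cp"
    then consider b where "S = {b}" "\<not> in_cp b" | t i where "S = cp_cls t i" by auto
    thus "ev (ind S) (?u - ?a) = 0"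
    proof cases
      case 1
      have "in_cp ([(KA, s)], None)" "in_cp ([(KU, tl s)], None)"
        using s(3) unfolding in_cp_def cp_cls_def by auto
      hence "b \<noteq> ([(KA, s)], None)" "b \<noteq> ([(KU, tl s)], None)" using 1 by auto
      thus ?thesis using 1 by (auto simp: ev_diff ind_def)
    next
      case 2
      thus ?thesis using s(3) by (auto simp: ev_diff ind_def cp_cls_def)
    qed
  qed
  moreover have "ev (ind (cp_cls (tl s) i)) (f ?u) = lookup (f ?u) ([(KU, tl s)], i)"
    by (rule lookup_ev_cp) (use hom_rigid[OF R b(2)] in auto)
  moreover have "ev (ind (cp_cls (tl s) i)) (f ?a) = lookup (f ?a) ([(KA, s)], i)"
    by (rule lookup_ev_cp) (use hom_rigid[OF R b(1)] s(3) in auto)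
  ultimately show ?thesis using hom_diff[OF G(1,2)] by (simp add: ev_diff)
qed

end

end

section \<open>From an isomorphism to an infinite branch\<close>

context coded_group
begin

text \<open>By rigidity both maps act on \<open>[k]\<close> as scalars modulo the vectors with a
  direction, and by \<open>Wp\<close> this part is preserved; so the scalars multiply to
  \<open>1\<close>.\<close>

lemma hom_unit:
  assumes f: "hom (Grp j N) (Grp j' N) f" and g: "hom (Grp j' N) (Grp j N) g"
    and gf: "\<And>x. x \<in> Grp j N \<Longrightarrow> g (f x) = x"
    and R: "rigid_on (UNIV \<times> N)" and k: "snd k \<in> N"
  shows "lookup (f (bv ([k], None))) ([k], None) * lookup (g (bv ([k], None))) ([k], None) = 1"
proof -
  define b :: "'a bas" where "b = ([k], None)"
  have b: "b \<in> bas_of N" using k by (auto simp: b_def bas_of_def)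
  have e: "bv b \<in> Grp i N" for i using Grp_basis[OF b] .
  define c where "c = lookup (f (bv b)) b"
  obtain m D where mD: "quotient_of c = (m, D)" by fastforce
  have D: "D > 0" "c = of_int m / of_int D"
    using quotient_of_denom_pos[OF mD] quotient_of_div[OF mD] by auto
  \<comment> \<open>Clearing the denominator of \<open>c\<close> is necessary because additivity
    only gives integer multiples of group elements.\<close>
  define y where "y = smul (of_int D) (f (bv b)) - smul (of_int m) (bv b)"
  have fe: "f (bv b) \<in> Grp j' N" using hom_Grp[OF f e] .
  have y: "y \<in> Grp j' N" unfolding y_def using fe e by (intro Grp_diff Grp_smul_int)
  have "lookup y (\<eta>, None) = 0" for \<eta>
  proof (cases "\<eta> = [k]")
    case True
    thus ?thesis using D by (simp add: y_def lookup_minus c_def[symmetric] flip: b_def)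
  next
    case False
    hence "lookup (f (bv b)) (\<eta>, None) = 0"
      using hom_rigid[OF f R, of k None \<eta> None] b unfolding b_def by blast
    thus ?thesis using False by (simp add: y_def lookup_minus b_def lookup_single)
  qed
  hence "lookup (g y) b = 0" using hom_Wp[OF g y] unfolding b_def by blast
  moreover have "g y = smul (of_int D) (bv b) - smul (of_int m) (g (bv b))"
    unfolding y_def
    using hom_diff[OF g Grp_smul_int[OF fe] Grp_smul_int[OF e]] hom_smul_int[OF g fe]
      hom_smul_int[OF g e] gf[OF e] by simp
  ultimately have "of_int D = of_int m * lookup (g (bv b)) b" by (simp add: lookup_minus)
  moreover have "c * lookup (g (bv b)) b = of_int m * lookup (g (bv b)) b / of_int D"
    by (simp add: D(2))
  ultimately have "c * lookup (g (bv b)) b = of_int D / of_int D" by simp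
  thus ?thesis using D(1) unfolding c_def b_def by simp
qed

text \<open>Only \<open>3\<close> needs an argument, since group elements may have denominator
  \<open>9\<close> there. The image involves the single word \<open>[k]\<close>, so
  \<open>bpsi\<close> (for \<open>U\<close> and \<open>A\<close>) or \<open>bphi\<close> (for
  \<open>V\<close>) sees just the coefficient in question.\<close>

lemma hom_coeff_int_at:
  assumes f: "hom (Grp j N) (Grp j' N) f"
    and R: "rigid_on (UNIV \<times> N)" and k: "snd k \<in> N" and p: "prime p" "p mod 9 \<noteq> 1"
  shows "int_at p (lookup (f (bv ([k], None))) ([k], None))"
proof -
  let ?x = "f (bv ([k], None))"
  have b: "([k], None) \<in> bas_of N" using k by (auto simp: bas_of_def)
  have G: "inG j' ?x" using hom_Grp[OF f Grp_basis[OF b]] by (simp add: Grp_def)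
  have z: "lookup ?x (\<eta>, i) = 0" if "\<eta> \<noteq> [k]" for \<eta> i using hom_rigid[OF f R b] that by blast
  obtain kd s where ks: "k = (kd, s)" by fastforce
  show ?thesis
  proof (cases "p = 3")
    case False
    thus ?thesis using inG_other[OF G p] by blast
  next
    case True
    have psi: "int_at 3 (ev (bpsi s) ?x)" by (rule inG_psi[OF G])
    show ?thesis
    proof (cases kd)
      case KU
      have "int_at 3 (- ev (bpsi s) ?x)" using psi by (rule int_at_minus[OF three_prime])
      thus ?thesis using True z KU ks by (simp add: ev_bpsi)
    next
      case KA
      thus ?thesis using True z ks psi by (simp add: ev_bpsi)
    next
      case KV
      have "ev (ind (kids s)) ?x = 0" unfolding ev_ind_eq_sum
        by (rule sum.neutral) (use z ks KV in \<open>auto simp: kids_def\<close>)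
      moreover have "lookup ?x ([(KA, s)], i) = 0" for i using z ks KV by simp
      ultimately show ?thesis using True KV ks inG_phi[OF G, of s]
        by (cases "s = []") (simp_all add: ev_bphi)
    qed
  qed
qed

text \<open>The gluing element of the node \<open>s\<close>; only \<open>9\<close> times it lies in the free group on the basis.\<close>

definition glue :: "'a list \<Rightarrow> 'a bas \<Rightarrow>\<^sub>0 rat" where
  "glue s = smul (1/9) (bv ([(KA, s)], None) + bv ([(KU, s)], None) + bv ([(KV, s)], None))"

lemma ev_glue: "ev \<phi> (glue s) = (\<phi> ([(KA, s)], None) + \<phi> ([(KU, s)], None) + \<phi> ([(KV, s)], None)) / 9"
  by (simp add: glue_def ev_smul ev_add)

text \<open>Equal coefficients cancel in \<open>bpsi\<close> and in \<open>bphi 0\<close>. In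
  \<open>bphi 1\<close> at the root the term with \<open>j\<close> would survive as
  \<open>-1/3\<close>: this is the discrepancy between the two groups.\<close>

lemma glue_Grp:
  assumes s: "s \<in> N"
  shows "glue s \<in> Grp 0 N"
proof -
  have "inG 0 (glue s)" unfolding inG_def
  proof safe
    fix p \<phi> assume p: "(p, \<phi>) \<in> constraints 0"
    note pp = constraints_prime[OF p]
    have div: "int_at p (ev (ind S) (glue s))" if "p \<noteq> 3" for S
    proof -
      have "\<not> p dvd 3 ^ 2" using that pp by (metis primes_dvd_imp_eq prime_dvd_power three_prime)
      hence "\<not> p dvd 9" by simp
      hence "\<not> int p dvd 9" by (metis int_dvd_int_iff of_nat_numeral)
      moreover have "int_at p (ind S ([(KA, s)], None) + ind S ([(KU, s)], None) + ind S ([(KV, s)], None))"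
        using pp by (intro int_at_add int_at_ind)
      ultimately show ?thesis unfolding ev_glue using int_at_divide[OF pp, of _ 9] by simp
    qed
    from p show "int_at p (ev \<phi> (glue s))"
    proof (cases rule: constraints_cases)
      case (cls k S)
      moreover have "q k \<noteq> 3" using q_mod[of k] by (intro notI) simp
      ultimately show ?thesis using div by simp
    next
      case (phi s')
      have "ev (bphi 0 s') (glue s) = 0"
        unfolding ev_glue by (auto simp: bphi_def ind_def kids_def)
      thus ?thesis using pp phi by simp
    next
      case (psi s')
      have "ev (bpsi s') (glue s) = 0" unfolding ev_glue by (auto simp: bpsi_def ind_def)
      thus ?thesis using pp psi by simp
    next
      case (nine b)
      have "ev \<phi> (glue s) = ind {b} ([(KA, s)], None) + ind {b} ([(KU, s)], None) + ind {b} ([(KV, s)], None)"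
        unfolding ev_glue nine by simp
      thus ?thesis using pp by (simp only:, intro int_at_add int_at_ind)
    next
      case (other b)
      thus ?thesis using div by simp
    qed
  qed
  moreover have "keys (glue s) \<subseteq> bas_of N"
  proof
    fix b assume "b \<in> keys (glue s)"
    hence "b \<in> {([(KA, s)], None), ([(KU, s)], None), ([(KV, s)], None)}"
      by (auto simp: in_keys_iff glue_def lookup_add lookup_single when_def split: if_splits)
    thus "b \<in> bas_of N" using s by (auto simp: bas_of_def)
  qed
  ultimately show ?thesis by (simp add: Grp_def)
qed

text \<open>The images of the gluing elements have to satisfy \<open>bphi 1\<close>. As
  \<open>9 * glue s\<close> is a sum of three basis vectors, this is a congruence modulo 9 between
  coefficients of their images, which relates the discrepancy entering \<open>s\<close> to the one
  leaving it.\<close>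

theorem iso_imp_branch:
  assumes bij: "bij_betw f (Grp 0 N) (Grp 1 N)"
    and add: "\<And>x y. x \<in> Grp 0 N \<Longrightarrow> y \<in> Grp 0 N \<Longrightarrow> f (x + y) = f x + f y"
    and R: "rigid_on (UNIV \<times> N)" and root: "[] \<in> N"
  shows "\<exists>s. s 0 = [] \<and> (\<forall>n. s n \<in> N \<and> s (Suc n) \<noteq> [] \<and> tl (s (Suc n)) = s n)"
proof -
  define g where "g = inv_into (Grp 0 N) f"
  have f: "hom (Grp 0 N) (Grp 1 N) f" using bij add by (auto simp: hom_def bij_betw_def)
  have gf: "g (f x) = x" if "x \<in> Grp 0 N" for x
    using bij that by (simp add: g_def bij_betw_inv_into_left)
  have fg: "f (g y) = y" "g y \<in> Grp 0 N" if "y \<in> Grp 1 N" for y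
    using bij that by (auto simp: g_def bij_betw_inv_into_right bij_betw_def inv_into_into)
  have g: "hom (Grp 1 N) (Grp 0 N) g" unfolding hom_def
  proof safe
    fix x y assume xy: "x \<in> Grp 1 N" "y \<in> Grp 1 N"
    have "f (g x + g y) = x + y" using add[of "g x" "g y"] fg xy by simp
    thus "g (x + y) = g x + g y" using gf[of "g x + g y"] fg xy Grp_add[of "g x" 0 N "g y"] by simp
  qed (use fg in auto)
  define c where "c k = lookup (f (bv ([k], None))) ([k], None)" for k
  have unit: "\<exists>e :: int. (e = 1 \<or> e = -1) \<and> int_at 3 ((c k - of_int e) / 9)" if "snd k \<in> N" for k
    unfolding c_def
    using unit_mod_9[OF hom_coeff_int_at[OF f R that] hom_coeff_int_at[OF g R that]
          hom_unit[OF f g gf R that]] by blast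
  have cint: "int_at 3 (c k)" if "snd k \<in> N" for k
    unfolding c_def by (rule hom_coeff_int_at[OF f R that]) auto
  define \<sigma> where "\<sigma> s = ev (ind (kids s)) (f (bv ([(KU, s)], None)))" for s
  define y where "y s = lookup (f (bv ([(KA, s)], None))) ([(KA, s)], Some s)" for s
  \<comment> \<open>Modulo 3, what enters \<open>s\<close> equals what leaves it towards the
    children. At the root the coefficient of \<open>A\<^sub>s\<close> itself enters, because
    \<open>j = 1\<close> in the target.\<close>
  have main: "int_at 3 (((if s = [] then c (KA, s) else y s) - \<sigma> s) / 3)" if s: "s \<in> N" for s
  proof -
    let ?A = "bv ([(KA, s)], None)" and ?U = "bv ([(KU, s)], None)" and ?V = "bv ([(KV, s)], None)"
    have bas: "([(k, s)], None) \<in> bas_of N" for k using s by (auto simp: bas_of_def)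
    note G = Grp_basis[OF bas]
    have rig: "lookup (f (bv ([(k, s)], None))) (\<eta>, i) = 0" if "\<eta> \<noteq> [(k, s)]" for k \<eta> i
      using hom_rigid[OF f R bas] that by blast
    have zG: "glue s \<in> Grp 0 N" by (rule glue_Grp[OF s])
    have "smul (of_int 9) (glue s) = ?A + ?U + ?V"
      by (rule poly_mapping_eqI) (simp add: glue_def)
    hence nine: "smul 9 (f (glue s)) = f ?A + f ?U + f ?V"
      using hom_smul_int[OF f zG, of 9] hom_add[OF f G G] hom_add[OF f Grp_add[OF G G] G] by simp
    have lk: "9 * lookup (f (glue s)) b = lookup (f ?A) b + lookup (f ?U) b + lookup (f ?V) b" for b
      using arg_cong[OF nine, of "\<lambda>x. lookup x b"] by (simp add: lookup_add)
    have kz: "ev (ind (kids s)) (f (bv ([(k, s)], None))) = 0" if "k \<noteq> KU" for k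
      unfolding ev_ind_eq_sum by (rule sum.neutral) (use rig that in \<open>auto simp: kids_def\<close>)
    have k9: "9 * ev (ind (kids s)) (f (glue s)) = \<sigma> s"
      using arg_cong[OF nine, of "ev (ind (kids s))"] kz by (simp add: ev_smul ev_add \<sigma>_def)
    have inG1: "inG 1 (f (glue s))" using hom_Grp[OF f zG] by (simp add: Grp_def)
    define d where "d = (if s = [] then c (KA, s) else y s)"
    have yint: "int_at 3 (y s)"
      using inG_nine[OF inG1, of "([(KA, s)], Some s)"] unfolding lk by (simp add: rig y_def)
    have dint: "int_at 3 d" unfolding d_def using yint cint[of "(KA, s)"] s by (cases "s = []") simp_all
    have \<sigma>int: "int_at 3 (\<sigma> s)" using inG_nine_ind[OF inG1, of "kids s"] unfolding k9 .
    have lV: "9 * lookup (f (glue s)) ([(KV, s)], None) = c (KV, s)"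
      and lA: "9 * lookup (f (glue s)) ([(KA, s)], None) = c (KA, s)"
      and ly: "9 * lookup (f (glue s)) ([(KA, s)], Some s) = y s"
      by (simp_all add: lk rig c_def y_def)
    have E9: "9 * ev (bphi 1 s) (f (glue s)) = c (KV, s) - c (KA, s) - 3 * d + 3 * \<sigma> s"
      unfolding ev_bphi d_def
      using lV lA ly k9 by (cases "s = []") simp_all
    have phi: "int_at 3 ((c (KV, s) - c (KA, s) - 3 * d + 3 * \<sigma> s) / 9)"
      unfolding E9[symmetric] using inG_phi[OF inG1, of s] by simp
    obtain e1 where e1: "e1 = 1 \<or> e1 = -1" "int_at 3 ((c (KV, s) - of_int e1) / 9)"
      using unit[of "(KV, s)"] s by (metis snd_conv)
    obtain e2 where e2: "e2 = 1 \<or> e2 = -1" "int_at 3 ((c (KA, s) - of_int e2) / 9)"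
      using unit[of "(KA, s)"] s by (metis snd_conv)
    have i3: "int_at 3 (3 * x)" if "int_at 3 x" for x
      using int_at_mult[OF three_prime int_at_of_int[OF three_prime, of 3] that] by simp
    \<comment> \<open>Read modulo 3, the condition compares only the two signs.\<close>
    have "of_int (e1 - e2) / of_nat 3 = 3 * ((c (KV, s) - c (KA, s) - 3 * d + 3 * \<sigma> s) / 9) + (d - \<sigma> s)
      - 3 * ((c (KV, s) - of_int e1) / 9) + 3 * ((c (KA, s) - of_int e2) / 9)"
      by (simp add: field_simps)
    moreover have "int_at 3 \<dots>"
      by (intro int_at_add[OF three_prime] int_at_diff[OF three_prime] i3 phi dint \<sigma>int e1(2) e2(2))
    ultimately have "int_at 3 (of_int (e1 - e2) / of_nat 3)" by (simp only:)
    hence "int 3 dvd e1 - e2" unfolding int_at_numeral_divide_iff[OF three_prime] .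
    hence e: "e1 = e2" using e1(1) e2(1) by auto
    \<comment> \<open>With equal signs the coefficients of \<open>V\<^sub>s\<close> and
      \<open>A\<^sub>s\<close> agree modulo 9, and only \<open>3 * (d - \<sigma> s)\<close> is left
      of the condition.\<close>
    have "(d - \<sigma> s) / 3 = (c (KV, s) - of_int e1) / 9 - (c (KA, s) - of_int e2) / 9
      - (c (KV, s) - c (KA, s) - 3 * d + 3 * \<sigma> s) / 9"
      using e by (simp add: field_simps)
    moreover have "int_at 3 \<dots>" by (intro int_at_diff[OF three_prime] phi e1(2) e2(2))
    ultimately have "int_at 3 ((d - \<sigma> s) / 3)" by (simp only:)
    thus ?thesis unfolding d_def .
  qed
  \<comment> \<open>The nodes that hand on a discrepancy which is nonzero modulo 3. The root is one,
    since a number that is \<open>\<plusminus>1\<close> modulo 9 enters it.\<close>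
  define bad where "bad s \<longleftrightarrow> s \<in> N \<and> \<not> int_at 3 (\<sigma> s / 3)" for s
  have bad_root: "bad []"
    unfolding bad_def
  proof (intro conjI root notI)
    assume "int_at 3 (\<sigma> [] / 3)"
    moreover obtain e where e: "e = 1 \<or> e = -1" "int_at 3 ((c (KA, []) - of_int e) / 9)"
      using unit[of "(KA, [])"] root by (metis snd_conv)
    ultimately have "int_at 3 ((c (KA, []) - \<sigma> []) / 3 + \<sigma> [] / 3 - of_int 3 * ((c (KA, []) - of_int e) / 9))"
      using main[OF root]
      by (intro int_at_add[OF three_prime] int_at_diff[OF three_prime] int_at_mult[OF three_prime]
          int_at_of_int[OF three_prime]) simp_all
    also have "(c (KA, []) - \<sigma> []) / 3 + \<sigma> [] / 3 - of_int 3 * ((c (KA, []) - of_int e) / 9)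
        = of_int e / of_nat 3"
      by (simp add: field_simps)
    finally have "int 3 dvd e" by (simp only: int_at_numeral_divide_iff[OF three_prime])
    thus False using e(1) by auto
  qed
  \<comment> \<open>A sum that is nonzero modulo 3 has such a summand. It is the coefficient of
    \<open>U\<^sub>s\<close> in the direction of a child \<open>r\<close>, and the copy
    \<open>A\<^sub>r\<close> turns it into the discrepancy entering \<open>r\<close>.\<close>
  have bad_child: "\<exists>r. bad r \<and> r \<noteq> [] \<and> tl r = s" if "bad s" for s
  proof -
    let ?x = "f (bv ([(KU, s)], None))"
    have s: "s \<in> N" using that by (simp add: bad_def)
    have "\<sigma> s / 3 = (\<Sum>b\<in>keys ?x \<inter> kids s. lookup ?x b / 3)"
      unfolding \<sigma>_def ev_ind_eq_sum by (simp add: sum_divide_distrib)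
    moreover have "\<not> int_at 3 (\<sigma> s / 3)" using that by (simp add: bad_def)
    ultimately obtain b where b: "b \<in> keys ?x" "b \<in> kids s" "\<not> int_at 3 (lookup ?x b / 3)"
      using int_at_sum[OF three_prime, of "keys ?x \<inter> kids s" "\<lambda>b. lookup ?x b / 3"] by auto
    then obtain r where r: "b = ([(KU, s)], Some r)" "r \<noteq> []" "tl r = s" by (auto simp: kids_def)
    have "bv ([(KU, s)], None) \<in> Grp 0 N" using s by (intro Grp_basis) (auto simp: bas_of_def)
    hence "b \<in> bas_of N" using hom_keys[OF f] b(1) by (auto simp: in_keys_iff)
    hence rN: "r \<in> N" using r by (auto simp: bas_of_def)
    have "y r = lookup ?x b"
      unfolding y_def using hom_copy[OF f R rN] r s by simp
    hence ny: "\<not> int_at 3 (y r / 3)" using b by simp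
    have "\<not> int_at 3 (\<sigma> r / 3)"
    proof
      assume "int_at 3 (\<sigma> r / 3)"
      hence "int_at 3 ((y r - \<sigma> r) / 3 + \<sigma> r / 3)"
        using main[OF rN] r by (intro int_at_add[OF three_prime]) simp_all
      thus False using ny by (simp add: field_simps)
    qed
    thus ?thesis using rN r by (auto simp: bad_def)
  qed
  have "\<exists>s. \<forall>n. (bad (s n) \<and> (n = 0 \<longrightarrow> s n = [])) \<and> (s (Suc n) \<noteq> [] \<and> tl (s (Suc n)) = s n)"
  proof (rule dependent_nat_choice)
    show "\<exists>s. bad s \<and> (0 = (0 :: nat) \<longrightarrow> s = [])" using bad_root by blast
    show "\<exists>r. (bad r \<and> (Suc n = 0 \<longrightarrow> r = [])) \<and> r \<noteq> [] \<and> tl r = s"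
      if "bad s \<and> (n = 0 \<longrightarrow> s = [])" for s n
      using bad_child[of s] that by blast
  qed
  then obtain s where s: "\<And>n. bad (s n)" "s 0 = []" "\<And>n. s (Suc n) \<noteq> []" "\<And>n. tl (s (Suc n)) = s n"
    by blast
  thus ?thesis unfolding bad_def by (intro exI[of _ s]) simp
qed

end

section \<open>Shift-invariant relations from a failing partition relation\<close>

locale colouring =
  fixes r :: "'v rel" and f :: "'v set \<Rightarrow> bool"
  assumes wo: "Well_order r"
begin

definition less :: "'v \<Rightarrow> 'v \<Rightarrow> bool" where
  "less a b \<longleftrightarrow> (a, b) \<in> r \<and> a \<noteq> b"

text \<open>The tuples below \<open>y 0\<close> for which replacing the first \<open>k\<close> entries of \<open>y\<close> by the entries
  \<open>1, \<dots>, k\<close> changes the colour.\<close>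

definition Dset :: "nat \<Rightarrow> nat \<Rightarrow> (nat \<Rightarrow> 'v) \<Rightarrow> 'v list set" where
  "Dset k m y = {a. length a = m \<and> set a \<subseteq> underS r (y 0)
     \<and> f (set a \<union> y ` {0..<k}) \<noteq> f (set a \<union> y ` {1..<Suc k})}"

definition Dpick :: "nat \<Rightarrow> nat \<Rightarrow> (nat \<Rightarrow> 'v) \<Rightarrow> 'v list" where
  "Dpick k m y = (SOME a. a \<in> Dset k m y)"

text \<open>A list of triples is a Skolem term: \<open>(k, m, l)\<close> selects the \<open>l\<close>-th entry of the chosen tuple.\<close>

fun val :: "(nat \<times> nat \<times> nat) list \<Rightarrow> (nat \<Rightarrow> 'v) \<Rightarrow> 'v" where
  "val [] x = x 0"
| "val ((k, m, l) # ts) x =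
     (if Dset k m (\<lambda>n. val ts (\<lambda>i. x (i + n))) \<noteq> {} \<and> l < m
      then Dpick k m (\<lambda>n. val ts (\<lambda>i. x (i + n))) ! l else val ts x)"

definition sq :: "(nat \<times> nat \<times> nat) list \<Rightarrow> (nat \<Rightarrow> 'v) \<Rightarrow> nat \<Rightarrow> 'v" where
  "sq ts x n = val ts (\<lambda>i. x (i + n))"

lemma sq_shift: "sq ts (\<lambda>i. x (i + m)) = (\<lambda>n. sq ts x (n + m))"
  by (rule ext) (simp add: sq_def add.assoc)

lemma Dset_cong:
  assumes "\<And>i. i \<le> k \<Longrightarrow> y i = y' i"
  shows "Dset k m y = Dset k m y'"
proof -
  have "y ` {0..<k} = y' ` {0..<k}" "y ` {1..<Suc k} = y' ` {1..<Suc k}"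
    using assms by (auto intro!: image_cong)
  thus ?thesis using assms[of 0] by (simp add: Dset_def)
qed

text \<open>Finite support is what allows questions about infinite sequences to be posed as
  predicates on finite words.\<close>

lemma val_finite_support: "\<exists>N. \<forall>x x'. (\<forall>i<N. x i = x' i) \<longrightarrow> val ts x = val ts x'"
proof (induction ts)
  case Nil
  show ?case by (intro exI[of _ 1]) auto
next
  case (Cons c ts)
  obtain k m l where c: "c = (k, m, l)" by (cases c) auto
  from Cons obtain N where N: "\<And>x x'. (\<forall>i<N. x i = x' i) \<Longrightarrow> val ts x = val ts x'" by blast
  show ?case
  proof (intro exI[of _ "N + k + 1"] allI impI)
    fix x x' :: "nat \<Rightarrow> 'v" assume x: "\<forall>i<N + k + 1. x i = x' i"
    have eq: "val ts (\<lambda>i. x (i + n)) = val ts (\<lambda>i. x' (i + n))" if "n \<le> k" for n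
      by (rule N) (use x that in auto)
    have D: "Dset k m (\<lambda>n. val ts (\<lambda>i. x (i + n))) = Dset k m (\<lambda>n. val ts (\<lambda>i. x' (i + n)))"
      by (rule Dset_cong) (rule eq)
    moreover have "val ts x = val ts x'" using eq[of 0] by simp
    ultimately show "val (c # ts) x = val (c # ts) x'" by (simp add: c Dpick_def)
  qed
qed

text \<open>Four kinds of questions about the sequence of \<open>ts\<close> from place
  \<open>d\<close> on: is its first step increasing, is it an equality, is there a witness of
  inhomogeneity, and which colour does the chosen witness give with the first block. The questions
  form a countable type, so \<open>from_nat\<close> enumerates them.\<close>

fun Q :: "nat \<times> nat \<times> nat \<times> nat \<times> (nat \<times> nat \<times> nat) list \<Rightarrow> (nat \<Rightarrow> 'v) \<Rightarrow> bool" where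
  "Q (i, d, k, m, ts) x = (let y = (\<lambda>n. sq ts x (n + d)) in
      if i = 0 then less (y 0) (y 1)
      else if i = 1 then y 0 = y 1
      else if i = 2 then Dset k m y \<noteq> {}
      else f (set (Dpick k m y) \<union> y ` {0..<k}))"

lemma Q_finite_support: "\<exists>N. \<forall>x x'. (\<forall>i<N. x i = x' i) \<longrightarrow> Q q x = Q q x'"
proof -
  obtain i d k m ts where q: "q = (i, d, k, m, ts)" by (cases q) auto
  from val_finite_support obtain N where N: "\<And>x x'. (\<forall>i<N. x i = x' i) \<Longrightarrow> val ts x = val ts x'" by blast
  show ?thesis
  proof (intro exI[of _ "N + d + k + 2"] allI impI)
    fix x x' :: "nat \<Rightarrow> 'v" assume x: "\<forall>i<N + d + k + 2. x i = x' i"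
    define y y' where "y = (\<lambda>n. sq ts x (n + d))" and "y' = (\<lambda>n. sq ts x' (n + d))"
    have eq: "y n = y' n" if "n \<le> k + 1" for n
      unfolding sq_def y_def y'_def by (rule N) (use x that in auto)
    have D: "Dset k m y = Dset k m y'"
      by (rule Dset_cong) (simp add: eq)
    have "y ` {0..<k} = y' ` {0..<k}" by (rule image_cong) (auto simp: eq)
    thus "Q q x = Q q x'"
      using eq[of 0] eq[of 1] D by (simp add: q Dpick_def Let_def flip: y_def y'_def)
  qed
qed

text \<open>The answer \<open>b\<close> is part of the index: thus passing truth from a word to its
  shift also passes falsity, and answers become invariant under the shift. The length
  \<open>Suc N\<close> covers the support and keeps the word nonempty.\<close>

definition P :: "nat \<Rightarrow> 'v list \<Rightarrow> bool" where
  "P n \<eta> = (case from_nat n of (q, b) \<Rightarrow>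
     (let N = (SOME N. \<forall>x x'. (\<forall>i<N. x i = x' i) \<longrightarrow> Q q x = Q q x')
      in length \<eta> = Suc N \<and> (Q q (\<lambda>i. if i < length \<eta> then \<eta> ! i else undefined) = b)))"

lemma Q_shift1:
  assumes "\<And>k n. P k (map x [0..<Suc n]) \<Longrightarrow> P k (map x [1..<Suc (Suc n)])"
  shows "Q q (\<lambda>i. x (i + 1)) = Q q x"
proof -
  define N where "N = (SOME N. \<forall>x x'. (\<forall>i<N. x i = x' i) \<longrightarrow> Q q x = Q q x')"
  have N: "Q q x = Q q x'" if "\<And>i. i < N \<Longrightarrow> x i = x' i" for x x'
    using someI_ex[OF Q_finite_support[of q]] that unfolding N_def by blast
  define n where "n = to_nat (q, Q q x)"
  have P: "P n \<eta> \<longleftrightarrow> length \<eta> = Suc N \<and> (Q q (\<lambda>i. if i < length \<eta> then \<eta> ! i else undefined) = Q q x)" for \<eta>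
    by (simp add: P_def n_def N_def[symmetric])
  have "P n (map x [0..<Suc N])" unfolding P by (auto intro!: N simp del: upt_Suc)
  hence "P n (map x [1..<Suc (Suc N)])" by (rule assms)
  hence "Q q (\<lambda>i. if i < Suc N then map x [1..<Suc (Suc N)] ! i else undefined) = Q q x"
    unfolding P by (simp del: upt_Suc)
  moreover have "Q q (\<lambda>i. if i < Suc N then map x [1..<Suc (Suc N)] ! i else undefined) = Q q (\<lambda>i. x (i + 1))"
    by (rule N) (simp del: upt_Suc)
  ultimately show ?thesis by simp
qed

context
  fixes x :: "nat \<Rightarrow> 'v"
  assumes shift: "\<And>k n. P k (map x [0..<Suc n]) \<Longrightarrow> P k (map x [1..<Suc (Suc n)])"
    and x: "range x \<subseteq> Field r"
begin

lemma Q_Suc: "Q (i, Suc d, k, m, ts) x = Q (i, d, k, m, ts) x"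
  using Q_shift1[OF shift, of "(i, d, k, m, ts)"] unfolding Q.simps sq_shift by simp

lemma Q_offset: "Q (i, d, k, m, ts) x = Q (i, 0, k, m, ts) x"
  by (induction d) (simp_all only: Q_Suc)

lemma val_Field: "range x' \<subseteq> Field r \<Longrightarrow> val ts x' \<in> Field r"
proof (induction ts)
  case (Cons c ts)
  obtain k m l where c: "c = (k, m, l)" by (cases c) auto
  define y where "y = (\<lambda>n. val ts (\<lambda>i. x' (i + n)))"
  have v: "val ts x' \<in> Field r" using Cons by auto
  show ?case
  proof (cases "Dset k m y \<noteq> {} \<and> l < m")
    case True
    hence "Dpick k m y \<in> Dset k m y" unfolding Dpick_def using some_in_eq by blast
    hence "Dpick k m y ! l \<in> underS r (y 0)" using True
      by (metis (mono_tags, lifting) Dset_def mem_Collect_eq nth_mem subsetD)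
    hence "Dpick k m y ! l \<in> Field r" by (auto simp: underS_def Field_def)
    thus ?thesis using True by (simp add: c flip: y_def)
  qed (use v in \<open>auto simp: c simp flip: y_def\<close>)
qed auto

lemma sq_Field: "sq ts x n \<in> Field r"
  unfolding sq_def using x by (intro val_Field) auto

lemma wf_less: "wf {(a, b). less a b}"
proof -
  have "{(a, b). less a b} = r - Id" by (auto simp: less_def)
  thus ?thesis using wo by (simp add: well_order_on_def)
qed

lemma less_trans: "less a b \<Longrightarrow> less b c \<Longrightarrow> less a c"
  using wo unfolding less_def well_order_on_def linear_order_on_def partial_order_on_def
    preorder_on_def by (metis antisymD transD)

lemma less_linear: "a \<in> Field r \<Longrightarrow> b \<in> Field r \<Longrightarrow> less a b \<or> a = b \<or> less b a"
  using wo unfolding less_def well_order_on_def linear_order_on_def total_on_def by metis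

text \<open>How consecutive entries compare does not depend on the place, so the sequence is
  increasing, constant or decreasing; well-foundedness excludes the last.\<close>

lemma sq_dichotomy: "(\<forall>n. less (sq ts x n) (sq ts x (Suc n))) \<or> (\<forall>n. sq ts x n = sq ts x 0)"
proof -
  have q0: "less (sq ts x n) (sq ts x (Suc n)) \<longleftrightarrow> less (sq ts x 0) (sq ts x 1)" for n
    using Q_offset[of 0 n 0 0 ts] by (simp add: Let_def)
  have q1: "sq ts x n = sq ts x (Suc n) \<longleftrightarrow> sq ts x 0 = sq ts x 1" for n
    using Q_offset[of 1 n 0 0 ts] by (simp add: Let_def)
  consider "less (sq ts x 0) (sq ts x 1)" | "sq ts x 0 = sq ts x 1"
    | "\<not> less (sq ts x 0) (sq ts x 1)" "sq ts x 0 \<noteq> sq ts x 1" by blast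
  thus ?thesis
  proof cases
    case 1
    hence "less (sq ts x n) (sq ts x (Suc n))" for n using q0[of n] by simp
    thus ?thesis by simp
  next
    case 2
    have "sq ts x n = sq ts x 0" for n
    proof (induction n)
      case (Suc n)
      thus ?case using q1[of n] 2 by simp
    qed simp
    thus ?thesis by simp
  next
    case 3
    have "less (sq ts x (Suc n)) (sq ts x n)" for n
      using 3 q0[of n] q1[of n] less_linear[OF sq_Field[of ts n] sq_Field[of ts "Suc n"]] by simp
    hence False using wf_less unfolding wf_iff_no_infinite_down_chain by blast
    thus ?thesis ..
  qed
qed

text \<open>Among the increasing sequences derived from \<open>x\<close> take one with least first entry: below it,
  Skolem witnesses of inhomogeneity would give a smaller one.\<close>

lemma homogeneous_if_nonconstant:
  assumes ne: "x 0 \<noteq> x 1"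
  shows "\<exists>H \<subseteq> Field r. Restr r H =o natLeq \<and> (\<forall>n. \<exists>c. \<forall>A \<in> nsets H n. f A = c)"
proof -
  define I where "I ts \<longleftrightarrow> (\<forall>n. less (sq ts x n) (sq ts x (Suc n)))" for ts
  have "sq [] x 1 \<noteq> sq [] x 0" using ne by (simp add: sq_def)
  hence "I []" using sq_dichotomy[of "[]"] unfolding I_def by blast
  hence ne: "{sq ts x 0 | ts. I ts} \<noteq> {}" by blast
  obtain b where b: "b \<in> {sq ts x 0 | ts. I ts}"
    "\<And>a. (a, b) \<in> {(a, b). less a b} \<Longrightarrow> a \<notin> {sq ts x 0 | ts. I ts}"
    by (rule wfE_min'[OF wf_less ne]) auto
  from b(1) obtain ts where ts: "I ts" "b = sq ts x 0" by auto
  have min: "\<not> less (sq ts' x 0) (sq ts x 0)" if "I ts'" for ts'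
    using b(2)[of "sq ts' x 0"] that ts(2) by auto
  define y where "y = sq ts x"
  have inc: "less (y n) (y (Suc n))" for n using ts(1) unfolding I_def y_def by simp
  have yF: "y n \<in> Field r" for n unfolding y_def by (rule sq_Field)
  have mono: "less (y m) (y n)" if "m < n" for m n
    using that
  proof (induction n)
    case (Suc n)
    thus ?case using inc[of n] less_trans[of "y m" "y n" "y (Suc n)"] by (cases "m = n") auto
  qed simp
  \<comment> \<open>For each \<open>l\<close> the \<open>l\<close>-th entries of the chosen tuples
    form a sequence that starts below \<open>y 0\<close>; by minimality it is not increasing, hence
    constant. So \<open>a 1 = a 0\<close>, and the invariance of the colour (question
    \<open>3\<close>) contradicts the choice of \<open>a 0\<close> as a witness.\<close>
  have D0: "Dset k m y = {}" for k m
  proof (rule ccontr)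
    assume D: "Dset k m y \<noteq> {}"
    define z where "z n = (\<lambda>i. y (i + n))" for n
    define a where "a n = Dpick k m (z n)" for n
    have "Dset k m (z n) \<noteq> {}" for n
      using Q_offset[of 2 n k m ts] D unfolding z_def y_def by simp
    hence a: "a n \<in> Dset k m (z n)" for n
      unfolding a_def Dpick_def using some_in_eq by blast
    have az: "a n ! l = sq ((k, m, l) # ts) x n" if "l < m" for l n
    proof -
      have "(\<lambda>n'. val ts (\<lambda>i. x (i + n' + n))) = z n"
        by (rule ext) (simp add: z_def y_def sq_def add.assoc)
      thus ?thesis using that \<open>Dset k m (z n) \<noteq> {}\<close> by (simp add: sq_def[of "_ # _"] a_def)
    qed
    have const: "a n ! l = a 0 ! l" if l: "l < m" for l n
    proof -
      have "\<not> I ((k, m, l) # ts)"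
      proof
        assume "I ((k, m, l) # ts)"
        hence "\<not> less (a 0 ! l) (y 0)" using min az[OF l] unfolding y_def by simp
        moreover have "a 0 ! l \<in> underS r (y 0)"
          using a[of 0] l unfolding Dset_def z_def by (auto simp: subset_iff)
        ultimately show False by (auto simp: less_def underS_def)
      qed
      hence "sq ((k, m, l) # ts) x n = sq ((k, m, l) # ts) x 0"
        using sq_dichotomy[of "(k, m, l) # ts"] unfolding I_def by blast
      thus ?thesis by (simp only: az[OF l])
    qed
    have len: "length (a n) = m" for n using a[of n] by (simp add: Dset_def)
    have "a 1 = a 0"
    proof (rule nth_equalityI)
      show "length (a 1) = length (a 0)" by (simp only: len)
      show "a 1 ! i = a 0 ! i" if "i < length (a 1)" for i
        using const[of i 1] that by (simp only: len)
    qed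
    moreover have "f (set (a 1) \<union> z 1 ` {0..<k}) = f (set (a 0) \<union> z 0 ` {0..<k})"
      using Q_offset[of 3 1 k m ts] by (simp add: a_def z_def y_def Let_def)
    moreover have "f (set (a 0) \<union> z 0 ` {0..<k}) \<noteq> f (set (a 0) \<union> z 0 ` {1..<Suc k})"
      using a[of 0] by (simp add: Dset_def)
    moreover have "z 1 ` {0..<k} = z 0 ` {1..<Suc k}"
    proof -
      have "{1..<Suc k} = Suc ` {0..<k}" by simp
      thus ?thesis by (simp only: image_image) (simp add: z_def)
    qed
    ultimately show False by simp
  qed
  \<comment> \<open>Question \<open>2\<close> carries the absence of witnesses from place
    \<open>0\<close> to every place \<open>n\<close>.\<close>
  have step: "f (A \<union> y ` {n..<n + k}) = f (A \<union> y ` {Suc n..<Suc n + k})"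
    if A: "finite A" "A \<subseteq> underS r (y n)" for A n k
  proof -
    obtain l where l: "set l = A" using finite_list[OF A(1)] by blast
    have "Dset k (length l) (\<lambda>i. y (i + n)) = {}"
      using Q_offset[of 2 n k "length l" ts] D0[of k "length l"] unfolding y_def by simp
    hence "l \<notin> Dset k (length l) (\<lambda>i. y (i + n))" by simp
    hence "f (A \<union> (\<lambda>i. y (i + n)) ` {0..<k}) = f (A \<union> (\<lambda>i. y (i + n)) ` {1..<Suc k})"
      using l A unfolding Dset_def by simp
    moreover have "(\<lambda>i. y (i + n)) ` {p..<q} = y ` {p + n..<q + n}" for p q
      unfolding image_image[of y "\<lambda>i. i + n", symmetric] by simp
    ultimately show ?thesis by (simp add: add.commute)
  qed
  have steps: "f (A \<union> y ` {n..<n + k}) = f (A \<union> y ` {n + d..<n + d + k})"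
    if A: "finite A" "A \<subseteq> underS r (y n)" for A n k d
  proof (induction d)
    case (Suc d)
    have "A \<subseteq> underS r (y (n + d))"
    proof
      fix a assume "a \<in> A"
      hence "less a (y n)" using A by (auto simp: underS_def less_def)
      hence "less a (y (n + d))" using mono[of n "n + d"] less_trans by (cases "d = 0") auto
      thus "a \<in> underS r (y (n + d))" by (auto simp: underS_def less_def)
    qed
    thus ?case using Suc step[OF A(1), of "n + d" k] by simp
  qed simp
  \<comment> \<open>Slide the block to the least element \<open>b\<close> of \<open>B\<close>,
    absorb \<open>y b\<close> into \<open>A\<close>, and treat the rest of \<open>B\<close> by
    induction.\<close>
  have homog: "f (A \<union> y ` B) = f (A \<union> y ` {n..<n + card B})"
    if "finite B" "finite A" "A \<subseteq> underS r (y n)" "\<forall>b\<in>B. n \<le> b" for A B n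
    using that
  proof (induction "card B" arbitrary: A B n)
    case 0
    thus ?case by simp
  next
    case (Suc k)
    define b where "b = Min B"
    have B: "B \<noteq> {}" using Suc.hyps(2) by auto
    have b: "b \<in> B" "\<And>c. c \<in> B \<Longrightarrow> b \<le> c" using Suc.prems(1) B by (auto simp: b_def)
    have bS: "\<forall>c\<in>B - {b}. Suc b \<le> c" using b(2) by (force simp: Suc_le_eq order.strict_iff_order)
    have nb: "n \<le> b" using b Suc.prems by auto
    have k: "k = card (B - {b})" using Suc.hyps(2) b Suc.prems(1) by simp
    have A': "insert (y b) A \<subseteq> underS r (y (Suc b))"
    proof
      fix a assume a: "a \<in> insert (y b) A"
      have "less a (y (Suc b))"
      proof (cases "a = y b")
        case False
        hence "less a (y n)" using a Suc.prems by (auto simp: underS_def less_def)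
        thus ?thesis using mono[of n "Suc b"] nb less_trans by auto
      qed (use inc in simp)
      thus "a \<in> underS r (y (Suc b))" by (auto simp: underS_def less_def)
    qed
    have "f (A \<union> y ` {n..<n + card B}) = f (A \<union> y ` {b..<b + card B})"
      using steps[OF Suc.prems(2,3), of "card B" "b - n"] nb by simp
    also have "{b..<b + card B} = insert b {Suc b..<Suc b + k}" using Suc.hyps(2) by auto
    also have "A \<union> y ` insert b {Suc b..<Suc b + k} = insert (y b) A \<union> y ` {Suc b..<Suc b + card (B - {b})}"
      using k by auto
    also have "f \<dots> = f (insert (y b) A \<union> y ` (B - {b}))"
      by (rule Suc.hyps(1)[OF k, symmetric]) (use Suc.prems A' bS in auto)
    also have "insert (y b) A \<union> y ` (B - {b}) = A \<union> y ` B" using b by auto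
    finally show ?case by simp
  qed
  have inj: "inj y"
    by (rule injI) (metis less_def mono nat_neq_iff)
  have "\<exists>c. \<forall>A \<in> nsets (range y) n. f A = c" for n
  proof (intro exI ballI)
    fix A assume "A \<in> nsets (range y) n"
    hence A: "A \<subseteq> range y" "finite A" "card A = n" by (auto simp: nsets_def)
    then obtain B where B: "A = y ` B" by (metis subset_imageE)
    have "finite B" "card B = n" using A B inj by (auto simp: finite_image_iff card_image inj_on_subset)
    thus "f A = f (y ` {0..<n})" using homog[of B "{}" 0] B by simp
  qed
  moreover have "natLeq =o Restr r (range y)"
  proof -
    have rfl: "(y n, y n) \<in> r" for n
      using wo yF[of n] unfolding well_order_on_def linear_order_on_def
          partial_order_on_def preorder_on_def refl_on_def by simp
    have F: "Field (Restr r (range y)) = range y"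
    proof
      show "range y \<subseteq> Field (Restr r (range y))"
      proof
        fix a assume "a \<in> range y"
        hence "(a, a) \<in> Restr r (range y)" using rfl by auto
        thus "a \<in> Field (Restr r (range y))" by (auto simp: Field_def)
      qed
    qed (auto simp: Field_def)
    have le: "(y m, y n) \<in> r \<longleftrightarrow> m \<le> n" for m n
    proof (cases "m = n")
      case True
      thus ?thesis using rfl by simp
    next
      case False
      hence "m < n \<or> n < m" by auto
      thus ?thesis using mono[of m n] mono[of n m] less_trans[of "y m" "y n" "y m"] False inj
        by (auto simp: less_def inj_eq)
    qed
    have "BNF_Wellorder_Embedding.iso natLeq (Restr r (range y)) y"
      unfolding iso_iff2 F Field_natLeq using inj le by (auto simp: bij_betw_def natLeq_def)
    thus ?thesis using natLeq_Well_order Well_order_Restr[OF wo] unfolding ordIso_def by auto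
  qed
  ultimately show ?thesis using yF by (intro exI[of _ "range y"]) (auto intro: ordIso_symmetric)
qed

end

end

text \<open>The only consequence of \<open>\<alpha> < \<kappa>(\<omega>)\<close> that is needed; it takes the place of absolutely rigid coloured
  trees.\<close>

lemma not_arrow_omega_imp_rigid:
  fixes r :: "'v rel"
  assumes wo: "Well_order r" and na: "\<not> arrow_omega r"
  shows "\<exists>P :: nat \<Rightarrow> 'v list \<Rightarrow> bool. \<forall>x. range x \<subseteq> Field r \<longrightarrow>
     (\<forall>k n. P k (map x [0..<Suc n]) \<longrightarrow> P k (map x [1..<Suc (Suc n)])) \<longrightarrow> x 0 = x 1"
proof -
  obtain f :: "'v set \<Rightarrow> bool" where
    f: "\<not> (\<exists>H \<subseteq> Field r. Restr r H =o natLeq \<and> (\<forall>n. \<exists>c. \<forall>A \<in> nsets H n. f A = c))"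
    using na unfolding arrow_omega_def by blast
  interpret colouring r f by unfold_locales (rule wo)
  show ?thesis
    by (rule exI[of _ P]) (use homogeneous_if_nonconstant f in blast)
qed

section \<open>Generic enumerations of groups\<close>

primrec nsum :: "nat \<Rightarrow> 'g::ab_group_add \<Rightarrow> 'g" where
  "nsum 0 x = 0"
| "nsum (Suc n) x = nsum n x + x"

lemma forcing_notion_refl: "forcing_notion P \<Longrightarrow> p \<in> Field P \<Longrightarrow> (p, p) \<in> P"
  unfolding forcing_notion_def preorder_on_def refl_on_def by blast

text \<open>A condition \<open>p\<close> decides the initial segment \<open>l p\<close> of a generic enumeration of \<open>G\<close>; the name
  \<open>M\<close> stands for the addition of \<open>G\<close> carried back to \<open>\<nat>\<close> along this enumeration.\<close>

locale reading =
  fixes P :: "'p rel" and G :: "'g::ab_group_add set" and l :: "'p \<Rightarrow> 'g list" and M :: "'p gname"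
  assumes forcing: "forcing_notion P"
    and l_mono: "(q, p) \<in> P \<Longrightarrow> prefix (l p) (l q)"
    and l_distinct: "p \<in> Field P \<Longrightarrow> distinct (l p)"
    and l_set: "p \<in> Field P \<Longrightarrow> set (l p) \<subseteq> G"
    and l_ext: "p \<in> Field P \<Longrightarrow> distinct s \<Longrightarrow> set s \<subseteq> G \<Longrightarrow> prefix (l p) s \<Longrightarrow> \<exists>q. (q, p) \<in> P \<and> l q = s"
    and M_iff: "r \<in> Field P \<Longrightarrow> (\<exists>s. ((a, b, c), s) \<in> M \<and> (r, s) \<in> P) \<longleftrightarrow>
      a < length (l r) \<and> b < length (l r) \<and> c < length (l r) \<and> l r ! a + l r ! b = l r ! c"
    and G_infinite: "infinite G"
    and G_zero: "0 \<in> G"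
    and G_add: "x \<in> G \<Longrightarrow> y \<in> G \<Longrightarrow> x + y \<in> G"
    and G_uminus: "x \<in> G \<Longrightarrow> - x \<in> G"
begin

lemma P_refl: "p \<in> Field P \<Longrightarrow> (p, p) \<in> P"
  by (rule forcing_notion_refl[OF forcing])

lemma P_trans: "(r, q) \<in> P \<Longrightarrow> (q, p) \<in> P \<Longrightarrow> (r, p) \<in> P"
  using forcing unfolding forcing_notion_def preorder_on_def by (blast dest: transD)

lemma P_Field1: "(q, p) \<in> P \<Longrightarrow> q \<in> Field P"
  by (rule FieldI1)

lemma forces_in_mono: "forces_in P x \<tau> p \<Longrightarrow> (q, p) \<in> P \<Longrightarrow> forces_in P x \<tau> q"
  unfolding forces_in_def using P_trans by blast

lemma l_length: "(q, p) \<in> P \<Longrightarrow> length (l p) \<le> length (l q)"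
  using l_mono by (rule prefix_length_le)

lemma l_nth: "(q, p) \<in> P \<Longrightarrow> a < length (l p) \<Longrightarrow> l q ! a = l p ! a"
  using l_mono[of q p] by (auto simp: prefix_def nth_append)

lemma l_nth_in: "p \<in> Field P \<Longrightarrow> a < length (l p) \<Longrightarrow> l p ! a \<in> G"
  using l_set nth_mem by blast

lemma extend_elem:
  assumes p: "p \<in> Field P" and g: "g \<in> G"
  shows "\<exists>q a. (q, p) \<in> P \<and> a < length (l q) \<and> l q ! a = g"
proof (cases "g \<in> set (l p)")
  case True
  thus ?thesis using P_refl[OF p] by (auto simp: in_set_conv_nth)
next
  case False
  then obtain q where "(q, p) \<in> P" "l q = l p @ [g]"
    using l_ext[OF p, of "l p @ [g]"] l_distinct[OF p] l_set[OF p] g by auto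
  thus ?thesis by (intro exI[of _ q] exI[of _ "length (l p)"]) auto
qed

lemma extend_length:
  assumes p: "p \<in> Field P"
  shows "\<exists>q. (q, p) \<in> P \<and> n \<le> length (l q)"
proof (induction n)
  case 0
  show ?case using P_refl[OF p] by blast
next
  case (Suc n)
  then obtain q where q: "(q, p) \<in> P" "n \<le> length (l q)" by blast
  obtain g where g: "g \<in> G" "g \<notin> set (l q)"
    using G_infinite finite_subset[of G "set (l q)"] by auto
  obtain r where r: "(r, q) \<in> P" "l r = l q @ [g]"
    using l_ext[OF P_Field1[OF q(1)], of "l q @ [g]"] g l_distinct[OF P_Field1[OF q(1)]]
      l_set[OF P_Field1[OF q(1)]] by auto
  thus ?case using q P_trans by (intro exI[of _ r]) auto
qed

text \<open>The condition \<open>p\<close> need not decide the entries yet. It suffices to ask the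
  stronger conditions that have reached length \<open>n\<close>, and these are dense.\<close>

lemma forces_M:
  assumes n: "a < n" "b < n" "c < n" and p: "p \<in> Field P"
  shows "forces_in P (a, b, c) M p \<longleftrightarrow>
    (\<forall>q. (q, p) \<in> P \<longrightarrow> n \<le> length (l q) \<longrightarrow> l q ! a + l q ! b = l q ! c)"
proof
  assume f: "forces_in P (a, b, c) M p"
  show "\<forall>q. (q, p) \<in> P \<longrightarrow> n \<le> length (l q) \<longrightarrow> l q ! a + l q ! b = l q ! c"
  proof (intro allI impI)
    fix q assume q: "(q, p) \<in> P" "n \<le> length (l q)"
    then obtain r s where r: "(r, q) \<in> P" "((a, b, c), s) \<in> M" "(r, s) \<in> P"
      using f unfolding forces_in_def by blast
    have "l r ! a + l r ! b = l r ! c" using iffD1[OF M_iff[OF P_Field1[OF r(1)]]] r(2,3) by blast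
    moreover have "a < length (l q)" "b < length (l q)" "c < length (l q)" using n q(2) by auto
    ultimately show "l q ! a + l q ! b = l q ! c" by (simp only: l_nth[OF r(1)])
  qed
next
  assume *: "\<forall>q. (q, p) \<in> P \<longrightarrow> n \<le> length (l q) \<longrightarrow> l q ! a + l q ! b = l q ! c"
  show "forces_in P (a, b, c) M p"
    unfolding forces_in_def
  proof (intro allI impI)
    fix q assume q: "(q, p) \<in> P"
    obtain r where r: "(r, q) \<in> P" "n \<le> length (l r)" using extend_length[OF P_Field1[OF q]] by blast
    have "l r ! a + l r ! b = l r ! c" using * P_trans[OF r(1) q] r(2) by blast
    hence "\<exists>s. ((a, b, c), s) \<in> M \<and> (r, s) \<in> P"
      using n r(2) by (intro iffD2[OF M_iff[OF P_Field1[OF r(1)]]]) auto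
    thus "\<exists>r. (r, q) \<in> P \<and> (\<exists>s. ((a, b, c), s) \<in> M \<and> (r, s) \<in> P)" using r(1) by blast
  qed
qed

lemma forces_M_now:
  assumes p: "p \<in> Field P" and n: "a < length (l p)" "b < length (l p)" "c < length (l p)"
  shows "forces_in P (a, b, c) M p \<longleftrightarrow> l p ! a + l p ! b = l p ! c"
proof -
  have eq: "l q ! a = l p ! a" "l q ! b = l p ! b" "l q ! c = l p ! c" if "(q, p) \<in> P" for q
    using l_nth[OF that] n by blast+
  define m where "m = length (l p)"
  have n': "a < m" "b < m" "c < m" using n by (auto simp: m_def)
  show ?thesis unfolding forces_M[OF n' p]
  proof
    assume "\<forall>q. (q, p) \<in> P \<longrightarrow> m \<le> length (l q) \<longrightarrow> l q ! a + l q ! b = l q ! c"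
    from this[rule_format, OF P_refl[OF p]] show "l p ! a + l p ! b = l p ! c" unfolding m_def by blast
  next
    assume "l p ! a + l p ! b = l p ! c"
    thus "\<forall>q. (q, p) \<in> P \<longrightarrow> m \<le> length (l q) \<longrightarrow> l q ! a + l q ! b = l q ! c"
      using eq by metis
  qed
qed

lemma forces_M_add:
  assumes p: "p \<in> Field P"
  shows "\<exists>q c. (q, p) \<in> P \<and> forces_in P (a, b, c) M q"
proof -
  obtain q where q: "(q, p) \<in> P" "Suc (a + b) \<le> length (l q)" using extend_length[OF p] by blast
  have "l q ! a + l q ! b \<in> G" using q by (intro G_add l_nth_in) (auto dest: P_Field1)
  then obtain r c where r: "(r, q) \<in> P" "c < length (l r)" "l r ! c = l q ! a + l q ! b"
    using extend_elem[OF P_Field1[OF q(1)]] by metis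
  hence "forces_in P (a, b, c) M r"
    using forces_M_now[OF P_Field1[OF r(1)], of a b c] q l_length[OF r(1)] l_nth[OF r(1)] by simp
  thus ?thesis using r q P_trans by blast
qed

lemma forces_zero_iff:
  assumes p: "p \<in> Field P"
  shows "forces_zero P M z p \<longleftrightarrow> (\<forall>q. (q, p) \<in> P \<longrightarrow> z < length (l q) \<longrightarrow> l q ! z = 0)"
proof
  assume z: "forces_zero P M z p"
  show "\<forall>q. (q, p) \<in> P \<longrightarrow> z < length (l q) \<longrightarrow> l q ! z = 0"
  proof (intro allI impI)
    fix q assume "(q, p) \<in> P" "z < length (l q)"
    hence "l q ! z + l q ! z = l q ! z"
      using z forces_M[of z "Suc z" z z p, OF _ _ _ p] unfolding forces_zero_def by simp
    thus "l q ! z = 0" by simp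
  qed
next
  assume z: "\<forall>q. (q, p) \<in> P \<longrightarrow> z < length (l q) \<longrightarrow> l q ! z = 0"
  show "forces_zero P M z p"
    unfolding forces_zero_def
  proof
    fix a
    show "forces_in P (z, a, a) M p"
      using z by (subst forces_M[of z "Suc (a + z)", OF _ _ _ p]) auto
  qed
qed

lemma forces_multiple_imp:
  assumes "forces_multiple P M n a c p" "p \<in> Field P" "(q, p) \<in> P" "a < length (l q)" "c < length (l q)"
  shows "nsum n (l q ! a) = l q ! c"
  using assms
proof (induction n arbitrary: c p q)
  case 0
  thus ?case using forces_zero_iff[of p c] by simp
next
  case (Suc n)
  from Suc.prems(1,3) obtain r d where r: "(r, q) \<in> P" "forces_multiple P M n a d r" "forces_in P (d, a, c) M r"
    unfolding forces_multiple.simps fex_def by blast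
  obtain s where s: "(s, r) \<in> P" "Suc (a + c + d) \<le> length (l s)"
    using extend_length[OF P_Field1[OF r(1)]] by blast
  have "nsum n (l s ! a) = l s ! d"
    by (rule Suc.IH[OF r(2) P_Field1[OF r(1)] s(1)]) (use s in auto)
  moreover have "l s ! d + l s ! a = l s ! c"
    using forces_M[of d "Suc (a + c + d)" a c r] r s P_Field1[OF r(1)] by simp
  ultimately have "nsum (Suc n) (l s ! a) = l s ! c" by simp
  thus ?case using l_nth[OF P_trans[OF s(1) r(1)]] Suc.prems by simp
qed

lemma forces_TFAG:
  assumes tf: "\<And>x n. x \<in> G \<Longrightarrow> n > 0 \<Longrightarrow> nsum n x = 0 \<Longrightarrow> x = 0" and p: "p \<in> Field P"
  shows "TFAG P M p"
  unfolding TFAG_def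
proof (intro conjI allI impI)
  show "fex P (\<lambda>c. forces_in P (a, b, c) M) p" for a b
    unfolding fex_def using forces_M_add P_Field1 by blast
next
  fix a b c c' :: nat assume ne: "c \<noteq> c'"
  show "fnot P (\<lambda>q. forces_in P (a, b, c) M q \<and> forces_in P (a, b, c') M q) p"
    unfolding fnot_def
  proof (intro allI impI notI)
    fix q assume q: "(q, p) \<in> P" and f: "forces_in P (a, b, c) M q \<and> forces_in P (a, b, c') M q"
    let ?n = "Suc (a + b + c + c')"
    obtain r where r: "(r, q) \<in> P" "?n \<le> length (l r)" using extend_length[OF P_Field1[OF q]] by blast
    have "l r ! c = l r ! c'"
      using f r forces_M[of a ?n b c, OF _ _ _ P_Field1[OF q]] forces_M[of a ?n b c', OF _ _ _ P_Field1[OF q]]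
      by auto
    thus False using ne r l_distinct[OF P_Field1[OF r(1)]] by (simp add: nth_eq_iff_index_eq)
  qed
next
  fix a b c u v w :: nat
  show "fimp P (\<lambda>q. forces_in P (a, b, u) M q \<and> forces_in P (b, c, v) M q \<and> forces_in P (u, c, w) M q)
     (forces_in P (a, v, w) M) p"
    unfolding fimp_def
  proof (intro allI impI)
    fix q assume q: "(q, p) \<in> P"
      and f: "forces_in P (a, b, u) M q \<and> forces_in P (b, c, v) M q \<and> forces_in P (u, c, w) M q"
    let ?n = "Suc (a + b + c + u + v + w)"
    note F = forces_M[where n = ?n, OF _ _ _ P_Field1[OF q]]
    have "a < ?n" "b < ?n" "c < ?n" "u < ?n" "v < ?n" "w < ?n" by auto
    note F = F[OF this(1,2,4)] F[OF this(2,3,5)] F[OF this(4,3,6)] F[OF this(1,5,6)]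
    have "l r ! a + l r ! v = l r ! w" if "(r, q) \<in> P" "?n \<le> length (l r)" for r
    proof -
      have "l r ! a + l r ! b = l r ! u" "l r ! b + l r ! c = l r ! v" "l r ! u + l r ! c = l r ! w"
        using f that unfolding F(1-3) by blast+
      thus ?thesis using add.assoc[of "l r ! a" "l r ! b" "l r ! c"] by simp
    qed
    thus "forces_in P (a, v, w) M q" unfolding F(4) by blast
  qed
next
  fix a b c :: nat
  show "fimp P (forces_in P (a, b, c) M) (forces_in P (b, a, c) M) p"
    unfolding fimp_def
  proof (intro allI impI)
    fix q assume q: "(q, p) \<in> P" and f: "forces_in P (a, b, c) M q"
    let ?n = "Suc (a + b + c)"
    note F = forces_M[where n = ?n, OF _ _ _ P_Field1[OF q]]
    have "a < ?n" "b < ?n" "c < ?n" by auto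
    note F = F[OF this(1,2,3)] F[OF this(2,1,3)]
    show "forces_in P (b, a, c) M q" using f unfolding F by (simp only: add.commute)
  qed
next
  show "fex P (\<lambda>z q. forces_zero P M z q \<and> (\<forall>a. fex P (\<lambda>b. forces_in P (a, b, z) M) q)) p"
    unfolding fex_def[of P "\<lambda>z q. forces_zero P M z q \<and> (\<forall>a. fex P (\<lambda>b. forces_in P (a, b, z) M) q)"]
  proof (intro allI impI)
    fix q assume q: "(q, p) \<in> P"
    obtain r z where r: "(r, q) \<in> P" "z < length (l r)" "l r ! z = 0"
      using extend_elem[OF P_Field1[OF q] G_zero] by blast
    have z: "l s ! z = 0" if "(s, r) \<in> P" for s using l_nth[OF that r(2)] r(3) by simp
    have "forces_zero P M z r" unfolding forces_zero_iff[OF P_Field1[OF r(1)]] using z by blast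
    moreover have "fex P (\<lambda>b. forces_in P (a, b, z) M) r" for a
      unfolding fex_def
    proof (intro allI impI)
      fix s assume s: "(s, r) \<in> P"
      obtain t where t: "(t, s) \<in> P" "Suc a \<le> length (l t)" using extend_length[OF P_Field1[OF s]] by blast
      have "- (l t ! a) \<in> G" using t by (intro G_uminus l_nth_in) (auto dest: P_Field1)
      then obtain t' b where t': "(t', t) \<in> P" "b < length (l t')" "l t' ! b = - (l t ! a)"
        using extend_elem[OF P_Field1[OF t(1)]] by metis
      have tr: "(t', r) \<in> P" using t' t s P_trans by blast
      have "forces_in P (a, b, z) M t'"
        using forces_M_now[OF P_Field1[OF t'(1)], of a b z] t t' l_length[OF t'(1)] l_nth[OF t'(1), of a]
          z[OF tr] l_length[OF tr] r(2) by simp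
      thus "\<exists>r. (r, s) \<in> P \<and> (\<exists>x. forces_in P (a, x, z) M r)" using t' t P_trans by blast
    qed
    ultimately show "\<exists>r. (r, q) \<in> P \<and> (\<exists>x. forces_zero P M x r \<and> (\<forall>a. fex P (\<lambda>b. forces_in P (a, b, x) M) r))"
      using r(1) by blast
  qed
next
  fix n a z :: nat assume n: "n > 0"
  show "fimp P (\<lambda>q. forces_zero P M z q \<and> forces_multiple P M n a z q) (forces_zero P M a) p"
    unfolding fimp_def
  proof (intro allI impI)
    fix q assume q: "(q, p) \<in> P" and f: "forces_zero P M z q \<and> forces_multiple P M n a z q"
    have "l r ! a = 0" if r: "(r, q) \<in> P" "a < length (l r)" for r
    proof -
      obtain s where s: "(s, r) \<in> P" "Suc (a + z) \<le> length (l s)"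
        using extend_length[OF P_Field1[OF r(1)]] by blast
      have sq: "(s, q) \<in> P" using s r P_trans by blast
      have "l s ! z = 0" using f forces_zero_iff[OF P_Field1[OF q]] sq s by simp
      hence "nsum n (l s ! a) = 0"
        using forces_multiple_imp[OF conjunct2[OF f] P_Field1[OF q] sq] s by simp
      hence "l s ! a = 0" using tf[OF l_nth_in n] P_Field1[OF s(1)] s by simp
      thus ?thesis using l_nth[OF s(1) r(2)] by simp
    qed
    thus "forces_zero P M a q" unfolding forces_zero_iff[OF P_Field1[OF q]] by blast
  qed
qed

end

section \<open>Pairs of generic enumerations and names for maps between the groups\<close>

locale two_readings = L: reading P G l M + R: reading P H k N
  for P :: "'p rel" and G :: "'g::ab_group_add set" and l M and H :: "'g set" and k N +
  assumes joint_ext: "p \<in> Field P \<Longrightarrow> distinct s \<Longrightarrow> set s \<subseteq> G \<Longrightarrow> prefix (l p) s \<Longrightarrow>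
     distinct t \<Longrightarrow> set t \<subseteq> H \<Longrightarrow> prefix (k p) t \<Longrightarrow> \<exists>q. (q, p) \<in> P \<and> l q = s \<and> k q = t"
begin

lemma extend_both:
  assumes p: "p \<in> Field P"
  shows "\<exists>q. (q, p) \<in> P \<and> n \<le> length (l q) \<and> n \<le> length (k q)"
proof -
  obtain q where q: "(q, p) \<in> P" "n \<le> length (l q)" using L.extend_length[OF p] by blast
  obtain r where r: "(r, q) \<in> P" "n \<le> length (k r)" using R.extend_length[OF L.P_Field1[OF q(1)]] by blast
  thus ?thesis using q L.l_length[OF r(1)] L.P_trans[OF r(1) q(1)] by (intro exI[of _ r]) auto
qed

text \<open>In the extension this is the map between the two copies on the natural numbers that the
  ground model map \<open>\<theta>\<close> induces.\<close>

definition graph_name :: "('g \<Rightarrow> 'g) \<Rightarrow> (nat \<times> nat, 'p) name" where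
  "graph_name \<theta> = {((a, b), u) | a b u. u \<in> Field P \<and> a < length (l u) \<and> b < length (k u) \<and> k u ! b = \<theta> (l u ! a)}"

lemma is_name_graph: "is_name P (graph_name \<theta>)"
  by (auto simp: is_name_def graph_name_def)

lemma forces_graph:
  assumes n: "a < n" "b < n" and p: "p \<in> Field P"
  shows "forces_in P (a, b) (graph_name \<theta>) p \<longleftrightarrow>
    (\<forall>q. (q, p) \<in> P \<longrightarrow> n \<le> length (l q) \<longrightarrow> n \<le> length (k q) \<longrightarrow> k q ! b = \<theta> (l q ! a))"
proof
  assume f: "forces_in P (a, b) (graph_name \<theta>) p"
  show "\<forall>q. (q, p) \<in> P \<longrightarrow> n \<le> length (l q) \<longrightarrow> n \<le> length (k q) \<longrightarrow> k q ! b = \<theta> (l q ! a)"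
  proof (intro allI impI)
    fix q assume q: "(q, p) \<in> P" "n \<le> length (l q)" "n \<le> length (k q)"
    then obtain r s where r: "(r, q) \<in> P" "((a, b), s) \<in> graph_name \<theta>" "(r, s) \<in> P"
      using f unfolding forces_in_def by blast
    hence "k s ! b = \<theta> (l s ! a)" "a < length (l s)" "b < length (k s)" by (auto simp: graph_name_def)
    hence "k r ! b = \<theta> (l r ! a)" using L.l_nth[OF r(3)] R.l_nth[OF r(3)] by simp
    thus "k q ! b = \<theta> (l q ! a)" using L.l_nth[OF r(1), of a] R.l_nth[OF r(1), of b] n q by simp
  qed
next
  assume *: "\<forall>q. (q, p) \<in> P \<longrightarrow> n \<le> length (l q) \<longrightarrow> n \<le> length (k q) \<longrightarrow> k q ! b = \<theta> (l q ! a)"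
  show "forces_in P (a, b) (graph_name \<theta>) p"
    unfolding forces_in_def
  proof (intro allI impI)
    fix q assume q: "(q, p) \<in> P"
    obtain r where r: "(r, q) \<in> P" "n \<le> length (l r)" "n \<le> length (k r)"
      using extend_both[OF L.P_Field1[OF q]] by blast
    have "k r ! b = \<theta> (l r ! a)" using * L.P_trans[OF r(1) q] r by blast
    hence "((a, b), r) \<in> graph_name \<theta>" using r n L.P_Field1[OF r(1)] by (auto simp: graph_name_def)
    thus "\<exists>r. (r, q) \<in> P \<and> (\<exists>s. ((a, b), s) \<in> graph_name \<theta> \<and> (r, s) \<in> P)"
      using r(1) L.P_refl[OF L.P_Field1[OF r(1)]] by blast
  qed
qed

lemma forces_graph_now:
  assumes p: "p \<in> Field P" and n: "a < length (l p)" "b < length (k p)"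
  shows "forces_in P (a, b) (graph_name \<theta>) p \<longleftrightarrow> k p ! b = \<theta> (l p ! a)"
proof -
  let ?n = "Suc (a + b)"
  obtain q where q: "(q, p) \<in> P" "?n \<le> length (l q)" "?n \<le> length (k q)"
    using extend_both[OF p] by blast
  have "a < ?n" "b < ?n" by auto
  note F = forces_graph[OF this p, of \<theta>]
  have eq: "l r ! a = l p ! a" "k r ! b = k p ! b" if "(r, p) \<in> P" for r
    using L.l_nth[OF that n(1)] R.l_nth[OF that n(2)] by auto
  show ?thesis unfolding F
  proof
    assume "\<forall>q. (q, p) \<in> P \<longrightarrow> ?n \<le> length (l q) \<longrightarrow> ?n \<le> length (k q) \<longrightarrow> k q ! b = \<theta> (l q ! a)"
    hence "k q ! b = \<theta> (l q ! a)" using q by blast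
    thus "k p ! b = \<theta> (l p ! a)" using eq[OF q(1)] by simp
  qed (simp add: eq)
qed

context
  fixes \<theta> :: "'g \<Rightarrow> 'g"
  assumes img: "\<And>x. x \<in> G \<Longrightarrow> \<theta> x \<in> H" and inj: "inj_on \<theta> G"
    and add: "\<And>x y. x \<in> G \<Longrightarrow> y \<in> G \<Longrightarrow> \<theta> (x + y) = \<theta> x + \<theta> y"
begin

lemma forces_embedding_graph:
  assumes p: "p \<in> Field P"
  shows "forces_embedding P M N (graph_name \<theta>) p"
  unfolding forces_embedding_def forces_injection_def
proof (intro conjI ballI allI impI)
  fix a :: nat
  show "fex P (\<lambda>b. forces_in P (a, b) (graph_name \<theta>)) p"
    unfolding fex_def
  proof (intro allI impI)
    fix q assume q: "(q, p) \<in> P"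
    obtain r where r: "(r, q) \<in> P" "Suc a \<le> length (l r)" using L.extend_length[OF L.P_Field1[OF q]] by blast
    have "\<theta> (l r ! a) \<in> H" using r by (intro img L.l_nth_in) (auto dest: L.P_Field1)
    then obtain s b where s: "(s, r) \<in> P" "b < length (k s)" "k s ! b = \<theta> (l r ! a)"
      using R.extend_elem[OF L.P_Field1[OF r(1)]] by metis
    have "forces_in P (a, b) (graph_name \<theta>) s"
      using forces_graph_now[OF L.P_Field1[OF s(1)], of a b] r s L.l_length[OF s(1)] L.l_nth[OF s(1), of a] by simp
    thus "\<exists>r. (r, q) \<in> P \<and> (\<exists>x. forces_in P (a, x) (graph_name \<theta>) r)" using s r L.P_trans by blast
  qed
next
  fix a b b' :: nat assume ne: "b \<noteq> b'"
  show "fnot P (\<lambda>q. forces_in P (a, b) (graph_name \<theta>) q \<and> forces_in P (a, b') (graph_name \<theta>) q) p"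
    unfolding fnot_def
  proof (intro allI impI notI)
    fix q assume q: "(q, p) \<in> P" and f: "forces_in P (a, b) (graph_name \<theta>) q \<and> forces_in P (a, b') (graph_name \<theta>) q"
    let ?n = "Suc (a + b + b')"
    obtain r where r: "(r, q) \<in> P" "?n \<le> length (l r)" "?n \<le> length (k r)"
      using extend_both[OF L.P_Field1[OF q]] by blast
    have "a < ?n" "b < ?n" "b' < ?n" by auto
    note F' = forces_graph[OF this(1,2) L.P_Field1[OF q]] forces_graph[OF this(1,3) L.P_Field1[OF q]]
    have "k r ! b = \<theta> (l r ! a)" "k r ! b' = \<theta> (l r ! a)"
      using f r unfolding F' by blast+
    hence "k r ! b = k r ! b'" by simp
    thus False using ne r R.l_distinct[OF L.P_Field1[OF r(1)]] by (simp add: nth_eq_iff_index_eq)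
  qed
next
  fix a a' b :: nat assume ne: "a \<noteq> a'"
  show "fnot P (\<lambda>q. forces_in P (a, b) (graph_name \<theta>) q \<and> forces_in P (a', b) (graph_name \<theta>) q) p"
    unfolding fnot_def
  proof (intro allI impI notI)
    fix q assume q: "(q, p) \<in> P" and f: "forces_in P (a, b) (graph_name \<theta>) q \<and> forces_in P (a', b) (graph_name \<theta>) q"
    let ?n = "Suc (a + a' + b)"
    obtain r where r: "(r, q) \<in> P" "?n \<le> length (l r)" "?n \<le> length (k r)"
      using extend_both[OF L.P_Field1[OF q]] by blast
    note F = L.P_Field1[OF r(1)]
    have "a < ?n" "a' < ?n" "b < ?n" by auto
    note F' = forces_graph[OF this(1,3) L.P_Field1[OF q]] forces_graph[OF this(2,3) L.P_Field1[OF q]]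
    have "k r ! b = \<theta> (l r ! a)" "k r ! b = \<theta> (l r ! a')"
      using f r unfolding F' by blast+
    hence "\<theta> (l r ! a) = \<theta> (l r ! a')" by simp
    moreover have "l r ! a \<in> G" "l r ! a' \<in> G" using r(2) by (auto intro: L.l_nth_in[OF F])
    ultimately have "l r ! a = l r ! a'" by (rule inj_onD[OF inj])
    thus False using ne r L.l_distinct[OF F] by (simp add: nth_eq_iff_index_eq)
  qed
next
  fix a b c a' b' c' :: nat
  show "fimp P (\<lambda>q. forces_in P (a, b, c) M q \<and> forces_in P (a, a') (graph_name \<theta>) q \<and>
          forces_in P (b, b') (graph_name \<theta>) q \<and> forces_in P (c, c') (graph_name \<theta>) q)
          (forces_in P (a', b', c') N) p"
    unfolding fimp_def
  proof (intro allI impI)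
    fix q assume q: "(q, p) \<in> P" and f: "forces_in P (a, b, c) M q \<and> forces_in P (a, a') (graph_name \<theta>) q \<and>
          forces_in P (b, b') (graph_name \<theta>) q \<and> forces_in P (c, c') (graph_name \<theta>) q"
    note qF = L.P_Field1[OF q]
    let ?n = "Suc (a + b + c + a' + b' + c')"
    have n: "a < ?n" "b < ?n" "c < ?n" "a' < ?n" "b' < ?n" "c' < ?n" by auto
    note F' = L.forces_M[OF n(1-3) qF] forces_graph[OF n(1,4) qF] forces_graph[OF n(2,5) qF]
      forces_graph[OF n(3,6) qF]
    have "k r ! a' + k r ! b' = k r ! c'" if r: "(r, q) \<in> P" "?n \<le> length (k r)" for r
    proof -
      obtain s where s: "(s, r) \<in> P" "?n \<le> length (l s)" "?n \<le> length (k s)"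
        using extend_both[OF L.P_Field1[OF r(1)]] by blast
      have sq: "(s, q) \<in> P" using s r L.P_trans by blast
      have eqs: "l s ! a + l s ! b = l s ! c" "k s ! a' = \<theta> (l s ! a)"
        "k s ! b' = \<theta> (l s ! b)" "k s ! c' = \<theta> (l s ! c)"
        using f sq s unfolding F' by blast+
      have "a < length (l s)" "b < length (l s)" using n(1,2) s(2) by linarith+
      hence "l s ! a \<in> G" "l s ! b \<in> G" using L.l_nth_in[OF L.P_Field1[OF s(1)]] by blast+
      hence "\<theta> (l s ! a + l s ! b) = \<theta> (l s ! a) + \<theta> (l s ! b)" by (rule add)
      hence "k s ! a' + k s ! b' = k s ! c'" by (simp only: eqs)
      thus ?thesis using R.l_nth[OF s(1)] r(2) by simp
    qed
    thus "forces_in P (a', b', c') N q" unfolding R.forces_M[OF n(4-6) qF] by blast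
  qed
qed

lemma forces_embeds_graph:
  assumes p: "p \<in> Field P" and len: "length as = length bs"
    and as: "\<And>i. i < length as \<Longrightarrow> as ! i < length (l p) \<and> bs ! i < length (k p) \<and> k p ! (bs ! i) = \<theta> (l p ! (as ! i))"
  shows "forces_embeds P M as N bs p"
  unfolding forces_embeds_def fex_def
proof (intro conjI len allI impI)
  fix q assume q: "(q, p) \<in> P"
  have f: "forces_in P (as ! i, bs ! i) (graph_name \<theta>) q" if "i < length as" for i
  proof -
    have i: "as ! i < length (l p)" "bs ! i < length (k p)" "k p ! (bs ! i) = \<theta> (l p ! (as ! i))"
      using as[OF that] by blast+
    have "forces_in P (as ! i, bs ! i) (graph_name \<theta>) p"
      by (rule iffD2[OF forces_graph_now[OF p i(1,2), where \<theta> = \<theta>] i(3)])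
    thus ?thesis by (rule L.forces_in_mono[OF _ q])
  qed
  show "\<exists>r. (r, q) \<in> P \<and> (\<exists>x. is_name P x \<and> forces_embedding P M N x r \<and> (\<forall>i<length as. forces_in P (as ! i, bs ! i) x r))"
  proof (rule exI[of _ q], rule conjI[OF L.P_refl[OF L.P_Field1[OF q]]], rule exI[of _ "graph_name \<theta>"],
      rule conjI[OF is_name_graph], rule conjI[OF forces_embedding_graph[OF L.P_Field1[OF q]]])
    show "\<forall>i<length as. forces_in P (as ! i, bs ! i) (graph_name \<theta>) q" using f by simp
  qed
qed

lemma forces_iso_graph:
  assumes p: "p \<in> Field P" and surj: "H \<subseteq> \<theta> ` G"
  shows "forces_iso P M N p"
  unfolding forces_iso_def fex_def[of P "\<lambda>f q. is_name P f \<and> forces_isomorphism P M N f q"]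
proof (intro allI impI)
  fix q assume q: "(q, p) \<in> P"
  note qF = L.P_Field1[OF q]
  have "fex P (\<lambda>a. forces_in P (a, b) (graph_name \<theta>)) q" for b
    unfolding fex_def
  proof (intro allI impI)
    fix q' assume q': "(q', q) \<in> P"
    obtain r where r: "(r, q') \<in> P" "Suc b \<le> length (k r)" using R.extend_length[OF L.P_Field1[OF q']] by blast
    have "k r ! b \<in> H" using r by (intro R.l_nth_in) (auto dest: L.P_Field1)
    then obtain g where g: "g \<in> G" "\<theta> g = k r ! b" using surj by auto
    then obtain s a where s: "(s, r) \<in> P" "a < length (l s)" "l s ! a = g"
      using L.extend_elem[OF L.P_Field1[OF r(1)]] by metis
    have b: "b < length (k r)" using r(2) by simp
    have "forces_in P (a, b) (graph_name \<theta>) s"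
    proof (rule iffD2[OF forces_graph_now[OF L.P_Field1[OF s(1)] s(2)]])
      show "b < length (k s)" using b R.l_length[OF s(1)] by simp
      show "k s ! b = \<theta> (l s ! a)" using R.l_nth[OF s(1) b] g(2) s(3) by simp
    qed
    thus "\<exists>r. (r, q') \<in> P \<and> (\<exists>x. forces_in P (x, b) (graph_name \<theta>) r)" using s r L.P_trans by blast
  qed
  hence "forces_isomorphism P M N (graph_name \<theta>) q"
    unfolding forces_isomorphism_def using forces_embedding_graph[OF qF] by blast
  note conjI[OF is_name_graph this]
  thus "\<exists>r. (r, q) \<in> P \<and> (\<exists>x. is_name P x \<and> forces_isomorphism P M N x r)"
    using L.P_refl[OF qF] by blast
qed

end

end

section \<open>Back and forth\<close>

text \<open>Iterated restrictions reduce to a single one, so the recursion of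
  \<open>forces_sim\<close> only meets restrictions of the original ordinal.\<close>

lemma underS_Restr:
  assumes "Well_order r" "I \<subseteq> Field r" "\<And>x y. x \<in> I \<Longrightarrow> (y, x) \<in> r \<Longrightarrow> y \<in> I" "x \<in> I"
  shows "Restr (Restr r I) (underS (Restr r I) x) = Restr r (underS r x)"
proof -
  have sub: "underS r x \<subseteq> I" using assms(3)[OF assms(4)] unfolding underS_def by blast
  hence "underS (Restr r I) x = underS r x" using assms(4) unfolding underS_def by blast
  thus ?thesis using sub by blast
qed

lemma Field_Restr_ideal:
  assumes "Well_order r" "I \<subseteq> Field r"
  shows "Field (Restr r I) = I"
proof
  have "refl_on (Field r) r"
    using assms(1) unfolding well_order_on_def linear_order_on_def partial_order_on_def preorder_on_def
    by blast
  hence "(x, x) \<in> Restr r I" if "x \<in> I" for x using that assms(2) unfolding refl_on_def by blast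
  thus "I \<subseteq> Field (Restr r I)" by (blast intro: FieldI1)
qed (auto simp: Field_def)

context two_readings
begin

lemma swap: "two_readings P H k N G l M"
proof -
  show ?thesis
    by (intro two_readings.intro R.reading_axioms L.reading_axioms two_readings_axioms.intro)
      (use joint_ext in blast)
qed

text \<open>\<open>B I gs hs\<close> is a system of positions from which the duplicator survives as long as the
  spoiler's clock is in the initial segment \<open>I\<close>.\<close>

context
  fixes \<alpha> :: "'o rel" and B :: "'o set \<Rightarrow> 'g list \<Rightarrow> 'g list \<Rightarrow> bool"
  assumes wo: "Well_order \<alpha>"
    and B_forth_emb: "\<And>I gs hs. B I gs hs \<Longrightarrow> \<exists>\<theta>. (\<forall>x\<in>G. \<theta> x \<in> H) \<and> inj_on \<theta> G \<and>
      (\<forall>x\<in>G. \<forall>y\<in>G. \<theta> (x + y) = \<theta> x + \<theta> y) \<and> map \<theta> gs = hs"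
    and B_back_emb: "\<And>I gs hs. B I gs hs \<Longrightarrow> \<exists>\<theta>. (\<forall>x\<in>H. \<theta> x \<in> G) \<and> inj_on \<theta> H \<and>
      (\<forall>x\<in>H. \<forall>y\<in>H. \<theta> (x + y) = \<theta> x + \<theta> y) \<and> map \<theta> hs = gs"
    and B_forth: "\<And>I gs hs x g. B I gs hs \<Longrightarrow> x \<in> I \<Longrightarrow> g \<in> G \<Longrightarrow> \<exists>h\<in>H. B (underS \<alpha> x) (gs @ [g]) (hs @ [h])"
    and B_back: "\<And>I gs hs x h. B I gs hs \<Longrightarrow> x \<in> I \<Longrightarrow> h \<in> H \<Longrightarrow> \<exists>g\<in>G. B (underS \<alpha> x) (gs @ [g]) (hs @ [h])"
    and B_weaken: "\<And>I gs hs x. B I gs hs \<Longrightarrow> x \<in> I \<Longrightarrow> B (underS \<alpha> x) gs hs"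
begin

text \<open>A position of \<open>B\<close> read through the enumerations; \<open>p\<close> must
  already decide all indices played.\<close>

definition good :: "'o set \<Rightarrow> nat list \<Rightarrow> nat list \<Rightarrow> 'p \<Rightarrow> bool" where
  "good I as bs p \<longleftrightarrow> p \<in> Field P \<and> set as \<subseteq> {..<length (l p)} \<and> set bs \<subseteq> {..<length (k p)}
     \<and> B I (map ((!) (l p)) as) (map ((!) (k p)) bs)"

definition ideal :: "'o set \<Rightarrow> bool" where
  "ideal I \<longleftrightarrow> I \<subseteq> Field \<alpha> \<and> (\<forall>x\<in>I. \<forall>y. (y, x) \<in> \<alpha> \<longrightarrow> y \<in> I)"

lemma B_length: "B I gs hs \<Longrightarrow> length gs = length hs"
proof -
  assume "B I gs hs"
  from B_forth_emb[OF this] obtain \<theta> where "map \<theta> gs = hs" by (elim exE conjE)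
  thus ?thesis by auto
qed

lemma map_l_mono: "(q, p) \<in> P \<Longrightarrow> set as \<subseteq> {..<length (l p)} \<Longrightarrow> map ((!) (l q)) as = map ((!) (l p)) as"
  by (rule map_cong) (auto simp: L.l_nth)

lemma map_k_mono: "(q, p) \<in> P \<Longrightarrow> set bs \<subseteq> {..<length (k p)} \<Longrightarrow> map ((!) (k q)) bs = map ((!) (k p)) bs"
  by (rule map_cong) (auto simp: R.l_nth)

lemma good_mono:
  assumes g: "good I as bs p" and q: "(q, p) \<in> P"
  shows "good I as bs q"
proof -
  have s: "set as \<subseteq> {..<length (l p)}" "set bs \<subseteq> {..<length (k p)}" using g by (auto simp: good_def)
  hence "set as \<subseteq> {..<length (l q)}" "set bs \<subseteq> {..<length (k q)}"
    using L.l_length[OF q] R.l_length[OF q] by force+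
  thus ?thesis
    using g L.P_Field1[OF q] unfolding good_def map_l_mono[OF q s(1)] map_k_mono[OF q s(2)] by blast
qed

lemma good_forth:
  assumes g: "good I as bs p" and x: "x \<in> I"
  shows "\<exists>q b. (q, p) \<in> P \<and> good (underS \<alpha> x) (as @ [a]) (bs @ [b]) q"
proof -
  have p: "p \<in> Field P" using g by (simp add: good_def)
  obtain q where q: "(q, p) \<in> P" "Suc a \<le> length (l q)" using L.extend_length[OF p] by blast
  have gq: "good I as bs q" using good_mono[OF g q(1)] .
  have "l q ! a \<in> G" using q by (intro L.l_nth_in) (auto dest: L.P_Field1)
  then obtain h where h: "h \<in> H" "B (underS \<alpha> x) (map ((!) (l q)) as @ [l q ! a]) (map ((!) (k q)) bs @ [h])"
    using B_forth[OF _ x] gq unfolding good_def by blast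
  obtain r b where r: "(r, q) \<in> P" "b < length (k r)" "k r ! b = h"
    using R.extend_elem[OF L.P_Field1[OF q(1)] h(1)] by blast
  have "good I as bs r" using good_mono[OF gq r(1)] .
  moreover have e: "map ((!) (l r)) as = map ((!) (l q)) as" "map ((!) (k r)) bs = map ((!) (k q)) bs"
    using gq map_l_mono[OF r(1)] map_k_mono[OF r(1)] unfolding good_def by blast+
  have "l r ! a = l q ! a" using L.l_nth[OF r(1)] q(2) by simp
  hence "B (underS \<alpha> x) (map ((!) (l r)) (as @ [a])) (map ((!) (k r)) (bs @ [b]))"
    unfolding map_append list.map e r(3) using h(2) by (simp only:)
  moreover have "a < length (l r)" using q(2) L.l_length[OF r(1)] by simp
  ultimately have "good (underS \<alpha> x) (as @ [a]) (bs @ [b]) r"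
    using r(2) unfolding good_def by auto
  thus ?thesis using L.P_trans[OF r(1) q(1)] by blast
qed

lemma good_back:
  assumes g: "good I as bs p" and x: "x \<in> I"
  shows "\<exists>q a. (q, p) \<in> P \<and> good (underS \<alpha> x) (as @ [a]) (bs @ [b]) q"
proof -
  have p: "p \<in> Field P" using g by (simp add: good_def)
  obtain q where q: "(q, p) \<in> P" "Suc b \<le> length (k q)" using R.extend_length[OF p] by blast
  have gq: "good I as bs q" using good_mono[OF g q(1)] .
  have "k q ! b \<in> H" using q by (intro R.l_nth_in) (auto dest: L.P_Field1)
  then obtain h where h: "h \<in> G" "B (underS \<alpha> x) (map ((!) (l q)) as @ [h]) (map ((!) (k q)) bs @ [k q ! b])"
    using B_back[OF _ x] gq unfolding good_def by blast
  obtain r a where r: "(r, q) \<in> P" "a < length (l r)" "l r ! a = h"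
    using L.extend_elem[OF L.P_Field1[OF q(1)] h(1)] by blast
  have "good I as bs r" using good_mono[OF gq r(1)] .
  moreover have e: "map ((!) (l r)) as = map ((!) (l q)) as" "map ((!) (k r)) bs = map ((!) (k q)) bs"
    using gq map_l_mono[OF r(1)] map_k_mono[OF r(1)] unfolding good_def by blast+
  have "k r ! b = k q ! b" using R.l_nth[OF r(1)] q(2) by simp
  hence "B (underS \<alpha> x) (map ((!) (l r)) (as @ [a])) (map ((!) (k r)) (bs @ [b]))"
    unfolding map_append list.map e r(3) using h(2) by (simp only:)
  moreover have "b < length (k r)" using q(2) R.l_length[OF r(1)] by simp
  ultimately have "good (underS \<alpha> x) (as @ [a]) (bs @ [b]) r"
    using r(2) unfolding good_def by auto
  thus ?thesis using L.P_trans[OF r(1) q(1)] by blast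
qed

lemma good_forces_embeds:
  assumes g: "good I as bs p"
  shows "forces_embeds P M as N bs p" "forces_embeds P N bs M as p"
proof -
  have p: "p \<in> Field P" and as: "set as \<subseteq> {..<length (l p)}" and bs: "set bs \<subseteq> {..<length (k p)}"
    and B: "B I (map ((!) (l p)) as) (map ((!) (k p)) bs)" using g by (auto simp: good_def)
  have len: "length as = length bs" using B_length[OF B] by simp
  have nth: "as ! i < length (l p)" "bs ! i < length (k p)" if "i < length as" for i
    using subsetD[OF as nth_mem[OF that]] subsetD[OF bs nth_mem] that len by auto
  obtain \<theta> where \<theta>: "\<forall>x\<in>G. \<theta> x \<in> H" "inj_on \<theta> G" "\<forall>x\<in>G. \<forall>y\<in>G. \<theta> (x + y) = \<theta> x + \<theta> y"
    "map \<theta> (map ((!) (l p)) as) = map ((!) (k p)) bs" using B_forth_emb[OF B] by blast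
  have "as ! i < length (l p) \<and> bs ! i < length (k p) \<and> k p ! (bs ! i) = \<theta> (l p ! (as ! i))" if "i < length as" for i
    using that nth len arg_cong[OF \<theta>(4), of "\<lambda>xs. xs ! i"] by simp
  thus "forces_embeds P M as N bs p" using \<theta> by (intro forces_embeds_graph[of \<theta>] p len) blast+
  interpret S: two_readings P H k N G l M by (rule swap)
  obtain \<theta> where \<theta>: "\<forall>x\<in>H. \<theta> x \<in> G" "inj_on \<theta> H" "\<forall>x\<in>H. \<forall>y\<in>H. \<theta> (x + y) = \<theta> x + \<theta> y"
    "map \<theta> (map ((!) (k p)) bs) = map ((!) (l p)) as" using B_back_emb[OF B] by blast
  have "bs ! i < length (k p) \<and> as ! i < length (l p) \<and> l p ! (as ! i) = \<theta> (k p ! (bs ! i))" if "i < length bs" for i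
    using that nth len arg_cong[OF \<theta>(4), of "\<lambda>xs. xs ! i"] by simp
  thus "forces_embeds P N bs M as p" using \<theta> by (intro S.forces_embeds_graph[of \<theta>] p len[symmetric]) blast+
qed

text \<open>The induction hypothesis is an assumption here so that one step serves the proper
  initial segments as well as the whole field, which need not be of the form
  \<open>underS \<alpha> x\<close>.\<close>

lemma sim_step:
  assumes I: "ideal I" and g: "good I as bs p"
    and IH: "\<And>x as bs p. x \<in> I \<Longrightarrow> good (underS \<alpha> x) as bs p \<Longrightarrow> forces_sim P M N (Restr \<alpha> (underS \<alpha> x)) as bs p"
  shows "forces_sim P M N (Restr \<alpha> I) as bs p"
proof -
  let ?r = "Restr \<alpha> I"
  have IF: "I \<subseteq> Field \<alpha>" and Id: "\<And>x y. x \<in> I \<Longrightarrow> (y, x) \<in> \<alpha> \<Longrightarrow> y \<in> I" using I by (auto simp: ideal_def)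
  have F: "Field ?r = I" by (rule Field_Restr_ideal[OF wo IF])
  have W: "Well_order ?r" by (rule Well_order_Restr[OF wo])
  have U: "Restr ?r (underS ?r x) = Restr \<alpha> (underS \<alpha> x)" if "x \<in> I" for x
    by (rule underS_Restr[OF wo IF Id that])
  consider "I = {}" | x where "x \<in> I" "\<forall>y\<in>I. (y, x) \<in> ?r"
    | "I \<noteq> {}" "\<not> (\<exists>x\<in>I. \<forall>y\<in>I. (y, x) \<in> ?r)" by blast
  thus ?thesis
  proof cases
    case 1
    thus ?thesis using good_forces_embeds[OF g] by (simp add: forces_sim.zero)
  next
    case 2
    show ?thesis
    proof (rule forces_sim.succ[OF W, of x])
      show "x \<in> Field ?r" "\<forall>y\<in>Field ?r. (y, x) \<in> ?r" using 2 F by auto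
      show "\<forall>a. fex P (\<lambda>b. forces_sim P M N (Restr ?r (underS ?r x)) (as @ [a]) (bs @ [b])) p"
        unfolding U[OF 2(1)] fex_def
      proof (intro allI impI)
        fix a q assume "(q, p) \<in> P"
        from good_forth[OF good_mono[OF g this] 2(1)] obtain r b where
          "(r, q) \<in> P" "good (underS \<alpha> x) (as @ [a]) (bs @ [b]) r" by blast
        with IH[OF 2(1)] show "\<exists>r. (r, q) \<in> P \<and>
            (\<exists>b. forces_sim P M N (Restr \<alpha> (underS \<alpha> x)) (as @ [a]) (bs @ [b]) r)" by blast
      qed
      show "\<forall>b. fex P (\<lambda>a. forces_sim P M N (Restr ?r (underS ?r x)) (as @ [a]) (bs @ [b])) p"
        unfolding U[OF 2(1)] fex_def
      proof (intro allI impI)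
        fix b q assume "(q, p) \<in> P"
        from good_back[OF good_mono[OF g this] 2(1)] obtain r a where
          "(r, q) \<in> P" "good (underS \<alpha> x) (as @ [a]) (bs @ [b]) r" by blast
        with IH[OF 2(1)] show "\<exists>r. (r, q) \<in> P \<and>
            (\<exists>a. forces_sim P M N (Restr \<alpha> (underS \<alpha> x)) (as @ [a]) (bs @ [b]) r)" by blast
      qed
    qed
  next
    case 3
    show ?thesis
    proof (rule forces_sim.lim[OF W])
      show "?r \<noteq> {}" using 3(1) F by (metis Field_empty)
      show "\<not> (\<exists>x\<in>Field ?r. \<forall>y\<in>Field ?r. (y, x) \<in> ?r)" using 3(2) F by simp
      show "\<forall>x\<in>Field ?r. forces_sim P M N (Restr ?r (underS ?r x)) as bs p"
      proof
        fix x assume "x \<in> Field ?r"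
        hence x: "x \<in> I" using F by simp
        have "good (underS \<alpha> x) as bs p" using g B_weaken[OF _ x] by (simp add: good_def)
        thus "forces_sim P M N (Restr ?r (underS ?r x)) as bs p" unfolding U[OF x] by (rule IH[OF x])
      qed
    qed
  qed
qed

lemma ideal_underS: "ideal (underS \<alpha> x)"
proof -
  have "trans \<alpha>" "antisym \<alpha>"
    using wo unfolding well_order_on_def linear_order_on_def partial_order_on_def preorder_on_def by auto
  hence "(w, x) \<in> \<alpha> \<and> w \<noteq> x" if "(y, x) \<in> \<alpha>" "y \<noteq> x" "(w, y) \<in> \<alpha>" for w y
    using that by (metis antisymD transD)
  moreover have "underS \<alpha> x \<subseteq> Field \<alpha>" by (auto simp: underS_def Field_def)
  ultimately show ?thesis unfolding ideal_def underS_def by blast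
qed

theorem forces_sim_of_system:
  assumes p: "p \<in> Field P" and B: "B (Field \<alpha>) [] []"
  shows "forces_sim P M N \<alpha> [] [] p"
proof -
  have wf: "wf (\<alpha> - Id)" using wo by (simp add: well_order_on_def)
  have U: "forces_sim P M N (Restr \<alpha> (underS \<alpha> x)) as bs p" if "good (underS \<alpha> x) as bs p" for x as bs p
    using that
  proof (induction x arbitrary: as bs p rule: wf_induct_rule[OF wf])
    case (1 x)
    show ?case
    proof (rule sim_step[OF ideal_underS 1(2)])
      fix y as bs p assume "y \<in> underS \<alpha> x" "good (underS \<alpha> y) as bs p"
      thus "forces_sim P M N (Restr \<alpha> (underS \<alpha> y)) as bs p"
        by (intro 1(1)) (auto simp: underS_def)
    qed
  qed
  have "ideal (Field \<alpha>)" by (auto simp: ideal_def FieldI1)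
  moreover have "good (Field \<alpha>) [] [] p" using p B by (simp add: good_def)
  ultimately have "forces_sim P M N (Restr \<alpha> (Field \<alpha>)) [] [] p"
    by (rule sim_step) (rule U)
  moreover have "Restr \<alpha> (Field \<alpha>) = \<alpha>" by (auto simp: Field_def)
  ultimately show ?thesis by simp
qed

end

text \<open>Closing off along an \<open>\<omega>\<close>-sequence of conditions deciding more and more of a forced isomorphism \<open>F\<close>;
  the sequence need not be generic, so the resulting partial isomorphism lies in the ground model.\<close>

context
  fixes nd :: "'g \<Rightarrow> 'n set" and z :: 'n
  assumes nd_finite: "\<And>g. finite (nd g)"
    and G_countable: "\<And>A. finite A \<Longrightarrow> countable {g \<in> G. nd g \<subseteq> A}"
    and H_countable: "\<And>A. finite A \<Longrightarrow> countable {h \<in> H. nd h \<subseteq> A}"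
begin

section \<open>The part of a forced isomorphism that a condition decides\<close>

definition rel :: "(nat \<times> nat, 'p) name \<Rightarrow> 'p \<Rightarrow> ('g \<times> 'g) set" where
  "rel F r = {(l r ! a, k r ! b) | a b. a < length (l r) \<and> b < length (k r) \<and> forces_in P (a, b) F r}"

text \<open>Including \<open>z\<close> guarantees that the final set of nodes contains it; it will
  be the root, where the branch starts.\<close>

definition nds :: "(nat \<times> nat, 'p) name \<Rightarrow> 'p \<Rightarrow> 'n set" where
  "nds F r = insert z (\<Union>(nd ` (fst ` rel F r \<union> snd ` rel F r)))"

lemma relI:
  "a < length (l r) \<Longrightarrow> b < length (k r) \<Longrightarrow> forces_in P (a, b) F r \<Longrightarrow> (l r ! a, k r ! b) \<in> rel F r"
  unfolding rel_def by blast

lemma rel_mono: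
  assumes "(q, p) \<in> P"
  shows "rel F p \<subseteq> rel F q"
proof
  fix x assume "x \<in> rel F p"
  then obtain a b where x: "x = (l p ! a, k p ! b)" and a: "a < length (l p)" and b: "b < length (k p)"
    and f: "forces_in P (a, b) F p"
    unfolding rel_def by blast
  have "a < length (l q)" "b < length (k q)"
    using a b L.l_length[OF assms] R.l_length[OF assms] by simp_all
  from relI[OF this L.forces_in_mono[OF f assms]] show "x \<in> rel F q"
    unfolding x L.l_nth[OF assms a] R.l_nth[OF assms b] .
qed

lemma rel_finite: "finite (rel F r)"
proof -
  have "rel F r \<subseteq> (\<lambda>(a, b). (l r ! a, k r ! b)) ` ({..<length (l r)} \<times> {..<length (k r)})"
    by (auto simp: rel_def)
  thus ?thesis by (rule finite_subset) simp
qed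

lemma nds_finite: "finite (nds F r)"
  unfolding nds_def using rel_finite[of F r] nd_finite by auto

lemma nds_mono: "(q, p) \<in> P \<Longrightarrow> nds F p \<subseteq> nds F q"
  unfolding nds_def using rel_mono[of q p F] by blast

lemma rel_subset: "r \<in> Field P \<Longrightarrow> rel F r \<subseteq> G \<times> H"
  unfolding rel_def using L.l_nth_in R.l_nth_in by auto

context
  fixes F r0
  assumes r0: "r0 \<in> Field P" and iso: "forces_isomorphism P M N F r0"
begin

lemma rel_total:
  assumes r: "(r, r0) \<in> P" and g: "g \<in> G"
  shows "\<exists>q. (q, r) \<in> P \<and> g \<in> fst ` rel F q"
proof -
  obtain q a where q: "(q, r) \<in> P" "a < length (l q)" "l q ! a = g"
    using L.extend_elem[OF L.P_Field1[OF r] g] by blast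
  have "fex P (\<lambda>b. forces_in P (a, b) F) r0"
    using iso unfolding forces_isomorphism_def forces_embedding_def forces_injection_def by blast
  then obtain s b where s: "(s, q) \<in> P" "forces_in P (a, b) F s"
    unfolding fex_def using L.P_trans[OF q(1) r] by blast
  obtain u where u: "(u, s) \<in> P" "Suc b \<le> length (k u)" using R.extend_length[OF L.P_Field1[OF s(1)]] by blast
  have uq: "(u, q) \<in> P" using u s L.P_trans by blast
  have "a < length (l u)" "b < length (k u)" using q(2) L.l_length[OF uq] u(2) by simp_all
  from relI[OF this L.forces_in_mono[OF s(2) u(1)]] have "(g, k u ! b) \<in> rel F u"
    unfolding L.l_nth[OF uq q(2)] q(3) .
  thus ?thesis using L.P_trans[OF uq q(1)] by force
qed

lemma rel_surj:
  assumes r: "(r, r0) \<in> P" and h: "h \<in> H"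
  shows "\<exists>q. (q, r) \<in> P \<and> h \<in> snd ` rel F q"
proof -
  obtain q b where q: "(q, r) \<in> P" "b < length (k q)" "k q ! b = h"
    using R.extend_elem[OF L.P_Field1[OF r] h] by blast
  have "fex P (\<lambda>a. forces_in P (a, b) F) r0"
    using iso unfolding forces_isomorphism_def by blast
  then obtain s a where s: "(s, q) \<in> P" "forces_in P (a, b) F s"
    unfolding fex_def using L.P_trans[OF q(1) r] by blast
  obtain u where u: "(u, s) \<in> P" "Suc a \<le> length (l u)" using L.extend_length[OF L.P_Field1[OF s(1)]] by blast
  have uq: "(u, q) \<in> P" using u s L.P_trans by blast
  have "a < length (l u)" "b < length (k u)" using q(2) R.l_length[OF uq] u(2) by simp_all
  from relI[OF this L.forces_in_mono[OF s(2) u(1)]] have "(l u ! a, h) \<in> rel F u"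
    unfolding R.l_nth[OF uq q(2)] q(3) .
  thus ?thesis using L.P_trans[OF uq q(1)] by force
qed

lemma rel_extend:
  assumes r: "(r, r0) \<in> P" and A: "finite A" "A \<subseteq> G" and B: "finite B" "B \<subseteq> H"
  shows "\<exists>q. (q, r) \<in> P \<and> A \<subseteq> fst ` rel F q \<and> B \<subseteq> snd ` rel F q"
proof -
  have "\<exists>q. (q, r) \<in> P \<and> A \<subseteq> fst ` rel F q"
    using A
  proof (induction A rule: finite_induct)
    case empty
    show ?case using L.P_refl[OF L.P_Field1[OF r]] by blast
  next
    case (insert g A)
    then obtain q where q: "(q, r) \<in> P" "A \<subseteq> fst ` rel F q" by auto
    obtain s where s: "(s, q) \<in> P" "g \<in> fst ` rel F s"
      using rel_total[OF L.P_trans[OF q(1) r]] insert.prems by blast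
    have "A \<subseteq> fst ` rel F s" using q(2) rel_mono[OF s(1), of F] by blast
    thus ?case using s L.P_trans[OF s(1) q(1)] by blast
  qed
  then obtain q where q: "(q, r) \<in> P" "A \<subseteq> fst ` rel F q" by blast
  have "\<exists>s. (s, q) \<in> P \<and> B \<subseteq> snd ` rel F s"
    using B
  proof (induction B rule: finite_induct)
    case empty
    show ?case using L.P_refl[OF L.P_Field1[OF q(1)]] by blast
  next
    case (insert h B)
    then obtain t where t: "(t, q) \<in> P" "B \<subseteq> snd ` rel F t" by auto
    obtain s where s: "(s, t) \<in> P" "h \<in> snd ` rel F s"
      using rel_surj[OF L.P_trans[OF t(1) L.P_trans[OF q(1) r]]] insert.prems by blast
    have "B \<subseteq> snd ` rel F s" using t(2) rel_mono[OF s(1), of F] by blast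
    thus ?case using s L.P_trans[OF s(1) t(1)] by blast
  qed
  then obtain s where s: "(s, q) \<in> P" "B \<subseteq> snd ` rel F s" by blast
  have "A \<subseteq> fst ` rel F s" using q(2) rel_mono[OF s(1), of F] by blast
  thus ?thesis using s L.P_trans[OF s(1) q(1)] by blast
qed

lemma rel_fun:
  assumes r: "(r, r0) \<in> P" and "(g, h) \<in> rel F r" "(g, h') \<in> rel F r"
  shows "h = h'"
proof -
  obtain a b a' b' where ab: "g = l r ! a" "h = k r ! b" "a < length (l r)" "b < length (k r)" "forces_in P (a, b) F r"
    "g = l r ! a'" "h' = k r ! b'" "a' < length (l r)" "b' < length (k r)" "forces_in P (a', b') F r"
    using assms(2,3) unfolding rel_def by blast
  have "a = a'" using ab L.l_distinct[OF L.P_Field1[OF r]] nth_eq_iff_index_eq by metis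
  moreover have "b = b'"
  proof (rule ccontr)
    assume "b \<noteq> b'"
    hence "fnot P (\<lambda>q. forces_in P (a, b) F q \<and> forces_in P (a, b') F q) r0"
      using iso unfolding forces_isomorphism_def forces_embedding_def forces_injection_def by blast
    thus False using r ab \<open>a = a'\<close> unfolding fnot_def by blast
  qed
  ultimately show ?thesis using ab by simp
qed

lemma rel_inj:
  assumes r: "(r, r0) \<in> P" and "(g, h) \<in> rel F r" "(g', h) \<in> rel F r"
  shows "g = g'"
proof -
  obtain a b a' b' where ab: "g = l r ! a" "h = k r ! b" "a < length (l r)" "b < length (k r)" "forces_in P (a, b) F r"
    "g' = l r ! a'" "h = k r ! b'" "a' < length (l r)" "b' < length (k r)" "forces_in P (a', b') F r"
    using assms(2,3) unfolding rel_def by blast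
  have "b = b'" using ab R.l_distinct[OF L.P_Field1[OF r]] nth_eq_iff_index_eq by metis
  moreover have "a = a'"
  proof (rule ccontr)
    assume "a \<noteq> a'"
    hence "fnot P (\<lambda>q. forces_in P (a, b) F q \<and> forces_in P (a', b) F q) r0"
      using iso unfolding forces_isomorphism_def forces_embedding_def forces_injection_def by blast
    thus False using r ab \<open>b = b'\<close> unfolding fnot_def by blast
  qed
  ultimately show ?thesis using ab by simp
qed

lemma rel_add:
  assumes r: "(r, r0) \<in> P" and x: "(g1, h1) \<in> rel F r" "(g2, h2) \<in> rel F r" "(g1 + g2, h3) \<in> rel F r"
  shows "h3 = h1 + h2"
proof -
  obtain a1 b1 where 1: "g1 = l r ! a1" "h1 = k r ! b1" "a1 < length (l r)" "b1 < length (k r)" "forces_in P (a1, b1) F r"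
    using x(1) unfolding rel_def by blast
  obtain a2 b2 where 2: "g2 = l r ! a2" "h2 = k r ! b2" "a2 < length (l r)" "b2 < length (k r)" "forces_in P (a2, b2) F r"
    using x(2) unfolding rel_def by blast
  obtain a3 b3 where 3: "g1 + g2 = l r ! a3" "h3 = k r ! b3" "a3 < length (l r)" "b3 < length (k r)" "forces_in P (a3, b3) F r"
    using x(3) unfolding rel_def by blast
  have rF: "r \<in> Field P" using L.P_Field1[OF r] .
  have "forces_in P (a1, a2, a3) M r"
    using L.forces_M_now[OF rF 1(3) 2(3) 3(3)] 1 2 3 by simp
  moreover have "fimp P (\<lambda>q. forces_in P (a1, a2, a3) M q \<and> forces_in P (a1, b1) F q \<and>
      forces_in P (a2, b2) F q \<and> forces_in P (a3, b3) F q) (forces_in P (b1, b2, b3) N) r0"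
    using iso unfolding forces_isomorphism_def forces_embedding_def by blast
  ultimately have "forces_in P (b1, b2, b3) N r" using r 1(5) 2(5) 3(5) unfolding fimp_def by blast
  thus ?thesis using R.forces_M_now[OF rF 1(4) 2(4) 3(4)] 1 2 3 by simp
qed

theorem iso_countable_subgroups:
  "\<exists>A f. z \<in> A \<and> bij_betw f {g \<in> G. nd g \<subseteq> A} {h \<in> H. nd h \<subseteq> A} \<and>
    (\<forall>x y. x \<in> G \<longrightarrow> y \<in> G \<longrightarrow> nd x \<subseteq> A \<longrightarrow> nd y \<subseteq> A \<longrightarrow> nd (x + y) \<subseteq> A \<longrightarrow> f (x + y) = f x + f y)"
proof -
  define eG where "eG A = from_nat_into {g \<in> G. nd g \<subseteq> A}" for A
  define eH where "eH A = from_nat_into {h \<in> H. nd h \<subseteq> A}" for A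
  define St where "St s \<longleftrightarrow> (fst s, r0) \<in> P" for s :: "'p \<times> 'n set list"
  \<comment> \<open>Bookkeeping: the list stores the finite node sets met so far, and step
    \<open>n\<close> puts the elements number \<open>0\<close> to \<open>n\<close> over each stored
    set into the domain and the range. The guards are there because \<open>from_nat_into\<close> of
    an empty set has an arbitrary value.\<close>
  define Nx where "Nx n s s' \<longleftrightarrow> (fst s', fst s) \<in> P \<and> snd s' = snd s @ [nds F (fst s')] \<and>
    (\<forall>A\<in>set (snd s). \<forall>i\<le>n. (eG A i \<in> G \<longrightarrow> eG A i \<in> fst ` rel F (fst s')) \<and> (eH A i \<in> H \<longrightarrow> eH A i \<in> snd ` rel F (fst s')))"
    for n :: nat and s s' :: "'p \<times> 'n set list"
  have "\<exists>S. \<forall>n. St (S n) \<and> Nx n (S n) (S (Suc n))"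
  proof (rule dependent_nat_choice)
    show "\<exists>s. St s" by (rule exI[of _ "(r0, [])"]) (use L.P_refl[OF r0] in \<open>simp add: St_def\<close>)
    fix s n assume s: "St s"
    define X where "X = (\<lambda>(A, i). eG A i) ` (set (snd s) \<times> {..n}) \<inter> G"
    define Y where "Y = (\<lambda>(A, i). eH A i) ` (set (snd s) \<times> {..n}) \<inter> H"
    have XY: "finite X" "X \<subseteq> G" "finite Y" "Y \<subseteq> H" unfolding X_def Y_def by simp_all
    have s0: "(fst s, r0) \<in> P" using s by (simp add: St_def)
    obtain q where q: "(q, fst s) \<in> P" "X \<subseteq> fst ` rel F q" "Y \<subseteq> snd ` rel F q"
      using rel_extend[OF s0 XY] by (elim exE conjE)
    have "St (q, snd s @ [nds F q])" using L.P_trans[OF q(1) s0] by (simp add: St_def)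
    moreover have "Nx n s (q, snd s @ [nds F q])"
    proof -
      have "eG A i \<in> fst ` rel F q" if "A \<in> set (snd s)" "i \<le> n" "eG A i \<in> G" for A i
      proof -
        have "eG A i \<in> X" unfolding X_def using that by (intro IntI image_eqI[of _ _ "(A, i)"]) simp_all
        thus ?thesis using q(2) by (rule subsetD[rotated])
      qed
      moreover have "eH A i \<in> snd ` rel F q" if "A \<in> set (snd s)" "i \<le> n" "eH A i \<in> H" for A i
      proof -
        have "eH A i \<in> Y" unfolding Y_def using that by (intro IntI image_eqI[of _ _ "(A, i)"]) simp_all
        thus ?thesis using q(3) by (rule subsetD[rotated])
      qed
      ultimately show ?thesis using q(1) unfolding Nx_def by simp
    qed
    ultimately show "\<exists>s'. St s' \<and> Nx n s s'" by (intro exI conjI)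
  qed
  then obtain S where S: "\<And>n. St (S n)" "\<And>n. Nx n (S n) (S (Suc n))" by blast
  define c where "c n = fst (S n)" for n
  have c0: "(c n, r0) \<in> P" for n using S(1)[of n] by (simp add: c_def St_def)
  have cS: "(c (Suc n), c n) \<in> P" for n using S(2)[of n] by (simp add: c_def Nx_def)
  have c_mono: "m \<le> n \<Longrightarrow> (c n, c m) \<in> P" for m n
  proof (induction n)
    case 0
    thus ?case using L.P_refl[OF L.P_Field1[OF c0]] by simp
  next
    case (Suc n)
    thus ?case using L.P_trans[OF cS[of n]] L.P_refl[OF L.P_Field1[OF c0]] by (cases "m = Suc n") auto
  qed
  have hist: "nds F (c (Suc m)) \<in> set (snd (S (Suc m + d)))" for m d
  proof (induction d)
    case 0
    show ?case using S(2)[of m] by (simp add: Nx_def c_def)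
  next
    case (Suc d)
    thus ?case using S(2)[of "Suc m + d"] by (simp add: Nx_def)
  qed
  define Rl where "Rl = (\<Union>n. rel F (c n))"
  define A where "A = (\<Union>n. nds F (c n))"
  have Rl_n: "\<exists>n. X \<subseteq> rel F (c n)" if "finite X" "X \<subseteq> Rl" for X
    using that
  proof (induction X rule: finite_induct)
    case (insert x X)
    then obtain n m where "X \<subseteq> rel F (c n)" "x \<in> rel F (c m)" by (auto simp: Rl_def)
    moreover have "rel F (c n) \<subseteq> rel F (c (max n m))" "rel F (c m) \<subseteq> rel F (c (max n m))"
      by (rule rel_mono[OF c_mono]; simp)+
    ultimately show ?case by blast
  qed simp
  \<comment> \<open>The index is \<open>Suc n\<close> because a step stores the nodes of the new
    condition; those of \<open>c 0\<close> are not stored by themselves.\<close>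
  have A_n: "\<exists>n. X \<subseteq> nds F (c (Suc n))" if "finite X" "X \<subseteq> A" for X
    using that
  proof (induction X rule: finite_induct)
    case (insert x X)
    then obtain n m where "X \<subseteq> nds F (c (Suc n))" "x \<in> nds F (c m)" by (auto simp: A_def)
    moreover have "nds F (c (Suc n)) \<subseteq> nds F (c (Suc (max n m)))" "nds F (c m) \<subseteq> nds F (c (Suc (max n m)))"
      by (rule nds_mono[OF c_mono]; simp)+
    ultimately show ?case by blast
  qed simp
  have dom: "fst ` Rl = {g \<in> G. nd g \<subseteq> A}"
  proof safe
    fix g h assume gh: "(g, h) \<in> Rl"
    then obtain n where n: "(g, h) \<in> rel F (c n)" by (auto simp: Rl_def)
    show "fst (g, h) \<in> G" using n rel_subset[OF L.P_Field1[OF c0]] by auto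
    fix x assume "x \<in> nd (fst (g, h))"
    hence "x \<in> nds F (c n)" using n unfolding nds_def by force
    thus "x \<in> A" by (auto simp: A_def)
  next
    fix g assume g: "g \<in> G" "nd g \<subseteq> A"
    \<comment> \<open>As \<open>nd g\<close> is finite, it is contained in one stored set; there
      \<open>g\<close> has some number \<open>i\<close>, and it is caught at a stage that is past
      both \<open>m\<close> and \<open>i\<close>.\<close>
    obtain m where m: "nd g \<subseteq> nds F (c (Suc m))" using A_n[OF nd_finite g(2)] by blast
    let ?A = "nds F (c (Suc m))"
    have "g \<in> {g \<in> G. nd g \<subseteq> ?A}" using g m by simp
    then obtain i where i: "eG ?A i = g"
      unfolding eG_def using from_nat_into_surj[OF G_countable[OF nds_finite]] by blast
    let ?n = "Suc m + i"
    have "g \<in> fst ` rel F (c (Suc ?n))"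
      using S(2)[of ?n] hist[of m i] i g unfolding Nx_def c_def by (metis le_add2)
    thus "g \<in> fst ` Rl" by (auto simp: Rl_def)
  qed
  have ran: "snd ` Rl = {h \<in> H. nd h \<subseteq> A}"
  proof safe
    fix g h assume gh: "(g, h) \<in> Rl"
    then obtain n where n: "(g, h) \<in> rel F (c n)" by (auto simp: Rl_def)
    show "snd (g, h) \<in> H" using n rel_subset[OF L.P_Field1[OF c0]] by auto
    fix x assume "x \<in> nd (snd (g, h))"
    hence "x \<in> nds F (c n)" using n unfolding nds_def by force
    thus "x \<in> A" by (auto simp: A_def)
  next
    fix g assume g: "g \<in> H" "nd g \<subseteq> A"
    obtain m where m: "nd g \<subseteq> nds F (c (Suc m))" using A_n[OF nd_finite g(2)] by blast
    let ?A = "nds F (c (Suc m))"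
    have "g \<in> {g \<in> H. nd g \<subseteq> ?A}" using g m by simp
    then obtain i where i: "eH ?A i = g"
      unfolding eH_def using from_nat_into_surj[OF H_countable[OF nds_finite]] by blast
    let ?n = "Suc m + i"
    have "g \<in> snd ` rel F (c (Suc ?n))"
      using S(2)[of ?n] hist[of m i] i g unfolding Nx_def c_def by (metis le_add2)
    thus "g \<in> snd ` Rl" by (auto simp: Rl_def)
  qed
  define f where "f g = (THE h. (g, h) \<in> Rl)" for g
  have f: "f g = h" if gh: "(g, h) \<in> Rl" for g h
    unfolding f_def
  proof (rule the_equality)
    show "(g, h) \<in> Rl" by (rule gh)
    fix h' assume "(g, h') \<in> Rl"
    then obtain n where "{(g, h), (g, h')} \<subseteq> rel F (c n)" using Rl_n[of "{(g, h), (g, h')}"] gh by auto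
    thus "h' = h" using rel_fun[OF c0] by blast
  qed
  have "bij_betw f (fst ` Rl) (snd ` Rl)"
    unfolding bij_betw_def
  proof
    show "inj_on f (fst ` Rl)"
    proof (rule inj_onI, clarify)
      fix g h g' h' assume gh: "(g, h) \<in> Rl" "(g', h') \<in> Rl" "f (fst (g, h)) = f (fst (g', h'))"
      hence "h = h'" using f by simp
      moreover obtain n where "{(g, h), (g', h')} \<subseteq> rel F (c n)" using Rl_n[of "{(g, h), (g', h')}"] gh by auto
      ultimately show "fst (g, h) = fst (g', h')" using rel_inj[OF c0] by auto
    qed
    show "f ` fst ` Rl = snd ` Rl" unfolding image_image by (rule image_cong) (use f in auto)
  qed
  moreover have "f (x + y) = f x + f y"
    if xy: "x \<in> G" "y \<in> G" "nd x \<subseteq> A" "nd y \<subseteq> A" "nd (x + y) \<subseteq> A" for x y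
  proof -
    have "x \<in> fst ` Rl" "y \<in> fst ` Rl" "x + y \<in> fst ` Rl" unfolding dom using xy L.G_add by auto
    then obtain h1 h2 h3 where h: "(x, h1) \<in> Rl" "(y, h2) \<in> Rl" "(x + y, h3) \<in> Rl" by force
    then obtain n where "{(x, h1), (y, h2), (x + y, h3)} \<subseteq> rel F (c n)"
      using Rl_n[of "{(x, h1), (y, h2), (x + y, h3)}"] by auto
    hence "h3 = h1 + h2" using rel_add[OF c0, of x h1 n y h2 h3] by simp
    thus ?thesis using f h by simp
  qed
  moreover have "z \<in> A" by (auto simp: A_def nds_def)
  ultimately show ?thesis unfolding dom ran by blast
qed

end

end

end

section \<open>Cardinality estimates\<close>

lemma card_of_countable_ordLeq_infinite:
  assumes B: "infinite B" and A: "countable A"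
  shows "|A| \<le>o |B|"
proof -
  obtain f :: "_ \<Rightarrow> nat" where "inj_on f A" using A unfolding countable_def by blast
  hence "|A| \<le>o |UNIV :: nat set|" by (rule card_of_ordLeqI) simp
  moreover have "|UNIV :: nat set| \<le>o |B|" using B infinite_iff_card_of_nat by blast
  ultimately show ?thesis by (rule ordLeq_transitive)
qed

lemma card_of_Times_ordLeq_infinite:
  "infinite B \<Longrightarrow> |A| \<le>o |B| \<Longrightarrow> |C| \<le>o |B| \<Longrightarrow> |A \<times> C| \<le>o |B|"
  by (rule card_of_Times_ordLeq_infinite_Field[OF _ _ _ card_of_Card_order]) (simp_all only: Field_card_of not_False_eq_True)

lemma card_of_Un_ordLeq_infinite:
  "infinite B \<Longrightarrow> |A| \<le>o |B| \<Longrightarrow> |C| \<le>o |B| \<Longrightarrow> |A \<union> C| \<le>o |B|"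
  by (rule card_of_Un_ordLeq_infinite_Field[OF _ _ _ card_of_Card_order]) (simp_all only: Field_card_of not_False_eq_True)

lemma card_of_lists_infinite:
  fixes A :: "'a set" and B :: "'b set"
  assumes B: "infinite B" and A: "|A| \<le>o |B|"
  shows "|lists A| \<le>o |B|"
proof -
  have n: "|{xs \<in> lists A. length xs = n}| \<le>o |B|" for n
  proof (induction n)
    case 0
    have "{xs \<in> lists A. length xs = 0} = {[]}" by auto
    thus ?case by (simp add: card_of_countable_ordLeq_infinite[OF B])
  next
    case (Suc n)
    have "|{xs \<in> lists A. length xs = Suc n}| \<le>o |A \<times> {xs \<in> lists A. length xs = n}|"
    proof (rule card_of_ordLeqI[of "\<lambda>xs. (hd xs, tl xs)"])
      show "inj_on (\<lambda>xs. (hd xs, tl xs)) {xs \<in> lists A. length xs = Suc n}"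
      proof (rule inj_onI)
        fix xs ys assume "xs \<in> {xs \<in> lists A. length xs = Suc n}" "ys \<in> {xs \<in> lists A. length xs = Suc n}"
          and "(hd xs, tl xs) = (hd ys, tl ys)"
        thus "xs = ys" by (cases xs; cases ys) simp_all
      qed
      show "(hd xs, tl xs) \<in> A \<times> {xs \<in> lists A. length xs = n}"
        if "xs \<in> {xs \<in> lists A. length xs = Suc n}" for xs
        using that by (cases xs) simp_all
    qed
    also have "|A \<times> {xs \<in> lists A. length xs = n}| \<le>o |B|"
      by (rule card_of_Times_ordLeq_infinite[OF B A Suc])
    finally show ?case .
  qed
  have "lists A = (\<Union>n. {xs \<in> lists A. length xs = n})" by auto
  moreover have "|\<Union>n. {xs \<in> lists A. length xs = n}| \<le>o |B|"
    using n by (intro card_of_UNION_ordLeq_infinite[OF B card_of_countable_ordLeq_infinite[OF B]]) simp_all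
  ultimately show ?thesis by simp
qed

lemma card_of_poly_mapping_infinite:
  fixes A :: "'a set" and B :: "'b set"
  assumes B: "infinite B" and A: "|A| \<le>o |B|"
  shows "|{x :: 'a \<Rightarrow>\<^sub>0 rat. keys x \<subseteq> A}| \<le>o |B|"
proof -
  define g where "g x = (SOME xs. set xs = (\<lambda>b. (b, lookup x b)) ` keys x)" for x :: "'a \<Rightarrow>\<^sub>0 rat"
  have g: "set (g x) = (\<lambda>b. (b, lookup x b)) ` keys x" for x
    unfolding g_def by (rule someI_ex) (simp add: finite_list)
  have "|{x :: 'a \<Rightarrow>\<^sub>0 rat. keys x \<subseteq> A}| \<le>o |lists (A \<times> (UNIV :: rat set))|"
  proof (rule card_of_ordLeqI[of g])
    show "inj_on g {x. keys x \<subseteq> A}"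
    proof (rule inj_onI, rule poly_mapping_eqI)
      fix x y b assume "g x = g y"
      hence eq: "(\<lambda>b. (b, lookup x b)) ` keys x = (\<lambda>b. (b, lookup y b)) ` keys y" using g by metis
      hence "fst ` (\<lambda>b. (b, lookup x b)) ` keys x = fst ` (\<lambda>b. (b, lookup y b)) ` keys y" by simp
      hence k: "keys x = keys y" by (simp add: image_image)
      show "lookup x b = lookup y b"
      proof (cases "b \<in> keys x")
        case True
        thus ?thesis using eq by force
      next
        case False
        with k have "b \<notin> keys y" by blast
        with False show ?thesis unfolding in_keys_iff by simp
      qed
    qed
    show "g x \<in> lists (A \<times> UNIV)" if "x \<in> {x. keys x \<subseteq> A}" for x
      using that g[of x] by (auto simp: in_lists_conv_set)
  qed
  also have "|lists (A \<times> (UNIV :: rat set))| \<le>o |B|"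
    by (intro card_of_lists_infinite card_of_Times_ordLeq_infinite B A card_of_countable_ordLeq_infinite) simp
  finally show ?thesis .
qed

lemma card_of_bas_of_infinite:
  fixes N :: "'a list set" and B :: "'b set"
  assumes B: "infinite B" and N: "|N| \<le>o |B|"
  shows "|bas_of N| \<le>o |B|"
proof -
  have K: "|(UNIV :: kind set) \<times> N| \<le>o |B|"
  proof (rule card_of_Times_ordLeq_infinite[OF B _ N])
    have "(UNIV :: kind set) = {KU, KA, KV}" using kind.exhaust by blast
    hence "finite (UNIV :: kind set)" by (metis finite.emptyI finite.insertI)
    thus "|UNIV :: kind set| \<le>o |B|" by (intro card_of_countable_ordLeq_infinite B countable_finite)
  qed
  have "|insert None (Some ` N)| \<le>o |B|"
  proof -
    have "|Some ` N| \<le>o |B|" by (rule ordLeq_transitive[OF card_of_image N])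
    hence "|{None} \<union> Some ` N| \<le>o |B|"
      using card_of_Un_ordLeq_infinite[OF B card_of_countable_ordLeq_infinite[OF B countable_finite], of "{None}"] by simp
    thus ?thesis by simp
  qed
  moreover have "|lists ((UNIV :: kind set) \<times> N)| \<le>o |B|" by (rule card_of_lists_infinite[OF B K])
  ultimately have "|lists ((UNIV :: kind set) \<times> N) \<times> insert None (Some ` N)| \<le>o |B|"
    by (intro card_of_Times_ordLeq_infinite B)
  moreover have "bas_of N \<subseteq> lists (UNIV \<times> N) \<times> insert None (Some ` N)"
  proof
    fix b assume "b \<in> bas_of N"
    then obtain \<eta> i where b: "b = (\<eta>, i)" "snd ` set \<eta> \<subseteq> N" "set_option i \<subseteq> N"
      unfolding bas_of_def by (cases b) simp
    have "\<eta> \<in> lists (UNIV \<times> N)" using b(2) by (auto simp: in_lists_conv_set)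
    moreover have "i \<in> insert None (Some ` N)" using b(3) by (cases i) simp_all
    ultimately show "b \<in> lists (UNIV \<times> N) \<times> insert None (Some ` N)" using b(1) by simp
  qed
  ultimately show ?thesis using ordLeq_transitive[OF card_of_mono1] by iprover
qed

section \<open>Forcing with finite injective sequences\<close>

definition dlists :: "'x set \<Rightarrow> 'x list set" where
  "dlists X = {s. distinct s \<and> set s \<subseteq> X}"

text \<open>The sequences are coded by \<open>e\<close> because all forcing notions have to live on
  one given type.\<close>

definition seq_forcing :: "('x list \<Rightarrow> 'v) \<Rightarrow> 'x set \<Rightarrow> 'v rel" where
  "seq_forcing e X = {(e s, e t) | s t. s \<in> dlists X \<and> t \<in> dlists X \<and> prefix t s}"

definition dec :: "('x list \<Rightarrow> 'v) \<Rightarrow> 'x set \<Rightarrow> 'v \<Rightarrow> 'x list" where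
  "dec e X = inv_into (dlists X) e"

definition grp_name :: "('x list \<Rightarrow> 'v) \<Rightarrow> 'x::ab_group_add set \<Rightarrow> 'v gname" where
  "grp_name e X = {((a, b, c), e s) | a b c s. s \<in> dlists X \<and> a < length s \<and> b < length s \<and> c < length s
     \<and> s ! a + s ! b = s ! c}"

lemma card_of_dlists_infinite: "infinite B \<Longrightarrow> |X| \<le>o |B| \<Longrightarrow> |dlists X| \<le>o |B|"
  by (rule ordLeq_transitive[OF card_of_mono1 card_of_lists_infinite])
     (auto simp: dlists_def in_lists_conv_set)

lemma dlists_append_one: "s \<in> dlists X \<Longrightarrow> x \<in> X \<Longrightarrow> x \<notin> set s \<Longrightarrow> s @ [x] \<in> dlists X"
  by (auto simp: dlists_def)

context
  fixes e :: "'x list \<Rightarrow> 'v" and X :: "'x set"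
  assumes e: "inj_on e (dlists X)"
begin

lemma dec_e: "s \<in> dlists X \<Longrightarrow> dec e X (e s) = s"
  unfolding dec_def using e by (rule inv_into_f_f)

lemma seq_forcing_iff:
  "(q, p) \<in> seq_forcing e X \<longleftrightarrow> q \<in> e ` dlists X \<and> p \<in> e ` dlists X \<and> prefix (dec e X p) (dec e X q)"
proof
  assume "(q, p) \<in> seq_forcing e X"
  thus "q \<in> e ` dlists X \<and> p \<in> e ` dlists X \<and> prefix (dec e X p) (dec e X q)"
    unfolding seq_forcing_def by (auto simp: dec_e)
next
  assume "q \<in> e ` dlists X \<and> p \<in> e ` dlists X \<and> prefix (dec e X p) (dec e X q)"
  then obtain s t where "q = e s" "s \<in> dlists X" "p = e t" "t \<in> dlists X" "prefix t s" by (auto simp: dec_e)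
  thus "(q, p) \<in> seq_forcing e X" unfolding seq_forcing_def by blast
qed

lemma Field_seq_forcing: "Field (seq_forcing e X) = e ` dlists X"
proof
  show "e ` dlists X \<subseteq> Field (seq_forcing e X)"
  proof
    fix p assume "p \<in> e ` dlists X"
    hence "(p, p) \<in> seq_forcing e X" by (simp add: seq_forcing_iff)
    thus "p \<in> Field (seq_forcing e X)" by (rule FieldI1)
  qed
qed (auto simp: Field_def seq_forcing_iff)

lemma forcing_notion_seq_forcing: "forcing_notion (seq_forcing e X)"
  unfolding forcing_notion_def preorder_on_def
proof (intro conjI)
  have "[] \<in> dlists X" by (simp add: dlists_def)
  thus "Field (seq_forcing e X) \<noteq> {}" unfolding Field_seq_forcing by blast
  show "seq_forcing e X \<subseteq> Field (seq_forcing e X) \<times> Field (seq_forcing e X)"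
    by (auto intro: FieldI1 FieldI2)
  show "refl_on (Field (seq_forcing e X)) (seq_forcing e X)"
    unfolding refl_on_def Field_seq_forcing by (auto simp: seq_forcing_iff)
  show "trans (seq_forcing e X)"
    by (rule transI) (auto simp: seq_forcing_iff intro: prefix_order.trans)
qed

lemma dec_dlists: "p \<in> Field (seq_forcing e X) \<Longrightarrow> dec e X p \<in> dlists X"
  unfolding Field_seq_forcing by (auto simp: dec_e)

lemma seq_forcing_extend:
  assumes "p \<in> Field (seq_forcing e X)" "s \<in> dlists X" "prefix (dec e X p) s"
  shows "(e s, p) \<in> seq_forcing e X \<and> dec e X (e s) = s"
  using assms by (auto simp: seq_forcing_iff Field_seq_forcing dec_e)

lemma e_dec: "p \<in> Field (seq_forcing e X) \<Longrightarrow> e (dec e X p) = p"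
  unfolding Field_seq_forcing dec_def by (rule f_inv_into_f)

text \<open>The generic sequence enumerates \<open>X\<close> without repetition, so \<open>a\<close>
  can be sent to the place of \<open>h a\<close>.\<close>

lemma collapses_seq_forcing:
  assumes h: "inj_on h A" "h ` A \<subseteq> X"
  shows "collapses (seq_forcing e X) A"
proof -
  let ?P = "seq_forcing e X" and ?d = "dec e X"
  define f where "f = {((a, n), e s) | a n s. a \<in> A \<and> s \<in> dlists X \<and> n < length s \<and> s ! n = h a}"
  have refl: "(p, p) \<in> ?P" if "p \<in> Field ?P" for p
    using that by (simp add: seq_forcing_iff Field_seq_forcing)
  have trans: "(r, p) \<in> ?P" if "(r, q) \<in> ?P" "(q, p) \<in> ?P" for p q r
    using that by (auto simp: seq_forcing_iff intro: prefix_order.trans)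
  have name: "is_name ?P f" unfolding is_name_def f_def Field_seq_forcing by auto
  have nth: "?d q ! n = ?d p ! n" "n < length (?d q)" if "(q, p) \<in> ?P" "n < length (?d p)" for p q n
  proof -
    have "prefix (?d p) (?d q)" using that(1) unfolding seq_forcing_iff by iprover
    then obtain zs where "?d q = ?d p @ zs" by (rule prefixE)
    thus "?d q ! n = ?d p ! n" "n < length (?d q)" using that(2) by (simp_all add: nth_append)
  qed
  have f_now: "forces_in ?P (a, n) f p"
    if p: "p \<in> Field ?P" and a: "a \<in> A" "n < length (?d p)" "?d p ! n = h a" for a n p
    unfolding forces_in_def
  proof (intro allI impI)
    fix q assume q: "(q, p) \<in> ?P"
    have "((a, n), e (?d p)) \<in> f" unfolding f_def using a dec_dlists[OF p] by blast
    hence "((a, n), p) \<in> f" by (simp add: e_dec[OF p])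
    thus "\<exists>r. (r, q) \<in> ?P \<and> (\<exists>s. ((a, n), s) \<in> f \<and> (r, s) \<in> ?P)"
      using q refl[OF FieldI1[OF q]] by (intro exI[of _ q] exI[of _ p] conjI)
  qed
  have f_imp: "\<exists>r. (r, p) \<in> ?P \<and> n < length (?d r) \<and> ?d r ! n = h a"
    if p: "p \<in> Field ?P" and f: "forces_in ?P (a, n) f p" for a n p
  proof -
    obtain r s where r: "(r, p) \<in> ?P" "((a, n), s) \<in> f" "(r, s) \<in> ?P"
      using f[unfolded forces_in_def, rule_format, OF refl[OF p]] by iprover
    obtain s' where "s = e s'" "s' \<in> dlists X" "n < length s'" "s' ! n = h a" using r(2) unfolding f_def mem_Collect_eq by fast
    hence s: "n < length (?d s)" "?d s ! n = h a" using dec_e[of s'] by simp_all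
    have "?d r ! n = h a" using HOL.trans[OF nth(1)[OF r(3) s(1)] s(2)] .
    thus ?thesis using nth(2)[OF r(3) s(1)] r(1) by (intro exI[of _ r] conjI)
  qed
  have mono: "forces_in ?P x f q" if "forces_in ?P x f p" "(q, p) \<in> ?P" for x p q
    using that trans unfolding forces_in_def by blast
  have "forces_injection ?P A f p" if p: "p \<in> Field ?P" for p
    unfolding forces_injection_def
  proof (intro conjI ballI allI impI)
    fix a assume a: "a \<in> A"
    show "fex ?P (\<lambda>b. forces_in ?P (a, b) f) p"
      unfolding fex_def
    proof (intro allI impI)
      fix q assume q: "(q, p) \<in> ?P"
      note qF = FieldI1[OF q]
      show "\<exists>r. (r, q) \<in> ?P \<and> (\<exists>b. forces_in ?P (a, b) f r)"
      proof (cases "h a \<in> set (?d q)")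
        case True
        then obtain n where n: "n < length (?d q)" "?d q ! n = h a" unfolding in_set_conv_nth by (elim exE conjE)
        show ?thesis by (intro exI[of _ q] exI[of _ n] conjI refl[OF qF] f_now[OF qF a n])
      next
        case False
        have s: "?d q @ [h a] \<in> dlists X" using dlists_append_one[OF dec_dlists[OF qF] _ False] h a by blast
        have r: "(e (?d q @ [h a]), q) \<in> ?P" "?d (e (?d q @ [h a])) = ?d q @ [h a]"
          using seq_forcing_extend[OF qF s] by auto
        have "forces_in ?P (a, length (?d q)) f (e (?d q @ [h a]))"
          by (rule f_now[OF FieldI1[OF r(1)] a]) (simp_all add: r(2))
        with r(1) show ?thesis by (intro exI[of _ "e (?d q @ [h a])"] exI[of _ "length (?d q)"] conjI)
      qed
    qed
  next
    fix a b b' :: nat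
    fix a assume a: "a \<in> A" and ne: "b \<noteq> b'"
    show "fnot ?P (\<lambda>q. forces_in ?P (a, b) f q \<and> forces_in ?P (a, b') f q) p"
      unfolding fnot_def
    proof (intro allI impI notI)
      fix q assume q: "(q, p) \<in> ?P" and F: "forces_in ?P (a, b) f q \<and> forces_in ?P (a, b') f q"
      obtain r where r: "(r, q) \<in> ?P" "b < length (?d r)" "?d r ! b = h a"
        using f_imp[OF FieldI1[OF q] conjunct1[OF F]] by iprover
      obtain u where u: "(u, r) \<in> ?P" "b' < length (?d u)" "?d u ! b' = h a"
        using f_imp[OF FieldI1[OF r(1)] mono[OF conjunct2[OF F] r(1)]] by iprover
      have "distinct (?d u)" using dec_dlists[OF FieldI1[OF u(1)]] by (simp add: dlists_def)
      moreover have "b < length (?d u)" "?d u ! b = ?d u ! b'"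
        using nth(2)[OF u(1) r(2)] HOL.trans[OF HOL.trans[OF nth(1)[OF u(1) r(2)] r(3)] sym[OF u(3)]] .
      ultimately show False using ne u(2) by (simp add: nth_eq_iff_index_eq)
    qed
  next
    fix a a' b assume a: "a \<in> A" "a' \<in> A" "a \<noteq> a'"
    show "fnot ?P (\<lambda>q. forces_in ?P (a, b) f q \<and> forces_in ?P (a', b) f q) p"
      unfolding fnot_def
    proof (intro allI impI notI)
      fix q assume q: "(q, p) \<in> ?P" and F: "forces_in ?P (a, b) f q \<and> forces_in ?P (a', b) f q"
      obtain r where r: "(r, q) \<in> ?P" "b < length (?d r)" "?d r ! b = h a"
        using f_imp[OF FieldI1[OF q] conjunct1[OF F]] by iprover
      obtain u where u: "(u, r) \<in> ?P" "b < length (?d u)" "?d u ! b = h a'"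
        using f_imp[OF FieldI1[OF r(1)] mono[OF conjunct2[OF F] r(1)]] by iprover
      have "h a = h a'" using HOL.trans[OF HOL.trans[OF sym[OF r(3)] sym[OF nth(1)[OF u(1) r(2)]]] u(3)] .
      thus False using inj_onD[OF h(1)] a by iprover
    qed
  qed
  hence *: "\<exists>f. is_name ?P f \<and> forces_injection ?P A f p" if "p \<in> Field ?P" for p
    using that name by (intro exI[of _ f] conjI) simp_all
  have "fex ?P (\<lambda>f q. is_name ?P f \<and> forces_injection ?P A f q) p" for p
    unfolding fex_def
  proof (intro allI impI)
    fix q assume "(q, p) \<in> ?P"
    hence q: "q \<in> Field ?P" by (rule FieldI1)
    show "\<exists>r. (r, q) \<in> ?P \<and> (\<exists>f. is_name ?P f \<and> forces_injection ?P A f r)"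
      by (intro exI[of _ q] conjI refl[OF q]) (rule *[OF q])
  qed
  thus ?thesis unfolding collapses_def forced_def by simp
qed

end

section \<open>Products of forcing notions\<close>

lemma Field_prod_forcing:
  assumes "forcing_notion P" "forcing_notion Q"
  shows "Field (P \<otimes> Q) = Field P \<times> Field Q"
proof
  show "Field (P \<otimes> Q) \<subseteq> Field P \<times> Field Q"
    unfolding prod_forcing_def Field_def by auto
  show "Field P \<times> Field Q \<subseteq> Field (P \<otimes> Q)"
  proof
    fix x assume "x \<in> Field P \<times> Field Q"
    then obtain p q where x: "x = (p, q)" "p \<in> Field P" "q \<in> Field Q" by (rule SigmaE)
    have "(p, p) \<in> P" "(q, q) \<in> Q"
      using forcing_notion_refl[OF assms(1) x(2)] forcing_notion_refl[OF assms(2) x(3)] .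
    hence "(x, x) \<in> P \<otimes> Q" using x(1) unfolding prod_forcing_def by simp
    thus "x \<in> Field (P \<otimes> Q)" by (rule FieldI1)
  qed
qed

lemma prod_forcing_iff: "((p', q'), (p, q)) \<in> P \<otimes> Q \<longleftrightarrow> (p', p) \<in> P \<and> (q', q) \<in> Q"
  by (simp add: prod_forcing_def)

lemma forcing_notion_prod:
  assumes P: "forcing_notion P" and Q: "forcing_notion Q"
  shows "forcing_notion (P \<otimes> Q)"
  unfolding forcing_notion_def preorder_on_def
proof (intro conjI)
  show "Field (P \<otimes> Q) \<noteq> {}"
    using P Q unfolding Field_prod_forcing[OF P Q] forcing_notion_def by simp
  show "P \<otimes> Q \<subseteq> Field (P \<otimes> Q) \<times> Field (P \<otimes> Q)"
    by (rule subrelI) (intro SigmaI FieldI1 FieldI2)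
  have "refl_on (Field P) P" "refl_on (Field Q) Q"
    using P Q unfolding forcing_notion_def preorder_on_def by simp_all
  thus "refl_on (Field (P \<otimes> Q)) (P \<otimes> Q)"
    unfolding refl_on_def Field_prod_forcing[OF P Q] by (auto simp: prod_forcing_iff)
  have "trans P" "trans Q" using P Q unfolding forcing_notion_def preorder_on_def by simp_all
  thus "trans (P \<otimes> Q)"
    unfolding trans_def by (simp add: prod_forcing_iff split_paired_all) blast
qed

text \<open>Here a condition itself, and not just a weaker one, is paired in the name with every sum
  it decides. This is what survives lifting along a projection, where a weaker condition below may
  not come from one above.\<close>

locale self_reading = reading P G l M for P :: "'p rel" and G :: "'g::ab_group_add set" and l M +
  assumes M_self: "r \<in> Field P \<Longrightarrow> a < length (l r) \<Longrightarrow> b < length (l r) \<Longrightarrow> c < length (l r) \<Longrightarrow>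
    l r ! a + l r ! b = l r ! c \<Longrightarrow> ((a, b, c), r) \<in> M"
begin

lemma lift_reading:
  assumes X: "forcing_notion X"
    and mono: "\<And>q p. (q, p) \<in> X \<Longrightarrow> (\<pi> q, \<pi> p) \<in> P"
    and lift: "\<And>p q. p \<in> Field X \<Longrightarrow> (q, \<pi> p) \<in> P \<Longrightarrow> \<exists>r. (r, p) \<in> X \<and> \<pi> r = q"
  shows "reading X G (l \<circ> \<pi>) (lift_name X \<pi> M)"
proof
  have fld: "\<pi> p \<in> Field P" if "p \<in> Field X" for p
  proof -
    have "(p, p) \<in> X" using forcing_notion_refl[OF X that] .
    thus ?thesis by (rule P_Field1[OF mono])
  qed
  show "forcing_notion X" by fact
  show "prefix ((l \<circ> \<pi>) p) ((l \<circ> \<pi>) q)" if "(q, p) \<in> X" for p q using l_mono[OF mono[OF that]] by simp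
  show "distinct ((l \<circ> \<pi>) p)" "set ((l \<circ> \<pi>) p) \<subseteq> G" if "p \<in> Field X" for p
    using l_distinct[OF fld[OF that]] l_set[OF fld[OF that]] by simp_all
  show "\<exists>q. (q, p) \<in> X \<and> (l \<circ> \<pi>) q = s"
    if p: "p \<in> Field X" and s: "distinct s" "set s \<subseteq> G" "prefix ((l \<circ> \<pi>) p) s" for p s
  proof -
    obtain q where q: "(q, \<pi> p) \<in> P" "l q = s" using l_ext[OF fld[OF p] s(1,2)] s(3) by auto
    obtain r where "(r, p) \<in> X" "\<pi> r = q" using lift[OF p q(1)] by iprover
    thus ?thesis using q(2) by (intro exI[of _ r]) simp
  qed
  show "(\<exists>s. ((a, b, c), s) \<in> lift_name X \<pi> M \<and> (r, s) \<in> X) \<longleftrightarrow>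
      a < length ((l \<circ> \<pi>) r) \<and> b < length ((l \<circ> \<pi>) r) \<and> c < length ((l \<circ> \<pi>) r) \<and>
      (l \<circ> \<pi>) r ! a + (l \<circ> \<pi>) r ! b = (l \<circ> \<pi>) r ! c" if r: "r \<in> Field X" for a b c r
  proof
    assume "\<exists>s. ((a, b, c), s) \<in> lift_name X \<pi> M \<and> (r, s) \<in> X"
    then obtain s where "((a, b, c), s) \<in> lift_name X \<pi> M" "(r, s) \<in> X" by iprover
    hence "((a, b, c), \<pi> s) \<in> M" "(\<pi> r, \<pi> s) \<in> P" using mono by (simp_all add: lift_name_def)
    thus "a < length ((l \<circ> \<pi>) r) \<and> b < length ((l \<circ> \<pi>) r) \<and> c < length ((l \<circ> \<pi>) r) \<and>
      (l \<circ> \<pi>) r ! a + (l \<circ> \<pi>) r ! b = (l \<circ> \<pi>) r ! c"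
      unfolding comp_def by (intro iffD1[OF M_iff[OF fld[OF r]]] exI[of _ "\<pi> s"] conjI)
  next
    assume "a < length ((l \<circ> \<pi>) r) \<and> b < length ((l \<circ> \<pi>) r) \<and> c < length ((l \<circ> \<pi>) r) \<and>
      (l \<circ> \<pi>) r ! a + (l \<circ> \<pi>) r ! b = (l \<circ> \<pi>) r ! c"
    hence "((a, b, c), \<pi> r) \<in> M" unfolding comp_def by (elim conjE) (rule M_self[OF fld[OF r]])
    hence "((a, b, c), r) \<in> lift_name X \<pi> M" using r by (simp add: lift_name_def)
    moreover have "(r, r) \<in> X" using forcing_notion_refl[OF X r] .
    ultimately show "\<exists>s. ((a, b, c), s) \<in> lift_name X \<pi> M \<and> (r, s) \<in> X" by iprover
  qed
qed (fact G_infinite G_zero G_add G_uminus)+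

end

text \<open>Arbitrary projections are allowed so as to serve both the product of two forcing notions
  and the product with a collapse as third factor.\<close>

lemma lift_two_readings:
  assumes P: "self_reading P G l M" and Q: "self_reading Q H k N" and X: "forcing_notion X"
    and mono: "\<And>q p. (q, p) \<in> X \<Longrightarrow> (\<pi> q, \<pi> p) \<in> P" "\<And>q p. (q, p) \<in> X \<Longrightarrow> (\<rho> q, \<rho> p) \<in> Q"
    and lift: "\<And>p q q'. p \<in> Field X \<Longrightarrow> (q, \<pi> p) \<in> P \<Longrightarrow> (q', \<rho> p) \<in> Q \<Longrightarrow>
      \<exists>r. (r, p) \<in> X \<and> \<pi> r = q \<and> \<rho> r = q'"
  shows "two_readings X G (l \<circ> \<pi>) (lift_name X \<pi> M) H (k \<circ> \<rho>) (lift_name X \<rho> N)"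
proof -
  interpret P: self_reading P G l M by fact
  interpret Q: self_reading Q H k N by fact
  have refl: "(p, p) \<in> X" if "p \<in> Field X" for p
    using forcing_notion_refl[OF X that] .
  interpret L: reading X G "l \<circ> \<pi>" "lift_name X \<pi> M"
  proof (rule P.lift_reading[OF X mono(1)])
    fix p q assume "p \<in> Field X" "(q, \<pi> p) \<in> P"
    from lift[OF this mono(2)[OF refl[OF this(1)]]] show "\<exists>r. (r, p) \<in> X \<and> \<pi> r = q" by iprover
  qed
  interpret R: reading X H "k \<circ> \<rho>" "lift_name X \<rho> N"
  proof (rule Q.lift_reading[OF X mono(2)])
    fix p q assume "p \<in> Field X" "(q, \<rho> p) \<in> Q"
    from lift[OF this(1) mono(1)[OF refl[OF this(1)]] this(2)] show "\<exists>r. (r, p) \<in> X \<and> \<rho> r = q" by iprover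
  qed
  show ?thesis
  proof
    fix p s t assume p: "p \<in> Field X" and s: "distinct s" "set s \<subseteq> G" "prefix ((l \<circ> \<pi>) p) s"
      and t: "distinct t" "set t \<subseteq> H" "prefix ((k \<circ> \<rho>) p) t"
    obtain q where q: "(q, \<pi> p) \<in> P" "l q = s"
      using P.l_ext[OF P.P_Field1[OF mono(1)[OF refl[OF p]]] s(1,2)] s(3) by auto
    obtain q' where q': "(q', \<rho> p) \<in> Q" "k q' = t"
      using Q.l_ext[OF Q.P_Field1[OF mono(2)[OF refl[OF p]]] t(1,2)] t(3) by auto
    obtain r where "(r, p) \<in> X" "\<pi> r = q" "\<rho> r = q'" using lift[OF p q(1) q'(1)] by iprover
    thus "\<exists>q. (q, p) \<in> X \<and> (l \<circ> \<pi>) q = s \<and> (k \<circ> \<rho>) q = t"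
      using q(2) q'(2) by (intro exI[of _ r]) simp
  qed
qed

lemma two_readings_prod:
  assumes P: "self_reading P G l M" and Q: "self_reading Q H k N"
  shows "two_readings (P \<otimes> Q) G (l \<circ> fst) (lift_name (P \<otimes> Q) fst M) H (k \<circ> snd) (lift_name (P \<otimes> Q) snd N)"
proof (rule lift_two_readings[OF P Q])
  have PQ: "forcing_notion P" "forcing_notion Q"
    using P Q unfolding self_reading_def reading_def by blast+
  show "forcing_notion (P \<otimes> Q)" by (rule forcing_notion_prod[OF PQ])
  show "(fst q, fst p) \<in> P" "(snd q, snd p) \<in> Q" if "(q, p) \<in> P \<otimes> Q" for p q
    using that by (cases p; cases q; simp add: prod_forcing_iff)+
  show "\<exists>r. (r, p) \<in> P \<otimes> Q \<and> fst r = q \<and> snd r = q'"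
    if "p \<in> Field (P \<otimes> Q)" "(q, fst p) \<in> P" "(q', snd p) \<in> Q" for p q q'
    using that(2,3) by (cases p) (simp add: prod_forcing_def)
qed

lemma two_readings_prod3:
  assumes P: "self_reading P G l M" and Q: "self_reading Q H k N" and R: "forcing_notion R"
  shows "two_readings (P \<otimes> Q \<otimes> R) G (l \<circ> fst) (lift_name (P \<otimes> Q \<otimes> R) fst M)
    H (k \<circ> (fst \<circ> snd)) (lift_name (P \<otimes> Q \<otimes> R) (fst \<circ> snd) N)"
proof (rule lift_two_readings[OF P Q])
  have PQ: "forcing_notion P" "forcing_notion Q"
    using P Q unfolding self_reading_def reading_def by blast+
  note QR = forcing_notion_prod[OF PQ(2) R]
  show "forcing_notion (P \<otimes> Q \<otimes> R)" by (rule forcing_notion_prod[OF PQ(1) QR])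
  show "(fst q, fst p) \<in> P" "((fst \<circ> snd) q, (fst \<circ> snd) p) \<in> Q" if "(q, p) \<in> P \<otimes> Q \<otimes> R" for p q
    using that by (cases p; cases q; simp add: prod_forcing_def; fail)+
  show "\<exists>r. (r, p) \<in> P \<otimes> Q \<otimes> R \<and> fst r = q \<and> (fst \<circ> snd) r = q'"
    if "p \<in> Field (P \<otimes> Q \<otimes> R)" "(q, fst p) \<in> P" "(q', (fst \<circ> snd) p) \<in> Q" for p q q'
  proof -
    obtain x y z where p: "p = (x, y, z)" by (cases p) auto
    have "z \<in> Field R"
      using that(1) unfolding p Field_prod_forcing[OF PQ(1) QR] Field_prod_forcing[OF PQ(2) R] by simp
    hence "(z, z) \<in> R" by (rule forcing_notion_refl[OF R])
    thus ?thesis using that(2,3) by (intro exI[of _ "(q, q', z)"]) (simp add: p prod_forcing_def)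
  qed
qed

lemma self_reading_seq_forcing:
  fixes X :: "'x::ab_group_add set"
  assumes e: "inj_on e (dlists X)" and inf: "infinite X" and zero: "0 \<in> X"
    and add: "\<And>x y. x \<in> X \<Longrightarrow> y \<in> X \<Longrightarrow> x + y \<in> X" and uminus: "\<And>x. x \<in> X \<Longrightarrow> - x \<in> X"
  shows "self_reading (seq_forcing e X) X (dec e X) (grp_name e X)"
proof
  let ?P = "seq_forcing e X" and ?d = "dec e X"
  show "forcing_notion ?P" by (rule forcing_notion_seq_forcing[OF e])
  show "prefix (?d p) (?d q)" if "(q, p) \<in> ?P" for p q using that unfolding seq_forcing_iff[OF e] by iprover
  show "distinct (?d p)" "set (?d p) \<subseteq> X" if "p \<in> Field ?P" for p
    using dec_dlists[OF e that] unfolding dlists_def by simp_all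
  show "\<exists>q. (q, p) \<in> ?P \<and> ?d q = s" if "p \<in> Field ?P" "distinct s" "set s \<subseteq> X" "prefix (?d p) s" for p s
    using seq_forcing_extend[OF e that(1) _ that(4)] that(2,3) unfolding dlists_def
    by (intro exI[of _ "e s"]) simp
  show self: "((a, b, c), r) \<in> grp_name e X"
    if "r \<in> Field ?P" "a < length (?d r)" "b < length (?d r)" "c < length (?d r)" "?d r ! a + ?d r ! b = ?d r ! c"
    for r a b c
    unfolding grp_name_def mem_Collect_eq
    by (intro exI[of _ a] exI[of _ b] exI[of _ c] exI[of _ "?d r"])
       (simp add: e_dec[OF e that(1)] dec_dlists[OF e that(1)] that)
  show "(\<exists>s. ((a, b, c), s) \<in> grp_name e X \<and> (r, s) \<in> ?P) \<longleftrightarrow>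
      a < length (?d r) \<and> b < length (?d r) \<and> c < length (?d r) \<and> ?d r ! a + ?d r ! b = ?d r ! c"
    if r: "r \<in> Field ?P" for a b c r
  proof
    assume "\<exists>s. ((a, b, c), s) \<in> grp_name e X \<and> (r, s) \<in> ?P"
    then obtain s where s: "((a, b, c), s) \<in> grp_name e X" "(r, s) \<in> ?P" by iprover
    from s(1) obtain s' where s': "s = e s'" "s' \<in> dlists X" "a < length s'" "b < length s'" "c < length s'"
      "s' ! a + s' ! b = s' ! c" unfolding grp_name_def by fast
    have "prefix s' (?d r)" using s(2) unfolding seq_forcing_iff[OF e] s'(1) dec_e[OF e s'(2)] by iprover
    then obtain zs where "?d r = s' @ zs" by (rule prefixE)
    thus "a < length (?d r) \<and> b < length (?d r) \<and> c < length (?d r) \<and> ?d r ! a + ?d r ! b = ?d r ! c"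
      using s' by (simp add: nth_append)
  next
    assume "a < length (?d r) \<and> b < length (?d r) \<and> c < length (?d r) \<and> ?d r ! a + ?d r ! b = ?d r ! c"
    hence "((a, b, c), r) \<in> grp_name e X" by (elim conjE) (rule self[OF r])
    moreover have "(r, r) \<in> ?P" using r unfolding seq_forcing_iff[OF e] Field_seq_forcing[OF e] by simp
    ultimately show "\<exists>s. ((a, b, c), s) \<in> grp_name e X \<and> (r, s) \<in> ?P" by iprover
  qed
qed (fact inf zero add uminus)+

section \<open>Descending sequences\<close>

text \<open>The second components are mere labels: each node has infinitely many children over each ordinal,
  so that a child outside the support of a given group element exists.\<close>

fun desc :: "'v rel \<Rightarrow> ('v \<times> nat) list \<Rightarrow> bool" where
  "desc r [] = True"
| "desc r [a] = (fst a \<in> Field r)"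
| "desc r (a # b # t) = (fst a \<in> underS r (fst b) \<and> desc r (b # t))"

lemma desc_tl: "desc r (a # t) \<Longrightarrow> desc r t"
  by (cases t) simp_all

lemma desc_suffix: "desc r t \<Longrightarrow> suffix s t \<Longrightarrow> desc r s"
proof (induction t)
  case (Cons a t)
  thus ?case using desc_tl[of r a t] by (cases "s = a # t") (simp_all add: suffix_Cons)
qed simp

lemma desc_label: "desc r ((x, m) # t) \<Longrightarrow> desc r ((x, n) # t)"
  by (cases t) simp_all

lemma desc_set: "desc r t \<Longrightarrow> set t \<subseteq> Field r \<times> UNIV"
proof (induction r t rule: desc.induct)
  case (2 r a)
  thus ?case by (cases a) simp
next
  case (3 r a b t)
  have "fst a \<in> underS r (fst b)" using 3(2) by simp
  hence "fst a \<in> Field r" by (rule underS_Field)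
  thus ?case using 3 by (cases a) simp
qed simp

lemma desc_no_branch:
  assumes wo: "Well_order r" and s: "s 0 = []" "\<And>n. desc r (s n)" "\<And>n. s (Suc n) \<noteq> []" "\<And>n. tl (s (Suc n)) = s n"
  shows False
proof -
  have wf: "wf (r - Id)" using wo by (simp add: well_order_on_def)
  define y where "y n = fst (hd (s (Suc n)))" for n
  have "(y (Suc n), y n) \<in> r - Id" for n
  proof -
    obtain b where b: "s (Suc n) = b # s n" using s(3,4)[of n] by (metis list.collapse)
    obtain a where a: "s (Suc (Suc n)) = a # s (Suc n)" using s(3,4)[of "Suc n"] by (metis list.collapse)
    have "desc r (a # b # s n)" using s(2)[of "Suc (Suc n)"] a b by simp
    thus ?thesis using a b by (simp add: y_def underS_def)
  qed
  thus False using wf unfolding wf_iff_no_infinite_down_chain by blast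
qed

lemma underS_trans: "Well_order r \<Longrightarrow> x \<in> underS r z \<Longrightarrow> y \<in> underS r x \<Longrightarrow> y \<in> underS r z"
  using underS_incr[of r x z] unfolding order_on_defs underS_def
  by (auto dest: transD antisymD)

lemma desc_weaken:
  assumes "Well_order r" "desc r ((x, m) # t)" "y \<in> underS r x"
  shows "desc r ((y, m) # t)"
proof (cases t)
  case Nil
  thus ?thesis using underS_Field[OF assms(3)] by simp
next
  case (Cons b u)
  thus ?thesis using assms(2) underS_trans[OF assms(1) _ assms(3)] by simp
qed

text \<open>Countably many labels can each have a predicate of their own. Otherwise the predicates
  are transported along an injection into the field of \<open>\<alpha>\<close>, whose cardinal is at
  most \<open>\<alpha>\<close> and hence fails the partition relation.\<close>

lemma rigid_family_exists:
  fixes \<alpha> :: "'v rel"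
  assumes wo: "Well_order \<alpha>" and k: "\<forall>\<kappa> :: 'v rel. is_kappa_omega \<kappa> \<longrightarrow> \<alpha> <o \<kappa>"
    and L: "countable L \<or> |L| \<le>o |Field \<alpha>|"
  shows "\<exists>P :: nat \<Rightarrow> 'l list \<Rightarrow> bool. \<forall>x. range x \<subseteq> L \<longrightarrow>
     (\<forall>k n. P k (map x [0..<Suc n]) \<longrightarrow> P k (map x [1..<Suc (Suc n)])) \<longrightarrow> x 0 = x 1"
  using L
proof
  assume L: "countable L"
  show ?thesis
  proof (intro exI[of _ "\<lambda>k \<eta>. to_nat_on L (hd \<eta>) = k"] allI impI)
    fix x :: "nat \<Rightarrow> 'l" assume x: "range x \<subseteq> L"
      and shift: "\<forall>k n. to_nat_on L (hd (map x [0..<Suc n])) = k \<longrightarrow> to_nat_on L (hd (map x [1..<Suc (Suc n)])) = k"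
    have "to_nat_on L (x 1) = to_nat_on L (x 0)" using shift[rule_format, of 0 "to_nat_on L (x 0)"] by simp
    thus "x 0 = x 1" using x inj_on_to_nat_on[OF L] by (simp add: inj_on_eq_iff range_subsetD)
  qed
next
  assume L: "|L| \<le>o |Field \<alpha>|"
  have na: "\<not> arrow_omega |Field \<alpha>|"
  proof
    assume a: "arrow_omega |Field \<alpha>|"
    \<comment> \<open>If the relation held, the least cardinal satisfying it would be
      \<kappa>(\<omega>) and at most \<open>\<alpha>\<close>. This covers the case where
      \<kappa>(\<omega>) does not exist.\<close>
    define R where "R = {\<kappa> :: 'v rel. Card_order \<kappa> \<and> arrow_omega \<kappa>}"
    have m: "|Field \<alpha>| \<in> R" unfolding R_def using a card_of_Card_order by simp
    hence "R \<noteq> {}" by blast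
    from exists_minim_Card_order[OF this] obtain \<kappa> where \<kappa>: "\<kappa> \<in> R" "\<forall>r\<in>R. \<kappa> \<le>o r" unfolding R_def by auto
    have "is_kappa_omega \<kappa>" using \<kappa> unfolding is_kappa_omega_def R_def by simp
    hence "\<alpha> <o \<kappa>" using k by simp
    moreover have "\<kappa> \<le>o \<alpha>" by (rule ordLeq_transitive[OF bspec[OF \<kappa>(2) m] card_of_least[OF wo]])
    ultimately show False using not_ordLess_ordLeq by blast
  qed
  obtain g where g: "inj_on g L" "g ` L \<subseteq> Field \<alpha>" using L unfolding card_of_ordLeq[symmetric] by blast
  obtain P :: "nat \<Rightarrow> 'v list \<Rightarrow> bool" where P: "\<And>x. range x \<subseteq> Field \<alpha> \<Longrightarrow>
     (\<forall>k n. P k (map x [0..<Suc n]) \<longrightarrow> P k (map x [1..<Suc (Suc n)])) \<Longrightarrow> x 0 = x 1"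
    using not_arrow_omega_imp_rigid[OF card_of_Well_order na] unfolding Field_card_of by metis
  show ?thesis
  proof (intro exI[of _ "\<lambda>k \<eta>. P k (map g \<eta>)"] allI impI)
    fix x :: "nat \<Rightarrow> 'l" assume x: "range x \<subseteq> L"
      and shift: "\<forall>k n. P k (map g (map x [0..<Suc n])) \<longrightarrow> P k (map g (map x [1..<Suc (Suc n)]))"
    have "(g \<circ> x) 0 = (g \<circ> x) 1"
    proof (rule P)
      show "range (g \<circ> x) \<subseteq> Field \<alpha>" using x g(2) by auto
      show "\<forall>k n. P k (map (g \<circ> x) [0..<Suc n]) \<longrightarrow> P k (map (g \<circ> x) [1..<Suc (Suc n)])"
        using shift unfolding map_map .
    qed
    thus "x 0 = x 1" using x g(1) by (simp add: inj_on_eq_iff range_subsetD)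
  qed
qed

lemma prime_coding_exists: "\<exists>q :: idx \<Rightarrow> nat. inj q \<and> (\<forall>k. prime (q k) \<and> q k mod 9 = 1)"
proof -
  obtain f :: "nat \<Rightarrow> nat" where f: "inj f" "range f \<subseteq> {q. prime q \<and> q mod 9 = 1}"
    using infinite_countable_subset[OF primes_1_mod_9_infinite] by blast
  define c where "c k = (case k of Pred n \<Rightarrow> prod_encode (0, n) | Len n \<Rightarrow> prod_encode (1, n)
    | Lnk n \<Rightarrow> prod_encode (2, n) | Wp \<Rightarrow> prod_encode (3, 0) | Cp \<Rightarrow> prod_encode (4, 0))" for k
  have "inj c"
  proof (rule injI)
    fix a b assume "c a = c b"
    thus "a = b" by (cases a; cases b) (simp_all add: c_def)
  qed
  hence "inj (f \<circ> c)" using f(1) by (rule inj_compose[rotated])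
  moreover have "prime ((f \<circ> c) k) \<and> (f \<circ> c) k mod 9 = 1" for k using range_subsetD[OF f(2), of "c k"] by simp
  ultimately show ?thesis by blast
qed

section \<open>Supports, sizes and pinned names of the coded groups\<close>

definition nodes :: "('a bas \<Rightarrow>\<^sub>0 rat) \<Rightarrow> 'a list set" where
  "nodes x = (\<Union>b\<in>keys x. snd ` set (fst b) \<union> set_option (snd b))"

lemma finite_nodes: "finite (nodes x)"
proof -
  have "finite (set_option i)" for i :: "'a list option" by (cases i) simp_all
  thus ?thesis unfolding nodes_def by simp
qed

lemma keys_subset_bas_of_iff: "keys x \<subseteq> bas_of N \<longleftrightarrow> nodes x \<subseteq> N"
proof -
  have "b \<in> bas_of N \<longleftrightarrow> snd ` set (fst b) \<union> set_option (snd b) \<subseteq> N" for b :: "'a bas"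
    unfolding bas_of_def by (cases b) simp
  thus ?thesis unfolding nodes_def UN_subset_iff subset_eq[of "keys x"] by blast
qed

lemma lookup_nsum: "lookup (nsum n x) b = of_nat n * lookup x b"
  by (induction n) (simp_all add: lookup_add algebra_simps)

lemma nsum_torsion_free: "n > 0 \<Longrightarrow> nsum n x = 0 \<Longrightarrow> (x :: 'b \<Rightarrow>\<^sub>0 rat) = 0"
proof (rule poly_mapping_eqI)
  fix b assume n: "n > 0" "nsum n x = 0"
  have "of_nat n * lookup x b = 0" using n(2) lookup_nsum[of n x b] by simp
  thus "lookup x b = lookup 0 b" using n(1) by simp
qed

text \<open>Any two generic enumerations list the same ground model group, so the identity induces
  an isomorphism of the two copies.\<close>

lemma pinned_name_seq_forcing:
  fixes X :: "('b \<Rightarrow>\<^sub>0 rat) set" and e :: "_ \<Rightarrow> 'v"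
  assumes e: "inj_on e (dlists X)" and S: "self_reading (seq_forcing e X) X (dec e X) (grp_name e X)"
  shows "pinned_name TFAG (seq_forcing e X) (grp_name e X)"
proof -
  let ?P = "seq_forcing e X" and ?M = "grp_name e X"
  interpret S: self_reading ?P X "dec e X" ?M by fact
  interpret S2: two_readings "?P \<otimes> ?P" X "dec e X \<circ> fst" "lift_name (?P \<otimes> ?P) fst ?M" X "dec e X \<circ> snd"
    "lift_name (?P \<otimes> ?P) snd ?M"
    by (rule two_readings_prod[OF S S])
  have "is_name ?P ?M" unfolding is_name_def grp_name_def Field_seq_forcing[OF e] by auto
  moreover have "TFAG ?P ?M p" if "p \<in> Field ?P" for p
    by (rule S.forces_TFAG[OF _ that]) (rule nsum_torsion_free)
  moreover have "forces_iso (?P \<otimes> ?P) (lift_name (?P \<otimes> ?P) fst ?M) (lift_name (?P \<otimes> ?P) snd ?M) p"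
    if "p \<in> Field (?P \<otimes> ?P)" for p
    by (rule S2.forces_iso_graph[where \<theta> = id, OF _ _ _ that]) simp_all
  ultimately show ?thesis unfolding pinned_name_def forced_def Let_def using S.forcing by simp
qed

context coded_group
begin

lemma Grp_nodes: "{g \<in> Grp j T. nodes g \<subseteq> A} = Grp j (A \<inter> T)"
  unfolding Grp_def keys_subset_bas_of_iff by blast

lemma countable_Grp: "countable A \<Longrightarrow> countable (Grp j A)"
proof -
  assume "countable A"
  hence "|A| \<le>o |UNIV :: nat set|" by (rule card_of_countable_ordLeq_infinite[OF infinite_UNIV_nat])
  hence "|{x :: 'a bas \<Rightarrow>\<^sub>0 rat. keys x \<subseteq> bas_of A}| \<le>o |UNIV :: nat set|"
    by (intro card_of_poly_mapping_infinite card_of_bas_of_infinite infinite_UNIV_nat)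
  then obtain f :: "_ \<Rightarrow> nat" where "inj_on f {x :: 'a bas \<Rightarrow>\<^sub>0 rat. keys x \<subseteq> bas_of A}"
    unfolding card_of_ordLeq[symmetric] by blast
  hence "countable {x :: 'a bas \<Rightarrow>\<^sub>0 rat. keys x \<subseteq> bas_of A}" unfolding countable_def by blast
  thus ?thesis by (rule countable_subset[rotated]) (auto simp: Grp_def)
qed

lemma infinite_Grp: "infinite (Grp j N)"
proof -
  define u :: "'a bas \<Rightarrow>\<^sub>0 rat" where "u = Poly_Mapping.single ([], None) 1"
  have "u \<in> Grp j N" unfolding u_def by (rule Grp_basis) (simp add: bas_of_def)
  hence "nsum n u \<in> Grp j N" for n by (induction n) (simp_all add: Grp_add)
  moreover have "inj (\<lambda>n. nsum n u)"
  proof (rule injI)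
    fix m n assume "nsum m u = nsum n u"
    hence "lookup (nsum m u) ([], None) = lookup (nsum n u) ([], None)" by simp
    thus "m = n" unfolding lookup_nsum u_def by simp
  qed
  ultimately show ?thesis using infinite_super[of "range (\<lambda>n. nsum n u)"] finite_imageD[of "\<lambda>n. nsum n u" UNIV]
    by blast
qed

lemma card_of_Grp_infinite: "infinite B \<Longrightarrow> |N| \<le>o |B| \<Longrightarrow> |Grp j N| \<le>o |B|"
  by (rule ordLeq_transitive[OF card_of_mono1 card_of_poly_mapping_infinite[OF _ card_of_bas_of_infinite]])
     (auto simp: Grp_def)

lemma self_reading_Grp:
  "inj_on e (dlists (Grp j N)) \<Longrightarrow>
    self_reading (seq_forcing e (Grp j N)) (Grp j N) (dec e (Grp j N)) (grp_name e (Grp j N))"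
  by (rule self_reading_seq_forcing) (simp_all add: infinite_Grp Grp_add Grp_uminus)

end

section \<open>The strategy of the duplicator\<close>

lemma (in coded_group) fresh_Cons_suffix: "fresh t x \<Longrightarrow> fresh (a # t) x"
  unfolding fresh_def by (auto dest: suffix_ConsD)

text \<open>Only finitely many entries occur in the first labels of the support of \<open>x\<close>;
  an entry whose label \<open>m\<close> differs from all of theirs makes the prolonged node
  fresh.\<close>

lemma (in coded_group) fresh_label_exists: "infinite (UNIV :: 'b set) \<Longrightarrow> \<exists>m :: 'b. \<forall>a. c a = m \<longrightarrow> fresh (a # t) x"
proof -
  assume inf: "infinite (UNIV :: 'b set)"
  have "finite (c ` (\<Union>b\<in>keys x. set (snd (hd (fst b)))))" by simp
  then obtain m where m: "m \<notin> c ` (\<Union>b\<in>keys x. set (snd (hd (fst b))))" using ex_new_if_finite[OF inf] by blast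
  show ?thesis
  proof (intro exI[of _ m] allI impI)
    fix a assume a: "c a = m"
    show "fresh (a # t) x" unfolding fresh_def
    proof (intro ballI impI notI)
      fix b assume b: "b \<in> keys x" "suffix (a # t) (snd (hd (fst b)))"
      have "a \<in> set (snd (hd (fst b)))" using set_mono_suffix[OF b(2)] by simp
      thus False using m a b(1) by blast
    qed
  qed
qed

lemma (in coded_group) flex_hom:
  assumes t: "\<And>n. suffix n t \<Longrightarrow> n \<in> N" and e: "(j, e, j') = (0, 1, 1) \<or> (j, e, j') = (1, -1, 0)"
  shows "(\<forall>x\<in>Grp j N. flex t e x \<in> Grp j' N) \<and> inj_on (flex t e) (Grp j N) \<and>
    (\<forall>x\<in>Grp j N. \<forall>y\<in>Grp j N. flex t e (x + y) = flex t e x + flex t e y)"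
proof -
  have "e = 1 \<or> e = -1" using e by auto
  hence "inj_on (flex t e) (Grp j N)" using inj_flex inj_on_subset by blast
  thus ?thesis using flex_Grp[OF _ t e] flex_add by blast
qed

locale node_group = coded_group P q
  for P :: "nat \<Rightarrow> ('v \<times> nat) lab list \<Rightarrow> bool" and q +
  fixes \<alpha> :: "'v rel"
  assumes wo: "Well_order \<alpha>" and rigid: "rigid_on (UNIV \<times> {t. desc \<alpha> t})"
begin

abbreviation G :: "nat \<Rightarrow> (('v \<times> nat) bas \<Rightarrow>\<^sub>0 rat) set" where "G j \<equiv> Grp j {t. desc \<alpha> t}"

text \<open>The node \<open>t\<close> is the path played so far, and every ordinal left on the clock
  can prolong it; the label \<open>0\<close> stands for any label by \<open>desc_label\<close>.
  Freshness makes \<open>flex t 1\<close> invertible on the moves and keeps their images unchanged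
  when \<open>t\<close> grows.\<close>

definition B :: "'v set \<Rightarrow> (('v \<times> nat) bas \<Rightarrow>\<^sub>0 rat) list \<Rightarrow> (('v \<times> nat) bas \<Rightarrow>\<^sub>0 rat) list \<Rightarrow> bool" where
  "B I gs hs \<longleftrightarrow> (\<exists>t. desc \<alpha> t \<and> (\<forall>x\<in>I. desc \<alpha> ((x, 0) # t)) \<and> set gs \<subseteq> G 0 \<and>
     (\<forall>g\<in>set gs. fresh t g) \<and> hs = map (flex t 1) gs)"

lemma suffix_desc: "desc \<alpha> t \<Longrightarrow> suffix n t \<Longrightarrow> n \<in> {t. desc \<alpha> t}"
  using desc_suffix by simp

lemma B_initial: "B (Field \<alpha>) [] []"
  unfolding B_def by (intro exI[of _ "[]"]) simp

lemma B_weaken: "B I gs hs \<Longrightarrow> x \<in> I \<Longrightarrow> B (underS \<alpha> x) gs hs"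
  unfolding B_def using desc_weaken[OF wo] by (elim exE conjE) (intro exI conjI ballI; blast)

lemma B_forth_emb:
  assumes "B I gs hs"
  shows "\<exists>\<theta>. (\<forall>x\<in>G 0. \<theta> x \<in> G 1) \<and> inj_on \<theta> (G 0) \<and>
      (\<forall>x\<in>G 0. \<forall>y\<in>G 0. \<theta> (x + y) = \<theta> x + \<theta> y) \<and> map \<theta> gs = hs"
proof -
  obtain t where t: "desc \<alpha> t" "hs = map (flex t 1) gs" using assms unfolding B_def by fast
  have "(\<forall>x\<in>G 0. flex t 1 x \<in> G 1) \<and> inj_on (flex t 1) (G 0) \<and>
    (\<forall>x\<in>G 0. \<forall>y\<in>G 0. flex t 1 (x + y) = flex t 1 x + flex t 1 y)"
    by (rule flex_hom) (use suffix_desc[OF t(1)] in simp_all)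
  thus ?thesis using t(2) by (intro exI[of _ "flex t 1"]) simp
qed

lemma B_back_emb:
  assumes "B I gs hs"
  shows "\<exists>\<theta>. (\<forall>x\<in>G 1. \<theta> x \<in> G 0) \<and> inj_on \<theta> (G 1) \<and>
      (\<forall>x\<in>G 1. \<forall>y\<in>G 1. \<theta> (x + y) = \<theta> x + \<theta> y) \<and> map \<theta> hs = gs"
proof -
  obtain t where t: "desc \<alpha> t" "hs = map (flex t 1) gs" "\<forall>g\<in>set gs. fresh t g"
    using assms unfolding B_def by fast
  have "(\<forall>x\<in>G 1. flex t (-1) x \<in> G 0) \<and> inj_on (flex t (-1)) (G 1) \<and>
    (\<forall>x\<in>G 1. \<forall>y\<in>G 1. flex t (-1) (x + y) = flex t (-1) x + flex t (-1) y)"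
    by (rule flex_hom) (use suffix_desc[OF t(1)] in simp_all)
  moreover have "map (flex t (-1)) hs = gs"
    unfolding t(2) map_map by (rule map_idI) (use flex_inverse[where e = 1] t(3) in simp)
  ultimately show ?thesis by iprover
qed

text \<open>The clock value \<open>x\<close> becomes the next entry of the path. The label
  \<open>m\<close> is left open, to be chosen after the spoiler has named an element.\<close>

lemma B_extend:
  assumes "B I gs hs" and x: "x \<in> I"
  shows "\<exists>t. (\<forall>m. desc \<alpha> ((x, m) # t)) \<and> (\<forall>m g. g \<in> G 0 \<longrightarrow> fresh ((x, m) # t) g \<longrightarrow>
    B (underS \<alpha> x) (gs @ [g]) (hs @ [flex ((x, m) # t) 1 g]))"
proof -
  obtain t where t: "desc \<alpha> t" "\<forall>x\<in>I. desc \<alpha> ((x, 0) # t)" "set gs \<subseteq> G 0" "\<forall>g\<in>set gs. fresh t g"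
    "hs = map (flex t 1) gs" using assms(1) unfolding B_def by fast
  have d: "desc \<alpha> ((x, m) # t)" for m by (rule desc_label[OF bspec[OF t(2) x]])
  have "B (underS \<alpha> x) (gs @ [g]) (hs @ [flex ((x, m) # t) 1 g])"
    if g: "g \<in> G 0" "fresh ((x, m) # t) g" for m g
    unfolding B_def
  proof (intro exI[of _ "(x, m) # t"] conjI)
    show "desc \<alpha> ((x, m) # t)" by (rule d)
    show "\<forall>y\<in>underS \<alpha> x. desc \<alpha> ((y, 0) # (x, m) # t)" using d by simp
    show "set (gs @ [g]) \<subseteq> G 0" using t(3) g(1) by simp
    show "\<forall>g\<in>set (gs @ [g]). fresh ((x, m) # t) g" using t(4) fresh_Cons_suffix g(2) by simp
    have "flex ((x, m) # t) 1 y = flex t 1 y" if "y \<in> set gs" for y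
      by (rule flex_extend[OF bspec[OF t(4) that] refl])
    hence "map (flex ((x, m) # t) 1) gs = hs" unfolding t(5) by (rule map_cong[OF refl])
    thus "hs @ [flex ((x, m) # t) 1 g] = map (flex ((x, m) # t) 1) (gs @ [g])" by simp
  qed
  thus ?thesis using d by (intro exI[of _ t] conjI allI impI)
qed

lemma B_forth:
  assumes "B I gs hs" "x \<in> I" "g \<in> G 0"
  shows "\<exists>h\<in>G 1. B (underS \<alpha> x) (gs @ [g]) (hs @ [h])"
proof -
  obtain t where t: "\<forall>m. desc \<alpha> ((x, m) # t)"
    "\<forall>m g. g \<in> G 0 \<longrightarrow> fresh ((x, m) # t) g \<longrightarrow> B (underS \<alpha> x) (gs @ [g]) (hs @ [flex ((x, m) # t) 1 g])"
    using B_extend[OF assms(1,2)] by (elim exE conjE)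
  obtain m where m: "fresh ((x, m) # t) g"
    using fresh_label_exists[OF infinite_UNIV_nat, of snd t g] by (metis snd_conv)
  have "flex ((x, m) # t) 1 g \<in> G 1"
    by (rule flex_Grp[OF assms(3)]) (use suffix_desc[OF t(1)[rule_format]] in simp_all)
  thus ?thesis using t(2)[rule_format, OF assms(3)] m by (intro bexI[rotated]) simp_all
qed

text \<open>The answer is the image of \<open>h\<close> under \<open>flex\<close> with
  \<open>-1\<close>. It inherits freshness from \<open>h\<close>, and freshness of \<open>h\<close>
  makes \<open>flex\<close> with \<open>1\<close> lead back to \<open>h\<close>.\<close>

lemma B_back:
  assumes "B I gs hs" "x \<in> I" "h \<in> G 1"
  shows "\<exists>g\<in>G 0. B (underS \<alpha> x) (gs @ [g]) (hs @ [h])"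
proof -
  obtain t where t: "\<forall>m. desc \<alpha> ((x, m) # t)"
    "\<forall>m g. g \<in> G 0 \<longrightarrow> fresh ((x, m) # t) g \<longrightarrow> B (underS \<alpha> x) (gs @ [g]) (hs @ [flex ((x, m) # t) 1 g])"
    using B_extend[OF assms(1,2)] by (elim exE conjE)
  obtain m where m: "fresh ((x, m) # t) h"
    using fresh_label_exists[OF infinite_UNIV_nat, of snd t h] by (metis snd_conv)
  define g where "g = flex ((x, m) # t) (-1) h"
  have g: "g \<in> G 0" unfolding g_def
    by (rule flex_Grp[OF assms(3)]) (use suffix_desc[OF t(1)[rule_format]] in simp_all)
  have "flex ((x, m) # t) 1 g = h" using flex_inverse[OF m, of "-1"] by (simp add: g_def)
  moreover have "fresh ((x, m) # t) g" unfolding g_def by (rule fresh_flex[OF m])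
  ultimately show ?thesis using t(2)[rule_format, OF g, of m] g by (intro bexI[of _ g]) simp_all
qed

lemma no_iso_countable:
  assumes A: "[] \<in> A" and f: "bij_betw f (Grp 0 (A \<inter> {t. desc \<alpha> t})) (Grp 1 (A \<inter> {t. desc \<alpha> t}))"
    and add: "\<And>x y. x \<in> Grp 0 (A \<inter> {t. desc \<alpha> t}) \<Longrightarrow> y \<in> Grp 0 (A \<inter> {t. desc \<alpha> t}) \<Longrightarrow> f (x + y) = f x + f y"
  shows False
proof -
  have "UNIV \<times> (A \<inter> {t. desc \<alpha> t}) \<subseteq> (UNIV :: kind set) \<times> {t. desc \<alpha> t}" by blast
  hence R: "rigid_on (UNIV \<times> (A \<inter> {t. desc \<alpha> t}))" using rigid unfolding rigid_on_def by (meson order_trans)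
  obtain s where s: "s 0 = []" "\<forall>n. s n \<in> A \<inter> {t. desc \<alpha> t} \<and> s (Suc n) \<noteq> [] \<and> tl (s (Suc n)) = s n"
    using iso_imp_branch[OF f add R] A by auto
  show False by (rule desc_no_branch[where s = s, OF wo s(1)]) (use s(2) in auto)
qed

lemma not_pinned_iso:
  assumes e: "inj_on e0 (dlists (G 0))" "inj_on e1 (dlists (G 1))"
  shows "\<not> pinned_iso (seq_forcing e0 (G 0)) (grp_name e0 (G 0)) (seq_forcing e1 (G 1)) (grp_name e1 (G 1))"
    (is "\<not> pinned_iso ?P ?M ?Q ?N")
proof
  let ?PQ = "?P \<otimes> ?Q"
  assume iso: "pinned_iso ?P ?M ?Q ?N"
  interpret T: two_readings ?PQ "G 0" "dec e0 (G 0) \<circ> fst" "lift_name ?PQ fst ?M" "G 1" "dec e1 (G 1) \<circ> snd"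
    "lift_name ?PQ snd ?N"
    by (rule two_readings_prod[OF self_reading_Grp[OF e(1)] self_reading_Grp[OF e(2)]])
  have "Field ?PQ \<noteq> {}" using T.L.forcing unfolding forcing_notion_def by iprover
  then obtain p where p: "p \<in> Field ?PQ" by blast
  have "forces_iso ?PQ (lift_name ?PQ fst ?M) (lift_name ?PQ snd ?N) p"
    using iso p unfolding pinned_iso_def forced_def Let_def by blast
  then obtain r F where r: "(r, p) \<in> ?PQ" "forces_isomorphism ?PQ (lift_name ?PQ fst ?M) (lift_name ?PQ snd ?N) F r"
    using T.L.P_refl[OF p] unfolding forces_iso_def fex_def by iprover
  have c: "countable {g \<in> G j. nodes g \<subseteq> A}" if "finite A" for A j
    unfolding Grp_nodes by (rule countable_Grp) (use that in \<open>simp add: countable_finite\<close>)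
  obtain A f where A: "[] \<in> A" and f: "bij_betw f {g \<in> G 0. nodes g \<subseteq> A} {h \<in> G 1. nodes h \<subseteq> A}"
    and add: "\<forall>x y. x \<in> G 0 \<longrightarrow> y \<in> G 0 \<longrightarrow> nodes x \<subseteq> A \<longrightarrow> nodes y \<subseteq> A \<longrightarrow> nodes (x + y) \<subseteq> A \<longrightarrow> f (x + y) = f x + f y"
    using T.iso_countable_subgroups[where nd = nodes and z = "[]", OF finite_nodes _ _ T.L.P_Field1[OF r(1)] r(2)] c
    by iprover
  show False
  proof (rule no_iso_countable[OF A])
    show "bij_betw f (Grp 0 (A \<inter> {t. desc \<alpha> t})) (Grp 1 (A \<inter> {t. desc \<alpha> t}))" using f unfolding Grp_nodes .
    fix x y assume xy: "x \<in> Grp 0 (A \<inter> {t. desc \<alpha> t})" "y \<in> Grp 0 (A \<inter> {t. desc \<alpha> t})"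
    have "x + y \<in> Grp 0 (A \<inter> {t. desc \<alpha> t})" by (rule Grp_add[OF xy])
    thus "f (x + y) = f x + f y" using xy add unfolding Grp_nodes[symmetric] by blast
  qed
qed

lemma pinned_sim_seq_forcing:
  fixes e0 e1 :: "_ \<Rightarrow> 'v"
  assumes inf: "infinite (UNIV :: 'v set)"
    and e: "inj_on e0 (dlists (G 0))" "inj_on e1 (dlists (G 1))"
  shows "pinned_sim \<alpha> (seq_forcing e0 (G 0)) (grp_name e0 (G 0)) (seq_forcing e1 (G 1)) (grp_name e1 (G 1))"
    (is "pinned_sim \<alpha> ?P ?M ?Q ?N")
proof -
  have "|dlists (UNIV :: 'v set)| \<le>o |UNIV :: 'v set|" by (rule card_of_dlists_infinite[OF inf card_of_mono1[OF subset_UNIV]])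
  \<comment> \<open>The forcing that enumerates the whole type collapses every set which injects
    into it, in particular all conditions and names involved.\<close>
  then obtain e2 :: "'v list \<Rightarrow> 'v" where e2: "inj_on e2 (dlists UNIV)" unfolding card_of_ordLeq[symmetric] by blast
  let ?R = "seq_forcing e2 UNIV"
  let ?X = "?P \<otimes> ?Q \<otimes> ?R"
  have R: "forcing_notion ?R" by (rule forcing_notion_seq_forcing[OF e2])
  interpret T: two_readings ?X "G 0" "dec e0 (G 0) \<circ> fst" "lift_name ?X fst ?M" "G 1" "dec e1 (G 1) \<circ> (fst \<circ> snd)"
    "lift_name ?X (fst \<circ> snd) ?N"
    by (rule two_readings_prod3[OF self_reading_Grp[OF e(1)] self_reading_Grp[OF e(2)] R])
  have "forces_sim ?X (lift_name ?X fst ?M) (lift_name ?X (fst \<circ> snd) ?N) \<alpha> [] [] p" if "p \<in> Field ?X" for p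
    by (rule T.forces_sim_of_system[OF wo B_forth_emb B_back_emb B_forth B_back B_weaken that B_initial])
  moreover have c: "collapses ?R A" for A :: "'v set"
    by (rule collapses_seq_forcing[OF e2, of id]) simp_all
  moreover have cM: "collapses ?R M" for M :: "'v gname"
  proof -
    have "|UNIV :: (nat \<times> nat \<times> nat) set| \<le>o |UNIV :: 'v set|"
      by (rule card_of_countable_ordLeq_infinite[OF inf]) simp
    hence "|(UNIV :: (nat \<times> nat \<times> nat) set) \<times> (UNIV :: 'v set)| \<le>o |UNIV :: 'v set|"
      by (rule card_of_Times_ordLeq_infinite[OF inf]) (rule card_of_mono1[OF subset_UNIV])
    then obtain h :: "_ \<Rightarrow> 'v" where "inj_on h ((UNIV :: (nat \<times> nat \<times> nat) set) \<times> (UNIV :: 'v set))"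
      unfolding card_of_ordLeq[symmetric] by blast
    hence "inj_on h M" by (rule inj_on_subset) simp
    thus ?thesis by (rule collapses_seq_forcing[OF e2]) simp
  qed
  ultimately show ?thesis unfolding pinned_sim_def forced_def Let_def using R by (intro exI[of _ ?R] conjI ballI)
qed

end

theorem mainTheorem14:
  fixes \<alpha> :: "'v rel"
  assumes "infinite (UNIV :: 'v set)"
    and "Well_order \<alpha>"
    and "\<forall>\<kappa> :: 'v rel. is_kappa_omega \<kappa> \<longrightarrow> \<alpha> <o \<kappa>"
  shows "\<not> schroeder_bernstein TFAG \<alpha>"
proof -
  let ?T = "{t. desc \<alpha> t}"
  have T: "?T \<subseteq> lists (Field \<alpha> \<times> UNIV)" using desc_set unfolding in_lists_conv_set by blast
  have kind: "countable (UNIV :: kind set)"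
  proof -
    have "(UNIV :: kind set) = {KU, KA, KV}" using kind.exhaust by blast
    thus ?thesis by (metis countable_finite finite.emptyI finite.insertI)
  qed
  \<comment> \<open>For finite \<open>\<alpha>\<close> the tree may have more nodes than
    \<open>\<alpha>\<close> has elements, but it is countable; for infinite \<open>\<alpha>\<close>
    it has no more than \<open>\<alpha>\<close>.\<close>
  have labels: "countable ((UNIV :: kind set) \<times> ?T) \<or> |(UNIV :: kind set) \<times> ?T| \<le>o |Field \<alpha>|"
  proof (cases "finite (Field \<alpha>)")
    case True
    hence "countable (lists (Field \<alpha> \<times> (UNIV :: nat set)))" by (intro countable_lists countable_SIGMA[OF countable_finite]) simp_all
    hence "countable ?T" using T by (rule countable_subset[rotated])
    thus ?thesis using kind by simp
  next
    case False
    note inf = card_of_Times_ordLeq_infinite[OF False] card_of_countable_ordLeq_infinite[OF False]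
    have "|Field \<alpha> \<times> (UNIV :: nat set)| \<le>o |Field \<alpha>|"
      by (rule inf(1)[OF card_of_mono1[OF subset_refl] inf(2)]) simp
    hence "|?T| \<le>o |Field \<alpha>|"
      by (rule ordLeq_transitive[OF card_of_mono1[OF T] card_of_lists_infinite[OF False]])
    thus ?thesis using inf(1)[OF inf(2)[OF kind]] by blast
  qed
  obtain P :: "nat \<Rightarrow> ('v \<times> nat) lab list \<Rightarrow> bool" where P: "\<forall>x. range x \<subseteq> UNIV \<times> ?T \<longrightarrow>
     (\<forall>k n. P k (map x [0..<Suc n]) \<longrightarrow> P k (map x [1..<Suc (Suc n)])) \<longrightarrow> x 0 = x 1"
    using rigid_family_exists[OF assms(2,3) labels] by (elim exE)
  obtain q :: "idx \<Rightarrow> nat" where q: "inj q" "\<forall>k. prime (q k) \<and> q k mod 9 = 1" using prime_coding_exists by (elim exE conjE)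
  interpret coded_group P q by (unfold_locales) (use q in simp_all)
  interpret node_group P q \<alpha> by (unfold_locales) (use P assms(2) in \<open>simp_all add: rigid_on_def\<close>)
  have "|UNIV :: nat set| \<le>o |UNIV :: 'v set|" by (rule card_of_countable_ordLeq_infinite[OF assms(1)]) simp
  hence "|(UNIV :: 'v set) \<times> (UNIV :: nat set)| \<le>o |UNIV :: 'v set|"
    by (rule card_of_Times_ordLeq_infinite[OF assms(1) card_of_mono1[OF subset_UNIV]])
  hence "|lists ((UNIV :: 'v set) \<times> (UNIV :: nat set))| \<le>o |UNIV :: 'v set|" by (rule card_of_lists_infinite[OF assms(1)])
  hence "|?T| \<le>o |UNIV :: 'v set|" by (rule ordLeq_transitive[OF card_of_mono1, rotated]) simp
  hence "|dlists (G j)| \<le>o |UNIV :: 'v set|" for j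
    by (intro card_of_dlists_infinite card_of_Grp_infinite assms(1))
  hence "\<exists>e :: _ \<Rightarrow> 'v. inj_on e (dlists (G j))" for j
    unfolding card_of_ordLeq[symmetric] by blast
  then obtain e :: "nat \<Rightarrow> _ \<Rightarrow> 'v" where e: "\<And>j. inj_on (e j) (dlists (G j))" by metis
  show ?thesis
  proof
    assume sb: "schroeder_bernstein TFAG \<alpha>"
    have pinned: "pinned_name TFAG (seq_forcing (e j) (G j)) (grp_name (e j) (G j))" for j
      by (rule pinned_name_seq_forcing[OF e self_reading_Grp[OF e]])
    have "pinned_iso (seq_forcing (e 0) (G 0)) (grp_name (e 0) (G 0)) (seq_forcing (e 1) (G 1)) (grp_name (e 1) (G 1))"
      by (rule sb[unfolded schroeder_bernstein_def, THEN spec, THEN spec, THEN spec, THEN spec, THEN mp,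
            OF conjI[OF pinned conjI[OF pinned pinned_sim_seq_forcing[OF assms(1) e e]]]])
    thus False using not_pinned_iso[OF e e] by (rule notE[rotated])
  qed
qed

end
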